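(* Let $m\ge1$ be an integer, $1<p<\infty$, let $(u,v)$ be a pair of weights on $\mathbb{R}^n$ with $(u,v)\in A_p$, and suppose $u\in A_\infty$. Then for every function $f\in W^{m,1}_{\mathrm{loc}}(\mathbb{R}^n)$ and every cube $Q$ $$\left(\frac{1}{u(Q)}\int_Q|f-P_Qf|^p\,u\,dx\right)^{1/p}\le C\,[u,v]_{A_p}^{1/p}\,\ell(Q)^m\left(\frac{1}{u(Q)}\int_Q|\nabla^m f|^p\,v\,dx\right)^{1/p},$$ where $P_Qf$ is the projection of $f$ on polynomials of degree at most $m-1$ and $C=C_{n,m}$ depends only on $n$ and $m$.
   Context: Cubes are cubes in $\mathbb{R}^n$ with sides parallel to the coordinate axes, with side length $\ell(Q)$. A weight is a locally integrable non-negative function; $u(Q)=\int_Q u\,dx$. $A_\infty=\bigcup_{q\ge1}A_q$ is the union of the one-weight Muckenhoupt classes. $(u,v)\in A_p$ means $$[u,v]_{A_p}:=\sup_Q\left(\frac{1}{|Q|}\int_Q u\,dx\right)\left(\frac{1}{|Q|}\int_Q v^{1-p'}\,dx\right)^{p-1}<\infty,\qquad p'=\frac{p}{p-1}.$$ $\nabla^m f=\{D^\sigma f\}_{|\sigma|=m}$ and $|\nabla^m f|=\sum_{|\sigma|=m}|D^\sigma f|$. For a cube $Q$, equip the space of polynomials of degree at most $m-1$ in $n$ variables with the inner product $\langle f,g\rangle_Q=\frac{1}{|Q|}\int_Q fg\,dx$ and let $\{\phi_r\}$ be an orthonormal basis; then $P_Qf=\sum_r\left(\frac{1}{|Q|}\int_Q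 f\phi_r\,dx\right)\phi_r$. *)

theory Defs
  imports "HOL-Analysis.Analysis"
begin

section \<open>Powers of extended non-negative reals\<close>

text \<open>Continuous extension of \<open>powr\<close> to \<open>0\<close> and \<open>top\<close>: a negative power of \<open>0\<close> is \<open>top\<close>
  (whereas \<open>0 powr a = 0\<close> for reals).\<close>

definition epowr :: "ennreal \<Rightarrow> real \<Rightarrow> ennreal" where
  "epowr x a =
     (if a = 0 then 1
      else if x = 0 then (if a < 0 then top else 0)
      else if x = top then (if a < 0 then 0 else top)
      else ennreal (enn2real x powr a))"

section \<open>Cubes and weights\<close>

text \<open>The cube with lower corner \<open>a\<close> and side length \<open>l\<close>, for \<open>l > 0\<close>.\<close>

definition cube :: "real ^ 'n \<Rightarrow> real \<Rightarrow> (real ^ 'n) set" where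
  "cube a l = cbox a (a + (\<chi> i. l))"

definition locally_integrable :: "(real ^ 'n \<Rightarrow> real) \<Rightarrow> bool" where
  "locally_integrable f \<longleftrightarrow> (\<forall>K. compact K \<longrightarrow> f absolutely_integrable_on K)"

definition weight :: "(real ^ 'n \<Rightarrow> real) \<Rightarrow> bool" where
  "weight w \<longleftrightarrow> locally_integrable w \<and> (\<forall>x. 0 \<le> w x)"

definition wmeasure :: "(real ^ 'n \<Rightarrow> real) \<Rightarrow> (real ^ 'n) set \<Rightarrow> ennreal" where
  "wmeasure u Q = (\<integral>\<^sup>+x\<in>Q. ennreal (u x) \<partial>lebesgue)"

definition nn_average :: "(real ^ 'n) set \<Rightarrow> (real ^ 'n \<Rightarrow> ennreal) \<Rightarrow> ennreal" where
  "nn_average Q g = (\<integral>\<^sup>+x\<in>Q. g x \<partial>lebesgue) / emeasure lebesgue Q"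

text \<open>The constant \<open>[u,v]\<close> of the two-weight class \<open>A\<^sub>p\<close>, for \<open>1 < p\<close>; \<open>p / (p - 1)\<close> is the
  conjugate exponent. The power of \<open>v\<close> is infinite where \<open>v = 0\<close>, and \<open>0 * top = 0\<close>.\<close>

definition Ap_const :: "real \<Rightarrow> (real ^ 'n \<Rightarrow> real) \<Rightarrow> (real ^ 'n \<Rightarrow> real) \<Rightarrow> ennreal" where
  "Ap_const p u v =
     (SUP (a, l) \<in> UNIV \<times> {0<..}.
        nn_average (cube a l) (\<lambda>x. ennreal (u x))
        * epowr (nn_average (cube a l) (\<lambda>x. epowr (ennreal (v x)) (1 - p / (p - 1)))) (p - 1))"

definition Ap_pair :: "real \<Rightarrow> (real ^ 'n \<Rightarrow> real) \<Rightarrow> (real ^ 'n \<Rightarrow> real) \<Rightarrow> bool" where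
  "Ap_pair p u v \<longleftrightarrow> Ap_const p u v < top"

definition A1_weight :: "(real ^ 'n \<Rightarrow> real) \<Rightarrow> bool" where
  "A1_weight u \<longleftrightarrow>
     (\<exists>K\<ge>0. \<forall>a l. 0 < l \<longrightarrow>
        (AE x in lebesgue. x \<in> cube a l \<longrightarrow>
           nn_average (cube a l) (\<lambda>y. ennreal (u y)) \<le> ennreal (K * u x)))"

definition muckenhoupt :: "real \<Rightarrow> (real ^ 'n \<Rightarrow> real) \<Rightarrow> bool" where
  "muckenhoupt q u \<longleftrightarrow> (if q = 1 then A1_weight u else 1 < q \<and> Ap_pair q u u)"

definition Ainfty_weight :: "(real ^ 'n \<Rightarrow> real) \<Rightarrow> bool" where
  "Ainfty_weight u \<longleftrightarrow> (\<exists>q\<ge>1. muckenhoupt q u)"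

section \<open>Weak derivatives and Sobolev spaces\<close>

text \<open>A multi-index is a function \<open>'n \<Rightarrow> nat\<close>.\<close>

definition midx_order :: "('n::finite \<Rightarrow> nat) \<Rightarrow> nat" where
  "midx_order \<sigma> = (\<Sum>i\<in>UNIV. \<sigma> i)"

definition partial :: "'n \<Rightarrow> (real ^ 'n \<Rightarrow> real) \<Rightarrow> real ^ 'n \<Rightarrow> real" where
  "partial i \<phi> x = frechet_derivative \<phi> (at x) (axis i 1)"

definition iter_partial :: "'n list \<Rightarrow> (real ^ 'n \<Rightarrow> real) \<Rightarrow> real ^ 'n \<Rightarrow> real" where
  "iter_partial is \<phi> = foldr partial is \<phi>"

text \<open>\<open>C\<^sup>\<infinity>\<close>: differentiability of all iterated partial derivatives also makes all of them
  continuous.\<close>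

definition smooth :: "(real ^ 'n \<Rightarrow> real) \<Rightarrow> bool" where
  "smooth \<phi> \<longleftrightarrow> (\<forall>is. iter_partial is \<phi> differentiable_on UNIV)"

definition test_function :: "(real ^ 'n \<Rightarrow> real) \<Rightarrow> bool" where
  "test_function \<phi> \<longleftrightarrow> smooth \<phi> \<and> compact (closure {x. \<phi> x \<noteq> 0})"

text \<open>The classical derivative of multi-index \<open>\<sigma>\<close>, used for smooth functions only: there the
  order in which the partial derivatives are taken is immaterial.\<close>

definition mixed_partial :: "('n::finite \<Rightarrow> nat) \<Rightarrow> (real ^ 'n \<Rightarrow> real) \<Rightarrow> real ^ 'n \<Rightarrow> real" where
  "mixed_partial \<sigma> \<phi> = iter_partial (SOME is. \<forall>i. count_list is i = \<sigma> i) \<phi>"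

definition has_weak_derivative ::
  "(real ^ 'n \<Rightarrow> real) \<Rightarrow> ('n::finite \<Rightarrow> nat) \<Rightarrow> (real ^ 'n \<Rightarrow> real) \<Rightarrow> bool" where
  "has_weak_derivative f \<sigma> g \<longleftrightarrow>
     locally_integrable g \<and>
     (\<forall>\<phi>. test_function \<phi> \<longrightarrow>
        (LINT x|lebesgue. f x * mixed_partial \<sigma> \<phi> x)
        = (- 1) ^ midx_order \<sigma> * (LINT x|lebesgue. g x * \<phi> x))"

text \<open>A representative of the weak derivative, which is unique up to null sets.\<close>

definition weak_derivative ::
  "('n::finite \<Rightarrow> nat) \<Rightarrow> (real ^ 'n \<Rightarrow> real) \<Rightarrow> real ^ 'n \<Rightarrow> real" where
  "weak_derivative \<sigma> f = (SOME g. has_weak_derivative f \<sigma> g)"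

text \<open>The space \<open>W\<close> of order \<open>m\<close> and exponent \<open>1\<close>, local version.\<close>

definition sobolev_loc :: "nat \<Rightarrow> (real ^ 'n \<Rightarrow> real) \<Rightarrow> bool" where
  "sobolev_loc m f \<longleftrightarrow>
     locally_integrable f \<and>
     (\<forall>\<sigma>. midx_order \<sigma> \<le> m \<longrightarrow> (\<exists>g. has_weak_derivative f \<sigma> g))"

definition grad_norm :: "nat \<Rightarrow> (real ^ 'n \<Rightarrow> real) \<Rightarrow> real ^ 'n \<Rightarrow> real" where
  "grad_norm m f x = (\<Sum>\<sigma> | midx_order \<sigma> = m. \<bar>weak_derivative \<sigma> f x\<bar>)"

section \<open>Projection on polynomials\<close>

definition polys_upto :: "nat \<Rightarrow> (real ^ 'n \<Rightarrow> real) set" where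
  "polys_upto k =
     {f. \<exists>c. f = (\<lambda>x. \<Sum>\<sigma> | midx_order \<sigma> \<le> k. c \<sigma> * (\<Prod>i\<in>UNIV. (x $ i) ^ \<sigma> i))}"

definition average :: "(real ^ 'n) set \<Rightarrow> (real ^ 'n \<Rightarrow> real) \<Rightarrow> real" where
  "average Q f = (LINT x:Q|lebesgue. f x) / measure lebesgue Q"

definition orthonormal_poly_basis ::
  "nat \<Rightarrow> (real ^ 'n) set \<Rightarrow> (real ^ 'n \<Rightarrow> real) set \<Rightarrow> bool" where
  "orthonormal_poly_basis k Q B \<longleftrightarrow>
     finite B \<and> B \<subseteq> polys_upto k \<and>
     (\<forall>\<phi>\<in>B. \<forall>\<psi>\<in>B. average Q (\<lambda>x. \<phi> x * \<psi> x) = (if \<phi> = \<psi> then 1 else 0)) \<and>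
     (\<forall>f\<in>polys_upto k. \<exists>c. f = (\<lambda>x. \<Sum>\<phi>\<in>B. c \<phi> * \<phi> x))"

text \<open>The projection \<open>P\<^sub>Q\<close> on polynomials of degree at most \<open>k\<close>; it does not depend on the
  choice of the orthonormal basis.\<close>

definition poly_proj :: "nat \<Rightarrow> (real ^ 'n) set \<Rightarrow> (real ^ 'n \<Rightarrow> real) \<Rightarrow> real ^ 'n \<Rightarrow> real" where
  "poly_proj k Q f =
     (let B = SOME B. orthonormal_poly_basis k Q B
      in (\<lambda>x. \<Sum>\<phi>\<in>B. average Q (\<lambda>y. f y * \<phi> y) * \<phi> x))"

end

(*
No self-improvement argument is needed. Let Q_k(x) be the dyadic subcube of Q of generation k
containing x, and P_k the projection on Q_k(x). By the (1,1)-Poincare inequality of order m the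
averages of |f - P_k| are at most C (2^-k l(Q))^m avg_{Q_k(x)} |grad^m f|. This makes
sum_k int_Q |f - P_k| finite, so P_k(x) tends to f(x) almost everywhere, and telescoping gives
  |f - P_Q f|(x) <= C l(Q)^m sum_k 2^-k avg_{Q_k(x)} |grad^m f|.
By the convexity of t^p the p-th power of the sum is at most 2^p times a convex combination of the
p-th powers of the averages, and on each dyadic cube Q' the two-weight condition and Hoelder's
inequality give u(Q') (avg_{Q'} |grad^m f|)^p <= [u,v] int_{Q'} |grad^m f|^p v; summing over the
cubes of one generation yields a bound independent of k.

The Poincare inequality comes from the first-order one by subtracting suitable polynomials; the
first-order one is deduced from the absolute continuity of weakly differentiable functions along
almost all lines in a coordinate direction.
*)

theory Submission
  imports Defs
begin

section \<open>Smooth functions of one variable\<close>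

text \<open>Everything up to the pointwise telescoping bound is an estimate in mean in which neither
  \<open>p\<close> nor the weights occur, so its constants depend on \<open>n\<close> and
  \<open>m\<close> only. The exponent enters once: the weights \<open>(1 / 2) ^ Suc k\<close> have
  sum 1, so Jensen's inequality costs nothing, and the factor \<open>(2 * D) powr p\<close> in front
  becomes \<open>2 * D\<close> under the \<open>p\<close>-th root. The decay
  \<open>(1 / 2) ^ k\<close> is the gain from \<open>l ^ m\<close> on smaller cubes, weakened to the
  first power; this is where \<open>m \<ge> 1\<close> matters. On the Sobolev side the obstacle is
  that weak derivatives are known only through test functions, while the Poincare inequality needs
  increments of the function. A test function containing a window integral turns one into the other
  directly, without mollifying \<open>f\<close>. The projection has a kernel that is bounded
  uniformly over all cubes, by scaling to the unit cube. This one bound makes the projection almost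
  optimal in mean and also controls the difference of the projections on successive dyadic
  cubes.\<close>

definition deriv_tower :: "(nat \<Rightarrow> real \<Rightarrow> real) \<Rightarrow> bool" where
  "deriv_tower F \<longleftrightarrow> (\<forall>k x. (F k has_real_derivative F (Suc k) x) (at x))"

text \<open>A tower records all derivatives at once, which turns differentiation into an index
  shift. Closure under sums and products is easier by induction on a finite order of
  differentiability; \<open>ndiff_imp_deriv_tower\<close> converts back.\<close>

primrec ndiff :: "nat \<Rightarrow> (real \<Rightarrow> real) \<Rightarrow> bool" where
  "ndiff 0 f \<longleftrightarrow> True"
| "ndiff (Suc n) f \<longleftrightarrow> (\<exists>g. (\<forall>x. (f has_real_derivative g x) (at x)) \<and> ndiff n g)"

lemma ndiff_mono: "ndiff (Suc n) f \<Longrightarrow> ndiff n f"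
  by (induction n arbitrary: f) auto

lemma ndiff_add: "ndiff n f \<Longrightarrow> ndiff n g \<Longrightarrow> ndiff n (\<lambda>x. f x + g x)"
proof (induction n arbitrary: f g)
  case (Suc n)
  then obtain f' g' where "\<forall>x. (f has_real_derivative f' x) (at x)" "ndiff n f'"
    "\<forall>x. (g has_real_derivative g' x) (at x)" "ndiff n g'" by auto
  with Suc.IH[of f' g'] show ?case
    by (auto intro!: exI[of _ "\<lambda>x. f' x + g' x"] derivative_intros)
qed simp

lemma ndiff_cmult: "ndiff n f \<Longrightarrow> ndiff n (\<lambda>x. c * f x)"
proof (induction n arbitrary: f)
  case (Suc n)
  then obtain f' where "\<forall>x. (f has_real_derivative f' x) (at x)" "ndiff n f'" by auto
  with Suc.IH[of f'] show ?case
    by (auto intro!: exI[of _ "\<lambda>x. c * f' x"] DERIV_cmult)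
qed simp

lemma ndiff_mult: "ndiff n f \<Longrightarrow> ndiff n g \<Longrightarrow> ndiff n (\<lambda>x. f x * g x)"
proof (induction n arbitrary: f g)
  case (Suc n)
  then obtain f' g' where *: "\<forall>x. (f has_real_derivative f' x) (at x)" "ndiff n f'"
    "\<forall>x. (g has_real_derivative g' x) (at x)" "ndiff n g'" by auto
  have "ndiff n (\<lambda>x. f' x * g x + g' x * f x)"
    using * Suc.prems by (intro ndiff_add Suc.IH) (blast intro: ndiff_mono)+
  with * show ?case
    unfolding ndiff.simps
    by (intro exI[of _ "\<lambda>x. f' x * g x + g' x * f x"] conjI allI DERIV_mult) blast+
qed simp

lemma ndiff_affine: "ndiff n f \<Longrightarrow> ndiff n (\<lambda>x. f (c * x + d))"
proof (induction n arbitrary: f)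
  case (Suc n)
  then obtain f' where *: "\<forall>x. (f has_real_derivative f' x) (at x)" "ndiff n f'" by auto
  have "((\<lambda>x. f (c * x + d)) has_real_derivative c * f' (c * x + d)) (at x)" for x
  proof -
    have "((\<lambda>x. c * x + d) has_real_derivative c) (at x)"
      by (auto intro!: derivative_eq_intros)
    from DERIV_chain2[OF *(1)[rule_format] this] show ?thesis by (simp add: mult.commute)
  qed
  with ndiff_cmult[OF Suc.IH[OF *(2)], of c] show ?case
    unfolding ndiff.simps by (intro exI[of _ "\<lambda>x. c * f' (c * x + d)"] conjI allI)
qed simp

text \<open>The derivatives witnessing \<open>ndiff n f\<close> for different \<open>n\<close> are
  chosen independently. Uniqueness of derivatives identifies all of them with \<open>deriv\<close>,
  whose iterates form the tower.\<close>

lemma ndiff_imp_deriv_tower: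
  assumes "\<And>n. ndiff n f"
  obtains F where "deriv_tower F" "F 0 = f"
proof -
  define F where "F k = (deriv ^^ k) f" for k
  have d: "(g has_real_derivative deriv g x) (at x)" "ndiff n (deriv g)" if nd: "\<And>n. ndiff n g" for g x n
  proof -
    obtain g' where g': "\<forall>x. (g has_real_derivative g' x) (at x)" using nd[of "Suc 0"] by auto
    show "(g has_real_derivative deriv g x) (at x)"
      using g' DERIV_imp_deriv by metis
    obtain g'' where g'': "\<forall>x. (g has_real_derivative g'' x) (at x)" "ndiff n g''"
      using nd[of "Suc n"] by auto
    then have "deriv g = g''" by (intro ext DERIV_imp_deriv) simp
    with g'' show "ndiff n (deriv g)" by simp
  qed
  have F: "ndiff n (F k)" for n k
  proof (induction k arbitrary: n)
    case 0
    show ?case using assms by (simp add: F_def)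
  next
    case (Suc k)
    have "F (Suc k) = deriv (F k)" by (simp add: F_def)
    with d(2)[OF Suc] show ?case by simp
  qed
  have "(F k has_real_derivative F (Suc k) x) (at x)" for k x
    using d(1)[OF F, of k x] by (simp add: F_def)
  then have "deriv_tower F" by (simp add: deriv_tower_def)
  moreover have "F 0 = f" by (simp add: F_def)
  ultimately show ?thesis using that by blast
qed

text \<open>Multiplying by powers of \<open>1 / x\<close> makes the family closed under differentiation.\<close>

definition flat_exp :: "nat \<Rightarrow> real \<Rightarrow> real" where
  "flat_exp k x = (if x \<le> 0 then 0 else exp (- (1 / x)) / x ^ k)"

lemma flat_exp_tendsto: "((\<lambda>x. exp (- (1 / x)) / x ^ k) \<longlongrightarrow> 0) (at_right (0::real))"
proof -
  have "((\<lambda>y::real. y ^ k / exp y) \<longlongrightarrow> 0) at_top" by (rule tendsto_power_div_exp_0)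
  then have "((\<lambda>x::real. inverse x ^ k / exp (inverse x)) \<longlongrightarrow> 0) (at_right 0)"
    by (rule filterlim_compose[OF _ filterlim_inverse_at_top_right])
  then show ?thesis
    by (simp add: exp_minus field_simps)
qed

lemma flat_exp_deriv:
  "(flat_exp k has_real_derivative flat_exp (k + 2) x - k * flat_exp (k + 1) x) (at x)"
proof -
  consider "x < 0" | "x > 0" | "x = 0" by linarith
  then show ?thesis
  proof cases
    case 1
    have "((\<lambda>_. 0) has_real_derivative 0) (at x)" by simp
    then have "(flat_exp k has_real_derivative 0) (at x)"
      by (rule has_field_derivative_transform_within_open[of _ _ _ "{..<0}"])
         (use 1 in \<open>auto simp: flat_exp_def\<close>)
    with 1 show ?thesis by (simp add: flat_exp_def)
  next
    case 2
    have "((\<lambda>x. exp (- (1 / x)) / x ^ k) has_real_derivative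
        flat_exp (k + 2) x - k * flat_exp (k + 1) x) (at x)"
    proof (cases k)
      case 0
      then show ?thesis using 2
        by (auto intro!: derivative_eq_intros simp: flat_exp_def field_simps power2_eq_square)
    next
      case (Suc j)
      have "((\<lambda>x. exp (- (1 / x)) / x ^ Suc j) has_real_derivative
          (exp (- (1 / x)) * (1 / x\<^sup>2) * x ^ Suc j - exp (- (1 / x)) * (real (Suc j) * x ^ j))
          / (x ^ Suc j)\<^sup>2) (at x)"
      proof -
        have "((\<lambda>x. exp (- (1 / x))) has_real_derivative exp (- (1 / x)) * (1 / x\<^sup>2)) (at x)"
          using 2 by (auto intro!: derivative_eq_intros simp: power2_eq_square)
        moreover have "((\<lambda>x. x ^ Suc j) has_real_derivative real (Suc j) * x ^ j) (at x)"
          using DERIV_pow[of "Suc j" x] by simp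
        moreover have "x ^ Suc j \<noteq> 0" using 2 by simp
        ultimately show ?thesis
          unfolding power2_eq_square by (rule DERIV_divide)
      qed
      also have "(exp (- (1 / x)) * (1 / x\<^sup>2) * x ^ Suc j - exp (- (1 / x)) * (real (Suc j) * x ^ j))
          / (x ^ Suc j)\<^sup>2 = flat_exp (k + 2) x - k * flat_exp (k + 1) x"
        using 2 by (simp add: flat_exp_def Suc field_simps power2_eq_square)
      finally show ?thesis by (simp add: Suc)
    qed
    then show ?thesis
      by (rule has_field_derivative_transform_within_open[of _ _ _ "{0<..}"])
         (use 2 in \<open>auto simp: flat_exp_def\<close>)
  next
    case 3
    \<comment> \<open>At \<open>0\<close> the difference quotient from the right is
      \<open>exp (- (1 / y)) / y ^ Suc k\<close>, again a function of the family, so its limit is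
      already known.\<close>
    have r: "((\<lambda>y. flat_exp k y / y) \<longlongrightarrow> 0) (at_right 0)"
    proof (rule Lim_transform_eventually[OF flat_exp_tendsto[of "Suc k"]])
      show "\<forall>\<^sub>F x in at_right 0. exp (- (1 / x)) / x ^ Suc k = flat_exp k x / x"
        by (auto simp: eventually_at_right_less flat_exp_def
            intro!: eventually_mono[OF eventually_at_right_less])
    qed
    have l: "((\<lambda>y. flat_exp k y / y) \<longlongrightarrow> 0) (at_left 0)"
    proof (rule Lim_transform_eventually[OF tendsto_const])
      show "\<forall>\<^sub>F x in at_left 0. 0 = flat_exp k x / x"
        by (auto simp: eventually_at_filter flat_exp_def)
    qed
    have "((\<lambda>y. flat_exp k y / y) \<longlongrightarrow> 0) (at 0)"
      using l r by (simp add: filterlim_split_at)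
    then show ?thesis using 3 by (simp add: has_field_derivative_iff flat_exp_def)
  qed
qed

lemma ndiff_flat_exp: "ndiff n (flat_exp k)"
proof (induction n arbitrary: k)
  case (Suc n)
  have "ndiff n (\<lambda>x. flat_exp (k + 2) x + (- real k) * flat_exp (k + 1) x)"
    by (intro ndiff_add ndiff_cmult Suc.IH)
  moreover have "\<forall>x. (flat_exp k has_real_derivative flat_exp (k + 2) x + (- real k) * flat_exp (k + 1) x) (at x)"
    using flat_exp_deriv[of k] by simp
  ultimately show ?case
    unfolding ndiff.simps
    by (intro exI[of _ "\<lambda>x. flat_exp (k + 2) x + (- real k) * flat_exp (k + 1) x"] conjI)
qed simp

text \<open>For \<open>y > 0\<close> the value of \<open>flat_exp 0\<close> at
  \<open>Suc c * y\<close> tends to 1 as \<open>c\<close> grows. These smooth functions therefore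
  stay between 0 and 1 and approach the indicator of the open interval, so that integrals over boxes
  become limits of integrals against test functions.\<close>

definition bump :: "real \<Rightarrow> real \<Rightarrow> nat \<Rightarrow> real \<Rightarrow> real" where
  "bump a b c x = flat_exp 0 (real (Suc c) * (x - a)) * flat_exp 0 (real (Suc c) * (b - x))"

lemma ndiff_bump: "ndiff n (bump a b c)"
proof -
  have "bump a b c = (\<lambda>x. flat_exp 0 (real (Suc c) * x + (- real (Suc c) * a)) * flat_exp 0 ((- real (Suc c)) * x + real (Suc c) * b))"
    by (auto simp: bump_def algebra_simps)
  then show ?thesis
    by (simp only:) (intro ndiff_mult ndiff_affine ndiff_flat_exp)
qed

lemma bump_bounds: "0 \<le> bump a b c x" "bump a b c x \<le> 1"
proof -
  have "0 \<le> flat_exp 0 y \<and> flat_exp 0 y \<le> 1" for y by (simp add: flat_exp_def)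
  then show "0 \<le> bump a b c x" "bump a b c x \<le> 1"
    unfolding bump_def by (auto intro!: mult_nonneg_nonneg mult_le_one)
qed

lemma bump_eq_0: "x \<notin> {a<..<b} \<Longrightarrow> bump a b c x = 0"
  by (cases "x \<le> a") (simp_all add: bump_def flat_exp_def mult_nonneg_nonpos)

lemma bump_tendsto: "(\<lambda>c. bump a b c x) \<longlonglongrightarrow> indicator {a<..<b} x"
proof (cases "x \<in> {a<..<b}")
  case True
  have *: "(\<lambda>c. flat_exp 0 (real (Suc c) * y)) \<longlonglongrightarrow> 1" if "y > 0" for y :: real
  proof -
    have "(\<lambda>c. exp (- ((1 / y) * (1 / real (Suc c))))) \<longlonglongrightarrow> exp (- ((1/y) * 0))"
      by (intro tendsto_intros LIMSEQ_Suc lim_1_over_n[where 'a=real])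
    moreover have "flat_exp 0 (real (Suc c) * y) = exp (- ((1 / y) * (1 / real (Suc c))))" for c
      using that by (auto simp: flat_exp_def mult_le_0_iff mult.commute)
    ultimately show ?thesis by (simp only: mult_zero_right exp_zero minus_zero)
  qed
  from True have "(\<lambda>c. flat_exp 0 (real (Suc c) * (x - a)) * flat_exp 0 (real (Suc c) * (b - x))) \<longlonglongrightarrow> 1 * 1"
    by (intro tendsto_mult *) auto
  with True show ?thesis unfolding bump_def by (simp only: indicator_simps mult_1)
qed (simp add: bump_eq_0)

lemma deriv_tower_continuous: "deriv_tower F \<Longrightarrow> continuous_on S (F k)"
  unfolding deriv_tower_def
  by (intro DERIV_continuous_on[where D = "F (Suc k)"]) (auto intro: has_field_derivative_at_within)

section \<open>Test functions of product form\<close>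

text \<open>For towers this is the partial derivative of multi-index \<open>\<sigma>\<close> of the
  product formed with \<open>\<lambda>_. 0\<close>, available without iterating
  \<open>partial\<close>.\<close>

definition tower_prod :: "('n::finite \<Rightarrow> nat \<Rightarrow> real \<Rightarrow> real) \<Rightarrow> ('n \<Rightarrow> nat) \<Rightarrow> real ^ 'n \<Rightarrow> real" where
  "tower_prod F \<sigma> x = (\<Prod>i\<in>UNIV. F i (\<sigma> i) (x $ i))"

definition test_tower :: "('n::finite \<Rightarrow> nat \<Rightarrow> real \<Rightarrow> real) \<Rightarrow> bool" where
  "test_tower F \<longleftrightarrow> (\<forall>i. deriv_tower (F i) \<and> (\<exists>A B. \<forall>x. x \<notin> {A..B} \<longrightarrow> F i 0 x = 0))"

lemma tower_prod_has_derivative: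
  assumes "\<And>j. deriv_tower (F j)"
  shows "(tower_prod F \<sigma> has_derivative
    (\<lambda>y. \<Sum>i\<in>UNIV. F i (Suc (\<sigma> i)) (x $ i) * (y $ i) * (\<Prod>j\<in>UNIV - {i}. F j (\<sigma> j) (x $ j)))) (at x)"
  unfolding tower_prod_def
proof (rule has_derivative_prod)
  fix i
  have "(F i (\<sigma> i) has_derivative (\<lambda>h. h * F i (Suc (\<sigma> i)) (x $ i))) (at (x $ i))"
  proof -
    have "(F i (\<sigma> i) has_real_derivative F i (Suc (\<sigma> i)) (x $ i)) (at (x $ i))"
      using assms[of i] by (simp add: deriv_tower_def)
    then show ?thesis unfolding has_field_derivative_def
      by (rule has_derivative_eq_rhs) (simp add: fun_eq_iff mult.commute)
  qed
  moreover have "((\<lambda>x. x $ i) has_derivative (\<lambda>y. y $ i)) (at x)"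
    by (simp add: bounded_linear_imp_has_derivative bounded_linear_vec_nth)
  ultimately have "((\<lambda>x. F i (\<sigma> i) (x $ i)) has_derivative (\<lambda>y. y $ i * F i (Suc (\<sigma> i)) (x $ i))) (at x)"
    using has_derivative_compose[where f = "\<lambda>x. x $ i" and f' = "\<lambda>y. y $ i" and g = "F i (\<sigma> i)"
        and g' = "\<lambda>h. h * F i (Suc (\<sigma> i)) (x $ i)" and x = x and s = UNIV] by blast
  then show "((\<lambda>x. F i (\<sigma> i) (x $ i)) has_derivative (\<lambda>y. F i (Suc (\<sigma> i)) (x $ i) * y $ i)) (at x)"
    by (rule has_derivative_eq_rhs) (simp add: fun_eq_iff mult.commute)
qed

lemma partial_tower_prod:
  assumes "\<And>j. deriv_tower (F j)"
  shows "partial i (tower_prod F \<sigma>) = tower_prod F (\<sigma>(i := Suc (\<sigma> i)))"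
proof
  fix x :: "real ^ 'a"
  have "partial i (tower_prod F \<sigma>) x =
     (\<Sum>k\<in>UNIV. F k (Suc (\<sigma> k)) (x $ k) * (axis i 1 $ k) * (\<Prod>j\<in>UNIV - {k}. F j (\<sigma> j) (x $ j)))"
    unfolding partial_def
    by (simp add: frechet_derivative_at[OF tower_prod_has_derivative[of F \<sigma> x, OF assms], symmetric])
  also have "\<dots> = (\<Sum>k\<in>UNIV. if k = i then F k (Suc (\<sigma> k)) (x $ k) * (\<Prod>j\<in>UNIV - {k}. F j (\<sigma> j) (x $ j)) else 0)"
    by (intro sum.cong) (auto simp: axis_def)
  also have "\<dots> = F i (Suc (\<sigma> i)) (x $ i) * (\<Prod>j\<in>UNIV - {i}. F j (\<sigma> j) (x $ j))"
    by simp
  also have "\<dots> = tower_prod F (\<sigma>(i := Suc (\<sigma> i))) x"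
    unfolding tower_prod_def by (subst prod.remove[of UNIV i]) (auto intro!: prod.cong)
  finally show "partial i (tower_prod F \<sigma>) x = tower_prod F (\<sigma>(i := Suc (\<sigma> i))) x" .
qed

lemma iter_partial_tower_prod:
  assumes "\<And>j. deriv_tower (F j)"
  shows "iter_partial is (tower_prod F \<sigma>) = tower_prod F (\<lambda>i. \<sigma> i + count_list is i)"
proof (induction "is")
  case (Cons i "is")
  have "iter_partial (i # is) (tower_prod F \<sigma>) = partial i (iter_partial is (tower_prod F \<sigma>))"
    by (simp add: iter_partial_def)
  also have "\<dots> = tower_prod F (\<lambda>j. \<sigma> j + count_list (i # is) j)"
    unfolding Cons partial_tower_prod[OF assms]
    by (rule arg_cong[of _ _ "tower_prod F"]) (auto simp: fun_eq_iff)
  finally show ?case .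
qed (simp add: iter_partial_def)

text \<open>Justifies the choice made in \<open>mixed_partial\<close>: a multi-index is a finite
  multiset of coordinates, and any enumeration of it qualifies.\<close>

lemma exists_list_of_counts: "\<exists>is. \<forall>i::'n::finite. count_list is i = \<sigma> i"
proof -
  have "finite {x. 0 < \<sigma> x}" by simp
  then have "count (Abs_multiset \<sigma>) = \<sigma>" by (rule count_Abs_multiset)
  moreover obtain xs where "mset xs = Abs_multiset \<sigma>" using ex_mset by blast
  ultimately show ?thesis by (metis count_mset)
qed

lemma mixed_partial_tower_prod:
  assumes "\<And>j. deriv_tower (F j)"
  shows "mixed_partial \<sigma> (tower_prod F (\<lambda>_. 0)) = tower_prod F \<sigma>"
  unfolding mixed_partial_def iter_partial_tower_prod[OF assms]
  using someI_ex[OF exists_list_of_counts[of \<sigma>]] by simp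

lemma test_tower_support:
  assumes "test_tower F"
  obtains a b where "\<And>x. x \<notin> cbox a b \<Longrightarrow> tower_prod F (\<lambda>_. 0) x = 0"
proof -
  from assms obtain A B where AB: "\<And>i x. x \<notin> {A i..B i} \<Longrightarrow> F i 0 x = 0"
    unfolding test_tower_def by metis
  have "tower_prod F (\<lambda>_. 0) x = 0" if "x \<notin> cbox (\<chi> i. A i) (\<chi> i. B i)" for x
    using that AB by (force simp: tower_prod_def mem_box_cart)
  then show ?thesis using that by blast
qed

lemma test_function_tower_prod:
  assumes "test_tower F"
  shows "test_function (tower_prod F (\<lambda>_. 0))"
proof -
  have F: "\<And>j. deriv_tower (F j)" using assms by (auto simp: test_tower_def)
  have "smooth (tower_prod F (\<lambda>_. 0))"
    unfolding smooth_def iter_partial_tower_prod[where F = F, OF F] differentiable_on_def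
  proof (intro allI ballI)
    fix "is" :: "'a list" and x :: "real ^ 'a"
    show "tower_prod F (\<lambda>i. 0 + count_list is i) differentiable at x"
      by (rule differentiableI, rule tower_prod_has_derivative, rule F)
  qed
  moreover obtain a b where "\<And>x. x \<notin> cbox a b \<Longrightarrow> tower_prod F (\<lambda>_. 0) x = 0"
    using test_tower_support[OF assms] by blast
  then have "{x. tower_prod F (\<lambda>_. 0) x \<noteq> 0} \<subseteq> cbox a b" by blast
  then have "bounded {x. tower_prod F (\<lambda>_. 0) x \<noteq> 0}" using bounded_cbox bounded_subset by blast
  ultimately show ?thesis by (simp add: test_function_def compact_closure)
qed

text \<open>The complement of \<open>{A..B}\<close> is open, so the derivative vanishes there
  together with the function. Hence a partial derivative of an admissible product is itself
  admissible.\<close>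

lemma test_tower_shift:
  assumes "test_tower F"
  shows "test_tower (F(i := \<lambda>k. F i (Suc k)))"
proof -
  have "\<exists>A B. \<forall>x. x \<notin> {A..B} \<longrightarrow> F i (Suc 0) x = 0"
  proof -
    obtain A B where AB: "\<And>x. x \<notin> {A..B} \<Longrightarrow> F i 0 x = 0"
      using assms unfolding test_tower_def by metis
    have "F i (Suc 0) x = 0" if "x \<notin> {A..B}" for x
    proof -
      have "(F i 0 has_real_derivative 0) (at x)"
        by (rule has_field_derivative_transform_within_open[of "\<lambda>_. 0" _ _ "- {A..B}"])
           (use that AB in auto)
      moreover have "(F i 0 has_real_derivative F i (Suc 0) x) (at x)"
        using assms by (auto simp: test_tower_def deriv_tower_def)
      ultimately show ?thesis using DERIV_unique by blast
    qed
    then show ?thesis by blast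
  qed
  then show ?thesis using assms by (auto simp: test_tower_def deriv_tower_def)
qed

text \<open>Weak differentiability in direction \<open>i\<close>, tested against products of functions of one
  variable only; this avoids the symmetry of mixed partial derivatives of test functions.\<close>

definition weak_partial :: "(real ^ 'n \<Rightarrow> real) \<Rightarrow> 'n::finite \<Rightarrow> (real ^ 'n \<Rightarrow> real) \<Rightarrow> bool" where
  "weak_partial g i G \<longleftrightarrow> (\<forall>F. test_tower F \<longrightarrow>
     (LINT x|lebesgue. g x * tower_prod F ((\<lambda>_. 0)(i := 1)) x)
     = - (LINT x|lebesgue. G x * tower_prod F (\<lambda>_. 0) x))"

text \<open>The identity for \<open>\<sigma>\<close> is applied to the product whose
  \<open>i\<close>-th tower is shifted by one, the identity for the raised multi-index to the
  product itself. Both then involve the same integral against \<open>f\<close>, and their signs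
  differ by a single factor \<open>-1\<close>.\<close>

lemma has_weak_derivative_imp_weak_partial:
  assumes "has_weak_derivative f \<sigma> g" "has_weak_derivative f (\<sigma>(i := Suc (\<sigma> i))) G"
  shows "weak_partial g i G"
  unfolding weak_partial_def
proof (intro allI impI)
  fix F :: "'a \<Rightarrow> nat \<Rightarrow> real \<Rightarrow> real" assume F: "test_tower F"
  define F' where "F' = F(i := \<lambda>k. F i (Suc k))"
  have F': "test_tower F'" using test_tower_shift[OF F] by (simp add: F'_def)
  have tF: "\<And>j. deriv_tower (F j)" "\<And>j. deriv_tower (F' j)"
    using F F' by (auto simp: test_tower_def)
  have shift: "tower_prod F' \<tau> = tower_prod F (\<tau>(i := Suc (\<tau> i)))" for \<tau>
    by (auto simp: tower_prod_def F'_def fun_eq_iff intro!: prod.cong)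
  have order: "midx_order (\<sigma>(i := Suc (\<sigma> i))) = Suc (midx_order \<sigma>)"
    unfolding midx_order_def by (subst (1 2) sum.remove[of UNIV i]) auto
  have "(- 1) ^ midx_order \<sigma> * (LINT x|lebesgue. g x * tower_prod F' (\<lambda>_. 0) x)
      = (LINT x|lebesgue. f x * tower_prod F' \<sigma> x)"
    using assms(1) test_function_tower_prod[OF F'] mixed_partial_tower_prod[where F = F', OF tF(2)]
    unfolding has_weak_derivative_def by metis
  also have "\<dots> = (LINT x|lebesgue. f x * tower_prod F (\<sigma>(i := Suc (\<sigma> i))) x)"
    by (simp add: shift)
  also have "\<dots> = (- 1) ^ Suc (midx_order \<sigma>) * (LINT x|lebesgue. G x * tower_prod F (\<lambda>_. 0) x)"
    using assms(2) test_function_tower_prod[OF F] mixed_partial_tower_prod[where F = F, OF tF(1)]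
    unfolding has_weak_derivative_def order by metis
  finally have "(- 1) ^ midx_order \<sigma> * (LINT x|lebesgue. g x * tower_prod F ((\<lambda>_. 0)(i := 1)) x)
     = (- 1) ^ midx_order \<sigma> * (- (LINT x|lebesgue. G x * tower_prod F (\<lambda>_. 0) x))"
    by (simp add: shift)
  then show "(LINT x|lebesgue. g x * tower_prod F ((\<lambda>_. 0)(i := 1)) x)
     = - (LINT x|lebesgue. G x * tower_prod F (\<lambda>_. 0) x)"
    unfolding mult_cancel_left by simp
qed

section \<open>Absolute continuity on lines\<close>

text \<open>Borel rather than Lebesgue measurability, because these functions are composed with
  \<open>x + s *\<^sub>R e\<close> and integrated over the uncompleted product
  \<open>lborel \<Otimes>\<^sub>M lborel\<close>.\<close>

definition box_integrable :: "('a::euclidean_space \<Rightarrow> real) \<Rightarrow> bool" where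
  "box_integrable h \<longleftrightarrow> h \<in> borel_measurable borel \<and>
     (\<forall>a b. integrable lborel (\<lambda>x. indicator (cbox a b) x * h x))"

lemma box_integrable_measurable: "box_integrable h \<Longrightarrow> h \<in> borel_measurable borel"
  by (simp add: box_integrable_def)

lemma box_integrable_bounded_mult:
  assumes h: "box_integrable h" and k[measurable]: "k \<in> borel_measurable borel"
    and B: "\<And>x. \<bar>k x\<bar> \<le> B" and supp: "\<And>x. x \<notin> cbox a b \<Longrightarrow> k x = 0"
  shows "integrable lborel (\<lambda>x. h x * k x)"
proof -
  have [measurable]: "h \<in> borel_measurable borel" using h by (rule box_integrable_measurable)
  have "integrable lborel (\<lambda>x. B * (indicator (cbox a b) x * h x))"
    using h by (simp add: box_integrable_def)
  then show ?thesis
  proof (rule Bochner_Integration.integrable_bound)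
    have "\<bar>h x * k x\<bar> \<le> \<bar>B * (indicator (cbox a b) x * h x)\<bar>" for x
    proof (cases "x \<in> cbox a b")
      case True
      have "\<bar>h x\<bar> * \<bar>k x\<bar> \<le> \<bar>h x\<bar> * \<bar>B\<bar>"
        using B[of x] by (intro mult_left_mono) auto
      with True show ?thesis by (simp add: abs_mult mult.commute)
    qed (simp add: supp)
    then show "AE x in lborel. norm (h x * k x) \<le> norm (B * (indicator (cbox a b) x * h x))" by simp
  qed simp
qed

lemma nn_integral_lborel_translate:
  fixes c :: "'a::euclidean_space"
  assumes [measurable]: "h \<in> borel_measurable borel"
  shows "(\<integral>\<^sup>+x. h (x + c) \<partial>lborel) = (\<integral>\<^sup>+x. h x \<partial>lborel)"
  by (subst (2) lborel_distr_plus[of c, symmetric], subst nn_integral_distr)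
     (auto simp: add.commute)

lemma integral_lborel_translate:
  fixes c :: "'a::euclidean_space" and h :: "'a \<Rightarrow> real"
  assumes [measurable]: "h \<in> borel_measurable borel"
  shows "(LINT x|lborel. h (x + c)) = (LINT x|lborel. h x)"
  by (subst (2) lborel_distr_plus[of c, symmetric], subst integral_distr)
     (auto simp: add.commute)

lemma integrable_lborel_translate:
  fixes c :: "'a::euclidean_space" and h :: "'a \<Rightarrow> real"
  assumes "integrable lborel h"
  shows "integrable lborel (\<lambda>x. h (x + c))"
proof -
  have [measurable]: "h \<in> borel_measurable borel" using assms by auto
  from assms have "integrable (distr lborel borel ((+) c)) h" by (simp add: lborel_distr_plus)
  then show ?thesis by (subst (asm) integrable_distr_eq) (auto simp: add.commute)
qed

lemma box_integrable_translate:
  assumes "box_integrable h"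
  shows "box_integrable (\<lambda>x. h (x + c))"
  unfolding box_integrable_def
proof (intro conjI allI)
  have [measurable]: "h \<in> borel_measurable borel" using assms by (rule box_integrable_measurable)
  show "(\<lambda>x. h (x + c)) \<in> borel_measurable borel" by simp
  fix a b
  have "integrable lborel (\<lambda>x. indicator (cbox (a + c) (b + c)) (x + c) * h (x + c))"
    using assms by (intro integrable_lborel_translate) (auto simp: box_integrable_def)
  moreover have "indicator (cbox (a + c) (b + c)) (x + c) = (indicator (cbox a b) x :: real)" for x
    by (auto simp: indicator_def mem_box inner_add_left)
  ultimately show "integrable lborel (\<lambda>x. indicator (cbox a b) x * h (x + c))" by simp
qed

lemma box_integrable_diff:
  assumes "box_integrable h" "box_integrable k"
  shows "box_integrable (\<lambda>x. h x - k x)"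
proof -
  have [measurable]: "h \<in> borel_measurable borel" "k \<in> borel_measurable borel"
    using assms by (auto dest: box_integrable_measurable)
  show ?thesis using assms by (simp add: box_integrable_def right_diff_distrib)
qed

lemma box_integrable_continuous:
  fixes h :: "'a::euclidean_space \<Rightarrow> real"
  assumes "continuous_on UNIV h" shows "box_integrable h"
  unfolding box_integrable_def
proof (intro conjI allI)
  show "h \<in> borel_measurable borel" using assms by (rule borel_measurable_continuous_onI)
  show "integrable lborel (\<lambda>x. indicator (cbox a b) x * h x)" for a b
    using borel_integrable_compact[OF compact_cbox continuous_on_subset[OF assms], of a b]
    by (auto simp: indicator_times_eq_if if_distrib cong: if_cong)
qed

text \<open>Open boxes are an intersection-stable generator of the Borel sets, so the vanishing of
  the integrals spreads to all Borel sets by Dynkin's argument. The cut-off by \<open>B n\<close>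
  makes the function integrable, as complements and countable unions demand, and a box cut by
  \<open>B n\<close> is again a box.\<close>

lemma AE_zero_if_box_integrals_zero:
  fixes H :: "'a::euclidean_space \<Rightarrow> real"
  assumes H: "box_integrable H"
    and zero: "\<And>a b. (LINT x|lborel. indicator (box a b) x * H x) = 0"
  shows "AE x in lborel. H x = 0"
proof -
  have [measurable]: "H \<in> borel_measurable borel" using H by (rule box_integrable_measurable)
  define B where "B n = box (- (real n *\<^sub>R One)) (real n *\<^sub>R One :: 'a)" for n
  have "AE x in lborel. indicator (B n) x * H x = 0" for n
  proof (rule density_unique_real)
    have "integrable lborel (\<lambda>x. H x * indicator (B n) x)"
      by (rule box_integrable_bounded_mult[OF H, of _ 1 "- (real n *\<^sub>R One)" "real n *\<^sub>R One"])
         (use box_subset_cbox in \<open>auto simp: B_def indicator_def\<close>)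
    then show int: "integrable lborel (\<lambda>x. indicator (B n) x * H x)" by (simp add: mult.commute)
    have si: "set_integrable lborel A (\<lambda>x. indicator (B n) x * H x)" if "A \<in> sets borel" for A
      using integrable_mult_indicator[of A lborel "\<lambda>x. indicator (B n) x * H x"] int that
      by (simp add: set_integrable_def)
    fix A :: "'a set" assume "A \<in> sets lborel"
    then have "A \<in> sigma_sets UNIV (range (\<lambda>(a, b). box a b))"
      unfolding borel_eq_box by (simp add: borel_eq_box)
    have "Int_stable (range (\<lambda>(a, b). box a b :: 'a set))"
      by (auto simp: Int_stable_def box_Int_box)
    moreover have "range (\<lambda>(a, b). box a b :: 'a set) \<subseteq> Pow UNIV" by simp
    moreover note \<open>A \<in> sigma_sets UNIV _\<close>
    ultimately have "(LINT x:A|lborel. indicator (B n) x * H x) = 0"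
    proof (induction rule: sigma_sets_induct_disjoint)
      case (basic A)
      then obtain a b where "A \<inter> B n = box a b" by (auto simp: B_def box_Int_box)
      then have eq: "indicator A x * (indicator (B n) x * H x) = indicator (box a b) x * H x" for x
        by (metis indicator_inter_arith mult.assoc)
      show ?case by (simp only: set_lebesgue_integral_def real_scaleR_def eq zero)
    next
      case empty
      show ?case by (simp add: set_lebesgue_integral_def)
    next
      case (compl A)
      then have A: "A \<in> sets borel" by (simp add: borel_eq_box)
      have "(LINT x:UNIV - A|lborel. indicator (B n) x * H x)
        = (LINT x|lborel. indicator (B n) x * H x - indicator A x * (indicator (B n) x * H x))"
        unfolding set_lebesgue_integral_def
        by (intro Bochner_Integration.integral_cong) (auto simp: indicator_def)
      also have "\<dots> = (LINT x|lborel. indicator (B n) x * H x)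
          - (LINT x:A|lborel. indicator (B n) x * H x)"
        using int si[OF A] unfolding set_lebesgue_integral_def set_integrable_def
        by (subst Bochner_Integration.integral_diff) auto
      finally show ?case using compl(2) zero by (simp add: B_def)
    next
      case (union A)
      then have A: "\<And>i. A i \<in> sets borel" by (auto simp: borel_eq_box)
      have "(LINT x:(\<Union>i. A i)|lborel. indicator (B n) x * H x)
        = (\<Sum>i. (LINT x:A i|lborel. indicator (B n) x * H x))"
      proof (rule lebesgue_integral_countable_add)
        show "set_integrable lborel (\<Union>i. A i) (\<lambda>x. indicator (B n) x * H x)"
          using A by (intro si) auto
      qed (use A union(1) in \<open>auto simp: disjoint_family_on_def\<close>)
      with union(3) show ?case by simp
    qed
    then show "(LINT x:A|lborel. indicator (B n) x * H x) = (LINT x:A|lborel. 0)"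
      by (simp add: set_lebesgue_integral_def)
  qed simp
  then have "AE x in lborel. \<forall>n. indicator (B n) x * H x = 0"
    unfolding AE_all_countable by blast
  then show ?thesis
  proof eventually_elim
    case (elim x)
    have "x \<in> (\<Union>n. B n)" unfolding B_def using UN_box_eq_UNIV by auto
    then obtain n where "x \<in> B n" by blast
    with elim show ?case by (metis indicator_simps(1) mult_1)
  qed
qed

lemma weak_partial_lborel:
  assumes "weak_partial g i G" "test_tower F"
    and [measurable]: "g \<in> borel_measurable borel" "G \<in> borel_measurable borel"
  shows "(LINT x|lborel. g x * tower_prod F ((\<lambda>_. 0)(i := 1)) x)
     = - (LINT x|lborel. G x * tower_prod F (\<lambda>_. 0) x)"
proof -
  have [measurable]: "tower_prod F \<sigma> \<in> borel_measurable borel" for \<sigma>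
    unfolding tower_prod_def[abs_def]
  proof (intro borel_measurable_prod)
    fix j
    have "continuous_on UNIV (F j (\<sigma> j))"
      using assms(2) by (intro deriv_tower_continuous) (simp add: test_tower_def)
    then have [measurable]: "F j (\<sigma> j) \<in> borel_measurable borel"
      by (rule borel_measurable_continuous_onI)
    show "(\<lambda>x. F j (\<sigma> j) (x $ j)) \<in> borel_measurable borel" by simp
  qed
  have eq: "(LINT x|lebesgue. h x * tower_prod F \<sigma> x) = (LINT x|lborel. h x * tower_prod F \<sigma> x)"
    if [measurable]: "h \<in> borel_measurable borel" for h \<sigma>
    by (rule integral_completion) simp
  have "(LINT x|lebesgue. g x * tower_prod F ((\<lambda>_. 0)(i := 1)) x)
     = - (LINT x|lebesgue. G x * tower_prod F (\<lambda>_. 0) x)"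
    using assms(1,2) unfolding weak_partial_def by blast
  then show ?thesis
    by (simp only: eq[OF assms(3)] eq[OF assms(4)])
qed

text \<open>Absolute continuity of \<open>g\<close> on lines in direction \<open>i\<close>; the exceptional null set of \<open>x\<close> may
  depend on \<open>t\<close>, which suffices after integration over \<open>x\<close>.\<close>

definition line_primitive :: "(real ^ 'n \<Rightarrow> real) \<Rightarrow> 'n::finite \<Rightarrow> (real ^ 'n \<Rightarrow> real) \<Rightarrow> bool" where
  "line_primitive g i G \<longleftrightarrow> (\<forall>t\<ge>0. AE x in lborel.
     has_bochner_integral lborel (\<lambda>s. indicator {0..t} s * G (x + s *\<^sub>R axis i 1))
       (g (x + t *\<^sub>R axis i 1) - g x))"

lemma nn_integral_shear:
  fixes e :: "'a::euclidean_space" and k G :: "'a \<Rightarrow> real"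
  assumes [measurable]: "k \<in> borel_measurable borel" "G \<in> borel_measurable borel"
  shows "(\<integral>\<^sup>+s. \<integral>\<^sup>+x. ennreal \<bar>k x * (indicator {0..t} s * G (x + s *\<^sub>R e))\<bar> \<partial>lborel \<partial>lborel)
    = (\<integral>\<^sup>+s. \<integral>\<^sup>+x. ennreal \<bar>G x * (indicator {0..t} s * k (x - s *\<^sub>R e))\<bar> \<partial>lborel \<partial>lborel)"
proof (rule nn_integral_cong)
  fix s :: real
  show "(\<integral>\<^sup>+x. ennreal \<bar>k x * (indicator {0..t} s * G (x + s *\<^sub>R e))\<bar> \<partial>lborel)
    = (\<integral>\<^sup>+x. ennreal \<bar>G x * (indicator {0..t} s * k (x - s *\<^sub>R e))\<bar> \<partial>lborel)"
    using nn_integral_lborel_translate[of "\<lambda>x. ennreal \<bar>G x * (indicator {0..t} s * k (x - s *\<^sub>R e))\<bar>" "s *\<^sub>R e"]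
    by (simp add: mult.commute mult.left_commute)
qed

text \<open>The image of \<open>cbox a b \<times> {0..t}\<close> under the shear is compact, so
  \<open>G\<close> is evaluated only inside one box, where it is integrable. The second integrand
  arises from the first by translating \<open>x\<close> for each fixed \<open>s\<close> and has the
  same absolute integral.\<close>

lemma integrable_shear:
  fixes e :: "'a::euclidean_space" and k G :: "'a \<Rightarrow> real"
  assumes G: "box_integrable G" and k[measurable]: "k \<in> borel_measurable borel"
    and B: "\<And>x. \<bar>k x\<bar> \<le> B" and supp: "\<And>x. x \<notin> cbox a b \<Longrightarrow> k x = 0"
  shows "integrable (lborel \<Otimes>\<^sub>M lborel) (\<lambda>(x, s). k x * (indicator {0..t::real} s * G (x + s *\<^sub>R e)))"
    and "integrable (lborel \<Otimes>\<^sub>M lborel) (\<lambda>(x, s). G x * (indicator {0..t::real} s * k (x - s *\<^sub>R e)))"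
proof -
  have [measurable]: "G \<in> borel_measurable borel" using G by (rule box_integrable_measurable)
  have B0: "0 \<le> B" using B[of 0] by linarith
  have "compact ((\<lambda>(x, s). x + s *\<^sub>R e) ` (cbox a b \<times> {0..t}))"
    by (intro compact_continuous_image compact_Times)
       (auto intro!: continuous_intros simp: case_prod_unfold)
  then obtain c where c: "(\<lambda>(x, s). x + s *\<^sub>R e) ` (cbox a b \<times> {0..t}) \<subseteq> cbox (- c) c"
    using bounded_subset_cbox_symmetric compact_imp_bounded by metis
  define N where "N = (\<integral>\<^sup>+x. ennreal \<bar>indicator (cbox (- c) c) x * G x\<bar> \<partial>lborel)"
  have "integrable lborel (\<lambda>x. indicator (cbox (- c) c) x * G x)"
    using G by (simp add: box_integrable_def)
  then have N: "N < \<infinity>" by (simp add: N_def integrable_iff_bounded)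
  have "(\<integral>\<^sup>+s. \<integral>\<^sup>+x. ennreal \<bar>k x * (indicator {0..t} s * G (x + s *\<^sub>R e))\<bar> \<partial>lborel \<partial>lborel)
      \<le> (\<integral>\<^sup>+s. indicator {0..t} s * (ennreal B * N) \<partial>lborel)"
  proof (rule nn_integral_mono)
    fix s :: real
    have "(\<integral>\<^sup>+x. ennreal \<bar>k x * (indicator {0..t} s * G (x + s *\<^sub>R e))\<bar> \<partial>lborel)
      \<le> (\<integral>\<^sup>+x. (indicator {0..t} s * ennreal B) * ennreal \<bar>indicator (cbox (- c) c) (x + s *\<^sub>R e) * G (x + s *\<^sub>R e)\<bar> \<partial>lborel)"
    proof (rule nn_integral_mono)
      fix x
      show "ennreal \<bar>k x * (indicator {0..t} s * G (x + s *\<^sub>R e))\<bar>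
        \<le> (indicator {0..t} s * ennreal B) * ennreal \<bar>indicator (cbox (- c) c) (x + s *\<^sub>R e) * G (x + s *\<^sub>R e)\<bar>"
      proof (cases "x \<in> cbox a b \<and> s \<in> {0..t}")
        case True
        with c have "x + s *\<^sub>R e \<in> cbox (- c) c" by force
        with True B0 B[of x] show ?thesis
          by (simp add: abs_mult ennreal_mult[symmetric] mult_right_mono)
      next
        case False
        with supp have "k x * (indicator {0..t} s * G (x + s *\<^sub>R e)) = 0"
          by (auto simp: indicator_def)
        then show ?thesis by (simp only: abs_zero ennreal_0 zero_le)
      qed
    qed
    also have "\<dots> = (indicator {0..t} s * ennreal B) * N"
      unfolding N_def
      by (subst nn_integral_cmult)
         (simp_all add: nn_integral_lborel_translate[of "\<lambda>x. ennreal \<bar>indicator (cbox (- c) c) x * G x\<bar>"])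
    finally show "(\<integral>\<^sup>+x. ennreal \<bar>k x * (indicator {0..t} s * G (x + s *\<^sub>R e))\<bar> \<partial>lborel)
      \<le> indicator {0..t} s * (ennreal B * N)" by (simp add: mult.assoc)
  qed
  also have "\<dots> = emeasure lborel {0..t} * (ennreal B * N)"
    by (subst nn_integral_multc) auto
  also have "\<dots> < \<infinity>"
    using N by (cases "0 \<le> t") (auto simp: ennreal_mult_less_top)
  finally have fin: "(\<integral>\<^sup>+s. \<integral>\<^sup>+x. ennreal \<bar>k x * (indicator {0..t} s * G (x + s *\<^sub>R e))\<bar> \<partial>lborel \<partial>lborel) < \<infinity>" .
  show "integrable (lborel \<Otimes>\<^sub>M lborel) (\<lambda>(x, s). k x * (indicator {0..t::real} s * G (x + s *\<^sub>R e)))"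
  proof (rule integrableI_bounded)
    have "(\<integral>\<^sup>+z. ennreal (norm (case z of (x, s) \<Rightarrow> k x * (indicator {0..t} s * G (x + s *\<^sub>R e)))) \<partial>(lborel \<Otimes>\<^sub>M lborel))
      = (\<integral>\<^sup>+s. \<integral>\<^sup>+x. ennreal \<bar>k x * (indicator {0..t} s * G (x + s *\<^sub>R e))\<bar> \<partial>lborel \<partial>lborel)"
      by (subst lborel_pair.nn_integral_snd[symmetric]) (simp_all add: case_prod_unfold)
    with fin show "(\<integral>\<^sup>+z. ennreal (norm (case z of (x, s) \<Rightarrow> k x * (indicator {0..t} s * G (x + s *\<^sub>R e)))) \<partial>(lborel \<Otimes>\<^sub>M lborel)) < \<infinity>" by simp
  qed (simp add: case_prod_unfold)
  show "integrable (lborel \<Otimes>\<^sub>M lborel) (\<lambda>(x, s). G x * (indicator {0..t::real} s * k (x - s *\<^sub>R e)))"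
  proof (rule integrableI_bounded)
    have "(\<integral>\<^sup>+z. ennreal (norm (case z of (x, s) \<Rightarrow> G x * (indicator {0..t} s * k (x - s *\<^sub>R e)))) \<partial>(lborel \<Otimes>\<^sub>M lborel))
      = (\<integral>\<^sup>+s. \<integral>\<^sup>+x. ennreal \<bar>G x * (indicator {0..t} s * k (x - s *\<^sub>R e))\<bar> \<partial>lborel \<partial>lborel)"
      by (subst lborel_pair.nn_integral_snd[symmetric]) (simp_all add: case_prod_unfold)
    with fin show "(\<integral>\<^sup>+z. ennreal (norm (case z of (x, s) \<Rightarrow> G x * (indicator {0..t} s * k (x - s *\<^sub>R e)))) \<partial>(lborel \<Otimes>\<^sub>M lborel)) < \<infinity>"
      by (simp only: nn_integral_shear[OF k \<open>G \<in> borel_measurable borel\<close>])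
  qed (simp add: case_prod_unfold)
qed

text \<open>Integration along a segment is moved from \<open>G\<close> to the test function, with
  the direction reversed: Fubini before and after a translation in \<open>x\<close> at fixed
  \<open>s\<close>.\<close>

lemma integral_shear:
  fixes e :: "'a::euclidean_space" and k G :: "'a \<Rightarrow> real"
  assumes G: "box_integrable G" and k[measurable]: "k \<in> borel_measurable borel"
    and B: "\<And>x. \<bar>k x\<bar> \<le> B" and supp: "\<And>x. x \<notin> cbox a b \<Longrightarrow> k x = 0"
  shows "(LINT x|lborel. k x * (LINT s|lborel. indicator {0..t::real} s * G (x + s *\<^sub>R e)))
    = (LINT x|lborel. G x * (LINT s|lborel. indicator {0..t} s * k (x - s *\<^sub>R e)))"
proof -
  have [measurable]: "G \<in> borel_measurable borel" using G by (rule box_integrable_measurable)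
  note int = integrable_shear[OF G k B supp, where t = t and e = e]
  have "(LINT x|lborel. k x * (LINT s|lborel. indicator {0..t} s * G (x + s *\<^sub>R e)))
    = (LINT x|lborel. LINT s|lborel. k x * (indicator {0..t} s * G (x + s *\<^sub>R e)))"
    by simp
  also have "\<dots> = (LINT s|lborel. LINT x|lborel. k x * (indicator {0..t} s * G (x + s *\<^sub>R e)))"
    using int(1) by (rule lborel_pair.Fubini_integral[symmetric])
  also have "\<dots> = (LINT s|lborel. LINT x|lborel. G x * (indicator {0..t} s * k (x - s *\<^sub>R e)))"
  proof (rule Bochner_Integration.integral_cong[OF refl])
    fix s
    show "(LINT x|lborel. k x * (indicator {0..t} s * G (x + s *\<^sub>R e)))
      = (LINT x|lborel. G x * (indicator {0..t} s * k (x - s *\<^sub>R e)))"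
      using integral_lborel_translate[of "\<lambda>x. G x * (indicator {0..t} s * k (x - s *\<^sub>R e))" "s *\<^sub>R e"]
      by (simp add: mult.commute mult.left_commute)
  qed
  also have "\<dots> = (LINT x|lborel. LINT s|lborel. G x * (indicator {0..t} s * k (x - s *\<^sub>R e)))"
    using int(2) by (rule lborel_pair.Fubini_integral)
  finally show ?thesis by simp
qed

lemma integral_window_primitive:
  assumes \<psi>: "continuous_on UNIV \<psi>" and \<Psi>: "\<And>x. (\<Psi> has_real_derivative \<psi> x) (at x)" and t: "0 \<le> t"
  shows "(LINT s|lborel. indicator {0..t} s * \<psi> (x - s)) = \<Psi> x - \<Psi> (x - t)"
proof -
  have "(\<integral>s. \<psi> (x - s) * indicator {0..t} s \<partial>lborel) = - \<Psi> (x - t) - (- \<Psi> (x - 0))"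
  proof (rule integral_FTC_Icc_real[OF t])
    fix s
    have "((\<lambda>s. \<Psi> (x - s)) has_real_derivative \<psi> (x - s) * (- 1)) (at s)"
      by (rule DERIV_chain2[OF \<Psi>]) (auto intro!: derivative_eq_intros)
    from DERIV_minus[OF this] show "((\<lambda>s. - \<Psi> (x - s)) has_real_derivative \<psi> (x - s)) (at s)"
      by simp
    have "continuous_on UNIV (\<lambda>s. \<psi> (x - s))"
      by (rule continuous_on_compose2[OF \<psi>]) (auto intro!: continuous_intros)
    then show "isCont (\<lambda>s. \<psi> (x - s)) s"
      by (simp add: continuous_on_eq_continuous_at)
  qed
  then show ?thesis by (simp add: mult.commute)
qed

text \<open>The weak derivative is tested against a product whose factor in direction \<open>i\<close> is replaced
  by its moving integral over a window of length \<open>t\<close>.\<close>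

lemma weak_partial_difference:
  fixes g G :: "real ^ 'n::finite \<Rightarrow> real"
  assumes w: "weak_partial g i G" and g: "box_integrable g" and G: "box_integrable G"
    and P: "test_tower P" and t: "0 \<le> t"
  defines "\<eta> \<equiv> tower_prod P (\<lambda>_. 0)" and "e \<equiv> axis i 1"
  shows "(LINT x|lborel. \<eta> x * (g (x + t *\<^sub>R e) - g x))
    = (LINT x|lborel. \<eta> x * (LINT s|lborel. indicator {0..t} s * G (x + s *\<^sub>R e)))"
proof -
  have [measurable]: "g \<in> borel_measurable borel" "G \<in> borel_measurable borel"
    using g G by (auto dest: box_integrable_measurable)
  have towers: "\<And>j. deriv_tower (P j)" using P by (simp add: test_tower_def)
  have cont: "continuous_on UNIV (P j k)" for j k
    using towers by (rule deriv_tower_continuous)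
  have \<eta>_cont: "continuous_on UNIV \<eta>"
    unfolding \<eta>_def tower_prod_def[abs_def]
    by (intro continuous_on_prod continuous_on_compose2[OF cont]) (auto intro!: continuous_intros)
  then have [measurable]: "\<eta> \<in> borel_measurable borel" by (rule borel_measurable_continuous_onI)
  obtain a b where supp: "\<And>x. x \<notin> cbox a b \<Longrightarrow> \<eta> x = 0"
    using test_tower_support[OF P] unfolding \<eta>_def by blast
  have "bounded (\<eta> ` cbox a b)"
    by (intro compact_imp_bounded compact_continuous_image continuous_on_subset[OF \<eta>_cont]) auto
  then obtain B where B: "\<And>x. x \<in> cbox a b \<Longrightarrow> \<bar>\<eta> x\<bar> \<le> B" and B0: "0 < B"
    by (auto simp: bounded_pos)
  then have B: "\<bar>\<eta> x\<bar> \<le> B" for x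
    by (cases "x \<in> cbox a b") (auto simp: supp)

  have "\<exists>\<Psi>. \<forall>x. (\<Psi> has_vector_derivative P i 0 x) (at x)"
    using einterval_antiderivative[of "-\<infinity>" "\<infinity>" "P i 0"] cont[of i 0]
    by (auto simp: continuous_on_eq_continuous_at)
  then obtain \<Psi> where \<Psi>: "\<And>x. (\<Psi> has_real_derivative P i 0 x) (at x)"
    by (auto simp: has_real_derivative_iff_has_vector_derivative)
  \<comment> \<open>Writing the window integral at level 0 as a difference of antiderivatives lets
    the tower continue with differences of the \<open>P i k\<close>. The derivative of the product
    in direction \<open>i\<close> is then a difference of translates of \<open>\<eta>\<close>, the
    product itself the window integral of \<open>\<eta>\<close>.\<close>
  define R where "R = P(i := \<lambda>k. case k of 0 \<Rightarrow> \<lambda>x. \<Psi> x - \<Psi> (x - t) | Suc k \<Rightarrow> \<lambda>x. P i k x - P i k (x - t))"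
  have shift: "((\<lambda>x. f (x - t)) has_real_derivative f' (x - t)) (at x)"
    if "\<And>x. (f has_real_derivative f' x) (at x)" for f f' :: "real \<Rightarrow> real" and x
  proof -
    have "((\<lambda>x. x - t) has_real_derivative 1) (at x)" by (auto intro!: derivative_eq_intros)
    from DERIV_chain2[OF that this] show ?thesis by simp
  qed
  have "deriv_tower (R i)"
    unfolding deriv_tower_def R_def
    using towers[of i] \<Psi> by (auto simp: deriv_tower_def split: nat.split intro!: DERIV_diff shift)
  moreover have "\<exists>A B. \<forall>x. x \<notin> {A..B} \<longrightarrow> R i 0 x = 0"
  proof -
    obtain A B where AB: "\<And>x. x \<notin> {A..B} \<Longrightarrow> P i 0 x = 0"
      using P unfolding test_tower_def by metis
    \<comment> \<open>\<open>\<Psi>\<close> need not have compact support, but its difference over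
      the window does: the support grows by the window length \<open>t\<close> on the right.\<close>
    have "R i 0 x = 0" if "x \<notin> {A..B + t}" for x
    proof -
      have z: "indicator {0..t} s * P i 0 (x - s) = 0" for s
        using AB[of "x - s"] that t by (auto simp: indicator_def)
      have "(LINT s|lborel. indicator {0..t} s * P i 0 (x - s)) = 0"
        by (simp only: z Bochner_Integration.integral_zero)
      then show ?thesis using integral_window_primitive[OF cont \<Psi> t] by (simp add: R_def)
    qed
    then show ?thesis by blast
  qed
  ultimately have R: "test_tower R"
    using P by (auto simp: test_tower_def R_def)

  have coord: "e $ j = (if j = i then 1 else 0)" for j
    by (auto simp: e_def axis_def)
  have \<eta>_shift: "\<eta> (x - s *\<^sub>R e) = P i 0 (x $ i - s) * (\<Prod>j\<in>UNIV - {i}. P j 0 (x $ j))" for x s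
    unfolding \<eta>_def tower_prod_def
    by (subst prod.remove[of UNIV i]) (auto simp: coord intro!: prod.cong)
  have "tower_prod R ((\<lambda>_. 0)(i := 1)) x = \<eta> x - \<eta> (x - t *\<^sub>R e)" for x
  proof -
    have "tower_prod R ((\<lambda>_. 0)(i := 1)) x = (P i 0 (x $ i) - P i 0 (x $ i - t)) * (\<Prod>j\<in>UNIV - {i}. P j 0 (x $ j))"
      unfolding tower_prod_def R_def by (subst prod.remove[of UNIV i]) (auto intro!: prod.cong)
    then show ?thesis using \<eta>_shift[of x 0] \<eta>_shift[of x t] by (simp add: left_diff_distrib)
  qed
  moreover have "tower_prod R (\<lambda>_. 0) x = (LINT s|lborel. indicator {0..t} s * \<eta> (x - s *\<^sub>R e))" for x
  proof -
    have "tower_prod R (\<lambda>_. 0) x = (\<Psi> (x $ i) - \<Psi> (x $ i - t)) * (\<Prod>j\<in>UNIV - {i}. P j 0 (x $ j))"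
      unfolding tower_prod_def R_def by (subst prod.remove[of UNIV i]) (auto intro!: prod.cong)
    also have "\<Psi> (x $ i) - \<Psi> (x $ i - t) = (LINT s|lborel. indicator {0..t} s * P i 0 (x $ i - s))"
      by (rule integral_window_primitive[OF cont \<Psi> t, symmetric])
    finally show ?thesis by (simp add: \<eta>_shift mult.assoc[symmetric])
  qed
  ultimately have main: "(LINT x|lborel. g x * (\<eta> x - \<eta> (x - t *\<^sub>R e)))
      = - (LINT x|lborel. G x * (LINT s|lborel. indicator {0..t} s * \<eta> (x - s *\<^sub>R e)))"
    using weak_partial_lborel[OF w R] by simp

  have gt: "box_integrable (\<lambda>x. g (x + t *\<^sub>R e))" using g by (rule box_integrable_translate)
  have i1: "integrable lborel (\<lambda>x. g x * \<eta> x)"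
    by (rule box_integrable_bounded_mult[OF g _ B supp]) auto
  have i2: "integrable lborel (\<lambda>x. g (x + t *\<^sub>R e) * \<eta> x)"
    by (rule box_integrable_bounded_mult[OF gt _ B supp]) auto
  have i3: "integrable lborel (\<lambda>x. g x * \<eta> (x - t *\<^sub>R e))"
    using integrable_lborel_translate[OF i2, of "- (t *\<^sub>R e)"] by simp
  have tr: "(LINT x|lborel. g x * \<eta> (x - t *\<^sub>R e)) = (LINT x|lborel. g (x + t *\<^sub>R e) * \<eta> x)"
    using integral_lborel_translate[of "\<lambda>x. g x * \<eta> (x - t *\<^sub>R e)" "t *\<^sub>R e"] by simp
  have "(LINT x|lborel. \<eta> x * (g (x + t *\<^sub>R e) - g x))
      = (LINT x|lborel. g (x + t *\<^sub>R e) * \<eta> x - g x * \<eta> x)"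
    by (simp add: algebra_simps)
  also have "\<dots> = (LINT x|lborel. g x * \<eta> (x - t *\<^sub>R e)) - (LINT x|lborel. g x * \<eta> x)"
    using i1 i2 tr by simp
  also have "\<dots> = - (LINT x|lborel. g x * (\<eta> x - \<eta> (x - t *\<^sub>R e)))"
    using i1 i3 by (simp add: right_diff_distrib)
  also have "\<dots> = (LINT x|lborel. \<eta> x * (LINT s|lborel. indicator {0..t} s * G (x + s *\<^sub>R e)))"
    unfolding main using integral_shear[OF G _ B supp, where t = t and e = e] by simp
  finally show ?thesis .
qed

text \<open>Fubini for the shear with the indicator of a box as \<open>k\<close>. The second claim
  removes the indicator by running through countably many boxes that exhaust the space, which keeps
  the exceptional set null.\<close>

lemma box_integrable_line_integral:
  fixes e :: "'a::euclidean_space"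
  assumes G: "box_integrable G"
  shows "box_integrable (\<lambda>x. LINT s|lborel. indicator {0..t} s * G (x + s *\<^sub>R e))"
    and "AE x in lborel. integrable lborel (\<lambda>s. indicator {0..t} s * G (x + s *\<^sub>R e))"
proof -
  have [measurable]: "G \<in> borel_measurable borel" using G by (rule box_integrable_measurable)
  have int: "integrable (lborel \<Otimes>\<^sub>M lborel) (\<lambda>(x, s). indicator (cbox a b) x * (indicator {0..t} s * G (x + s *\<^sub>R e)))"
    for a b
    by (rule integrable_shear(1)[OF G, of _ 1 a b]) (auto simp: indicator_def)
  show "box_integrable (\<lambda>x. LINT s|lborel. indicator {0..t} s * G (x + s *\<^sub>R e))"
    unfolding box_integrable_def
  proof (intro conjI allI)
    show "(\<lambda>x. LINT s|lborel. indicator {0..t} s * G (x + s *\<^sub>R e)) \<in> borel_measurable borel"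
      by measurable
    show "integrable lborel (\<lambda>x. indicator (cbox a b) x * (LINT s|lborel. indicator {0..t} s * G (x + s *\<^sub>R e)))" for a b
      using lborel_pair.integrable_fst[OF int[of a b]] by simp
  qed
  define B where "B n = cbox (- (real n *\<^sub>R One)) (real n *\<^sub>R One :: 'a)" for n
  have "AE x in lborel. \<forall>n. integrable lborel (\<lambda>s. indicator (B n) x * (indicator {0..t} s * G (x + s *\<^sub>R e)))"
    unfolding AE_all_countable B_def using lborel_pair.AE_integrable_fst[OF int] by blast
  then show "AE x in lborel. integrable lborel (\<lambda>s. indicator {0..t} s * G (x + s *\<^sub>R e))"
  proof eventually_elim
    case (elim x)
    have "x \<in> (\<Union>n. box (- (real n *\<^sub>R One)) (real n *\<^sub>R One :: 'a))" using UN_box_eq_UNIV by auto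
    then obtain n where "x \<in> B n" using box_subset_cbox unfolding B_def by blast
    with elim show ?case by (metis (no_types, lifting) Bochner_Integration.integrable_cong indicator_simps(1) mult_1)
  qed
qed

text \<open>The defect \<open>H\<close> between increment and line integral is orthogonal to every
  product of bumps. By dominated convergence its integral over each open box vanishes, hence
  \<open>H = 0\<close> almost everywhere.\<close>

lemma weak_partial_imp_line_primitive:
  fixes g G :: "real ^ 'n::finite \<Rightarrow> real"
  assumes w: "weak_partial g i G" and g: "box_integrable g" and G: "box_integrable G"
  shows "line_primitive g i G"
  unfolding line_primitive_def
proof (intro allI impI)
  fix t :: real assume t: "0 \<le> t"
  define e :: "real ^ 'n" where "e = axis i 1"
  define J where "J x = (LINT s|lborel. indicator {0..t} s * G (x + s *\<^sub>R e))" for x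
  define D where "D x = g (x + t *\<^sub>R e) - g x" for x
  define H where "H x = D x - J x" for x
  have J: "box_integrable J" unfolding J_def[abs_def] by (rule box_integrable_line_integral(1)[OF G])
  have D: "box_integrable D"
    unfolding D_def[abs_def] by (intro box_integrable_diff box_integrable_translate g)
  have H: "box_integrable H" unfolding H_def[abs_def] by (intro box_integrable_diff J D)
  then have [measurable]: "H \<in> borel_measurable borel" by (rule box_integrable_measurable)
  have "AE x in lborel. H x = 0"
  proof (rule AE_zero_if_box_integrals_zero[OF H])
    fix a b :: "real ^ 'n"
    define P where "P c j = (SOME F. deriv_tower F \<and> F 0 = bump (a $ j) (b $ j) c)" for c j
    have ex: "\<exists>F. deriv_tower F \<and> F 0 = bump (a $ j) (b $ j) c" for j c
      using ndiff_imp_deriv_tower[OF ndiff_bump, of "a $ j" "b $ j" c] by metis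
    have P: "deriv_tower (P c j)" "P c j 0 = bump (a $ j) (b $ j) c" for c j
      using someI_ex[OF ex[of j c]] by (simp_all add: P_def)
    have PT: "test_tower (P c)" for c
    proof -
      have "\<forall>x. x \<notin> {a $ j..b $ j} \<longrightarrow> P c j 0 x = 0" for j
        by (auto simp: P(2) intro!: bump_eq_0)
      with P(1) show ?thesis unfolding test_tower_def by blast
    qed
    define \<eta> where "\<eta> c = tower_prod (P c) (\<lambda>_. 0)" for c
    have \<eta>: "\<eta> c x = (\<Prod>j\<in>UNIV. bump (a $ j) (b $ j) c (x $ j))" for c x
      by (simp add: \<eta>_def tower_prod_def P(2))
    have cont: "continuous_on UNIV (bump (a $ j) (b $ j) c)" for j c
      using deriv_tower_continuous[OF P(1), of UNIV c j 0] by (simp add: P(2))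
    have "(\<lambda>x. bump (a $ j) (b $ j) c (x $ j)) \<in> borel_measurable borel" for j c
      by (rule borel_measurable_continuous_onI, rule continuous_on_compose2[OF cont _ subset_UNIV])
         (intro continuous_intros)
    then have [measurable]: "\<eta> c \<in> borel_measurable borel" for c
      unfolding \<eta>[abs_def] by (intro borel_measurable_prod) auto
    have \<eta>_bounds: "\<bar>\<eta> c x\<bar> \<le> 1" for c x
      unfolding \<eta> abs_prod by (intro prod_le_1) (auto simp: bump_bounds)
    have \<eta>_supp: "\<eta> c x = 0" if "x \<notin> cbox a b" for c x
    proof -
      from that obtain j where "x $ j \<notin> {a $ j..b $ j}" by (auto simp: mem_box_cart)
      then have "x $ j \<notin> {a $ j<..<b $ j}" by auto
      then show ?thesis unfolding \<eta> by (auto intro!: prod_zero bexI[of _ j] bump_eq_0)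
    qed
    have "(\<lambda>c. LINT x|lborel. \<eta> c x * H x) \<longlonglongrightarrow> (LINT x|lborel. indicator (box a b) x * H x)"
    proof (rule integral_dominated_convergence)
      show "integrable lborel (\<lambda>x. \<bar>indicator (cbox a b) x * H x\<bar>)"
        using H by (simp add: box_integrable_def)
      have "(\<lambda>c. \<eta> c x) \<longlonglongrightarrow> (\<Prod>j\<in>UNIV. indicator {a $ j<..<b $ j} (x $ j))" for x
        unfolding \<eta> by (intro tendsto_prod bump_tendsto)
      moreover have "(\<Prod>j\<in>UNIV. indicator {a $ j<..<b $ j} (x $ j)) = (indicator (box a b) x :: real)" for x
        by (auto simp: indicator_def mem_box_cart prod_eq_1_iff intro!: prod_zero)
      ultimately show "AE x in lborel. (\<lambda>c. \<eta> c x * H x) \<longlonglongrightarrow> indicator (box a b) x * H x"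
        by (auto intro!: tendsto_mult)
      have "norm (\<eta> c x * H x) \<le> \<bar>indicator (cbox a b) x * H x\<bar>" for c x
        using \<eta>_bounds[of c x] by (cases "x \<in> cbox a b") (auto simp: abs_mult \<eta>_supp mult_left_le_one_le)
      then show "AE x in lborel. norm (\<eta> c x * H x) \<le> \<bar>indicator (cbox a b) x * H x\<bar>" for c by simp
    qed simp_all
    moreover have "(LINT x|lborel. \<eta> c x * H x) = 0" for c
    proof -
      have "integrable lborel (\<lambda>x. K x * \<eta> c x)" if "box_integrable K" for K
        by (rule box_integrable_bounded_mult[OF that, where B = 1 and a = a and b = b])
           (simp_all add: \<eta>_bounds \<eta>_supp)
      from this[OF D] this[OF J] have "(LINT x|lborel. \<eta> c x * H x) = (LINT x|lborel. \<eta> c x * D x) - (LINT x|lborel. \<eta> c x * J x)"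
        by (simp add: H_def right_diff_distrib mult.commute)
      also have "\<dots> = 0"
        using weak_partial_difference[OF w g G PT[of c] t] by (simp add: \<eta>_def D_def J_def e_def)
      finally show ?thesis .
    qed
    ultimately show "(LINT x|lborel. indicator (box a b) x * H x) = 0"
      by (simp add: LIMSEQ_const_iff)
  qed
  with box_integrable_line_integral(2)[OF G, of t e]
  show "AE x in lborel. has_bochner_integral lborel (\<lambda>s. indicator {0..t} s * G (x + s *\<^sub>R axis i 1))
      (g (x + t *\<^sub>R axis i 1) - g x)"
  proof eventually_elim
    case (elim x)
    then show ?case by (simp add: has_bochner_integral_iff H_def D_def J_def e_def)
  qed
qed

section \<open>Mean size of differences of translates on a box\<close>

definition axis_restrict :: "'n set \<Rightarrow> real ^ 'n \<Rightarrow> real ^ 'n::finite" where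
  "axis_restrict I t = (\<chi> i. if i \<in> I then t $ i else 0)"

text \<open>If \<open>x\<close> and \<open>x + t *\<^sub>R e\<close> lie in the box, so does the
  segment between them. After exchanging the integrals each \<open>s\<close> in
  \<open>{0..t}\<close> contributes at most the integral of \<open>\<bar>G\<bar>\<close> over the
  box, and the length of the interval supplies the factor.\<close>

lemma line_primitive_difference_bound:
  fixes g G :: "real ^ 'n::finite \<Rightarrow> real" and a b :: "real ^ 'n"
  assumes L: "line_primitive g i G" and g: "box_integrable g" and G: "box_integrable G"
  defines "e \<equiv> axis i 1" and "Q \<equiv> cbox a b"
  shows "(\<integral>\<^sup>+x. indicator Q x * indicator Q (x + t *\<^sub>R e) * ennreal \<bar>g (x + t *\<^sub>R e) - g x\<bar> \<partial>lborel)
    \<le> ennreal \<bar>t\<bar> * (\<integral>\<^sup>+x. indicator Q x * ennreal \<bar>G x\<bar> \<partial>lborel)"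
proof -
  have [measurable]: "g \<in> borel_measurable borel" "G \<in> borel_measurable borel" "Q \<in> sets borel"
    using g G by (auto dest: box_integrable_measurable simp: Q_def)
  have nonneg: "(\<integral>\<^sup>+x. indicator Q x * indicator Q (x + t *\<^sub>R e) * ennreal \<bar>g (x + t *\<^sub>R e) - g x\<bar> \<partial>lborel)
    \<le> ennreal t * (\<integral>\<^sup>+x. indicator Q x * ennreal \<bar>G x\<bar> \<partial>lborel)" if t: "0 \<le> t" for t
  proof -
    have "(\<integral>\<^sup>+x. indicator Q x * indicator Q (x + t *\<^sub>R e) * ennreal \<bar>g (x + t *\<^sub>R e) - g x\<bar> \<partial>lborel)
      \<le> (\<integral>\<^sup>+x. \<integral>\<^sup>+s. indicator {0..t} s * (indicator Q (x + s *\<^sub>R e) * ennreal \<bar>G (x + s *\<^sub>R e)\<bar>) \<partial>lborel \<partial>lborel)"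
    proof (rule nn_integral_mono_AE)
      from L t have "AE x in lborel. has_bochner_integral lborel (\<lambda>s. indicator {0..t} s * G (x + s *\<^sub>R e))
          (g (x + t *\<^sub>R e) - g x)" by (auto simp: line_primitive_def e_def)
      then show "AE x in lborel. indicator Q x * indicator Q (x + t *\<^sub>R e) * ennreal \<bar>g (x + t *\<^sub>R e) - g x\<bar>
        \<le> (\<integral>\<^sup>+s. indicator {0..t} s * (indicator Q (x + s *\<^sub>R e) * ennreal \<bar>G (x + s *\<^sub>R e)\<bar>) \<partial>lborel)"
      proof eventually_elim
        case (elim x)
        show ?case
        proof (cases "x \<in> Q \<and> x + t *\<^sub>R e \<in> Q")
          case True
          have Q: "x + s *\<^sub>R e \<in> Q" if "s \<in> {0..t}" for s
            unfolding Q_def mem_box_cart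
          proof (intro allI)
            fix j
            have "a $ j \<le> x $ j" "x $ j \<le> b $ j" "x $ j + t * e $ j \<le> b $ j"
              using True by (auto simp: Q_def mem_box_cart)
            moreover have "e $ j = 0 \<or> e $ j = 1" by (auto simp: e_def axis_def)
            ultimately show "a $ j \<le> (x + s *\<^sub>R e) $ j \<and> (x + s *\<^sub>R e) $ j \<le> b $ j"
              using that by auto
          qed
          have "ennreal \<bar>g (x + t *\<^sub>R e) - g x\<bar>
            \<le> (\<integral>\<^sup>+s. ennreal (norm (indicator {0..t} s * G (x + s *\<^sub>R e))) \<partial>lborel)"
            using elim integral_norm_bound_ennreal[of lborel "\<lambda>s. indicator {0..t} s * G (x + s *\<^sub>R e)"]
            by (auto simp: has_bochner_integral_iff)
          also have "\<dots> = (\<integral>\<^sup>+s. indicator {0..t} s * (indicator Q (x + s *\<^sub>R e) * ennreal \<bar>G (x + s *\<^sub>R e)\<bar>) \<partial>lborel)"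
            using Q by (intro nn_integral_cong) (auto simp: indicator_def)
          finally show ?thesis using True by simp
        qed auto
      qed
    qed
    also have "\<dots> = (\<integral>\<^sup>+s. \<integral>\<^sup>+x. indicator {0..t} s * (indicator Q (x + s *\<^sub>R e) * ennreal \<bar>G (x + s *\<^sub>R e)\<bar>) \<partial>lborel \<partial>lborel)"
      by (rule lborel_pair.Fubini'[symmetric]) simp
    also have "\<dots> = (\<integral>\<^sup>+s. indicator {0..t} s * (\<integral>\<^sup>+x. indicator Q x * ennreal \<bar>G x\<bar> \<partial>lborel) \<partial>lborel)"
      by (simp add: nn_integral_cmult nn_integral_lborel_translate[of "\<lambda>x. indicator Q x * ennreal \<bar>G x\<bar>"])
    also have "\<dots> = ennreal t * (\<integral>\<^sup>+x. indicator Q x * ennreal \<bar>G x\<bar> \<partial>lborel)"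
      using t by (simp add: nn_integral_multc)
    finally show ?thesis .
  qed
  show ?thesis
  proof (cases "0 \<le> t")
    case False
    \<comment> \<open>For negative \<open>t\<close> a translation exchanges the two end points,
      which reduces the claim to the displacement \<open>- t\<close>.\<close>
    define h where "h x = indicator Q x * indicator Q (x + t *\<^sub>R e) * ennreal \<bar>g (x + t *\<^sub>R e) - g x\<bar>" for x
    have [measurable]: "h \<in> borel_measurable borel" unfolding h_def by measurable
    have "(\<integral>\<^sup>+x. h x \<partial>lborel) = (\<integral>\<^sup>+x. h (x + (- t) *\<^sub>R e) \<partial>lborel)"
      by (rule nn_integral_lborel_translate[symmetric]) simp
    also have "\<dots> = (\<integral>\<^sup>+x. indicator Q x * indicator Q (x + (- t) *\<^sub>R e) * ennreal \<bar>g (x + (- t) *\<^sub>R e) - g x\<bar> \<partial>lborel)"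
      unfolding h_def by (intro nn_integral_cong) (simp add: abs_minus_commute mult.commute)
    also have "\<dots> \<le> ennreal (- t) * (\<integral>\<^sup>+x. indicator Q x * ennreal \<bar>G x\<bar> \<partial>lborel)"
      using False by (intro nonneg) simp
    finally show ?thesis using False by (simp add: h_def)
  qed (use nonneg in simp)
qed

text \<open>The displacement is carried out one coordinate at a time. Every intermediate point has
  each coordinate equal to that of one of the two end points, so it stays in the box and the bound
  in an axis direction applies to each leg.\<close>

lemma translation_difference_bound:
  fixes g :: "real ^ 'n::finite \<Rightarrow> real" and G :: "'n \<Rightarrow> real ^ 'n \<Rightarrow> real"
    and a b t :: "real ^ 'n"
  assumes L: "\<And>i. line_primitive g i (G i)" and g: "box_integrable g" and G: "\<And>i. box_integrable (G i)"
    and I: "finite I"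
  defines "Q \<equiv> cbox a b"
  shows "(\<integral>\<^sup>+x. indicator Q x * indicator Q (x + axis_restrict I t) * ennreal \<bar>g (x + axis_restrict I t) - g x\<bar> \<partial>lborel)
    \<le> (\<Sum>i\<in>I. ennreal \<bar>t $ i\<bar> * (\<integral>\<^sup>+x. indicator Q x * ennreal \<bar>G i x\<bar> \<partial>lborel))"
  using I
proof (induction I)
  case empty
  have "axis_restrict {} t = 0" by (simp add: axis_restrict_def vec_eq_iff)
  then show ?case by simp
next
  case (insert i I)
  have [measurable]: "g \<in> borel_measurable borel" "G i \<in> borel_measurable borel" "Q \<in> sets borel" for i
    using g G by (auto dest: box_integrable_measurable simp: Q_def)
  define y where "y x = x + axis_restrict I t" for x
  define e :: "real ^ 'n" where "e = axis i 1"
  have [measurable]: "y \<in> borel_measurable borel" unfolding y_def by measurable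
  have step: "x + axis_restrict (insert i I) t = y x + (t $ i) *\<^sub>R e" for x
    using insert.hyps by (auto simp: y_def e_def axis_restrict_def vec_eq_iff axis_def)
  define h where "h x = indicator Q x * indicator Q (x + (t $ i) *\<^sub>R e) * ennreal \<bar>g (x + (t $ i) *\<^sub>R e) - g x\<bar>" for x
  have [measurable]: "h \<in> borel_measurable borel" unfolding h_def by measurable
  have "(\<integral>\<^sup>+x. indicator Q x * indicator Q (x + axis_restrict (insert i I) t)
      * ennreal \<bar>g (x + axis_restrict (insert i I) t) - g x\<bar> \<partial>lborel)
    \<le> (\<integral>\<^sup>+x. h (x + axis_restrict I t) + indicator Q x * indicator Q (y x) * ennreal \<bar>g (y x) - g x\<bar> \<partial>lborel)"
  proof (rule nn_integral_mono)
    fix x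
    show "indicator Q x * indicator Q (x + axis_restrict (insert i I) t)
      * ennreal \<bar>g (x + axis_restrict (insert i I) t) - g x\<bar>
      \<le> h (x + axis_restrict I t) + indicator Q x * indicator Q (y x) * ennreal \<bar>g (y x) - g x\<bar>"
    proof (cases "x \<in> Q \<and> x + axis_restrict (insert i I) t \<in> Q")
      case True
      have "y x \<in> Q"
        unfolding Q_def mem_box_cart
      proof
        fix j
        have "y x $ j = x $ j \<or> y x $ j = (x + axis_restrict (insert i I) t) $ j"
          using insert.hyps by (auto simp: y_def axis_restrict_def)
        then show "a $ j \<le> y x $ j \<and> y x $ j \<le> b $ j"
          using True unfolding Q_def mem_box_cart by metis
      qed
      moreover have "ennreal \<bar>g (y x + (t $ i) *\<^sub>R e) - g x\<bar>
        \<le> ennreal \<bar>g (y x + (t $ i) *\<^sub>R e) - g (y x)\<bar> + ennreal \<bar>g (y x) - g x\<bar>"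
        by (subst ennreal_plus[symmetric]) (auto simp del: ennreal_plus intro!: ennreal_leI)
      ultimately show ?thesis using True by (simp add: step h_def y_def[symmetric])
    qed auto
  qed
  also have "\<dots> = (\<integral>\<^sup>+x. h x \<partial>lborel)
      + (\<integral>\<^sup>+x. indicator Q x * indicator Q (y x) * ennreal \<bar>g (y x) - g x\<bar> \<partial>lborel)"
    by (subst nn_integral_add) (auto simp: nn_integral_lborel_translate)
  also have "\<dots> \<le> ennreal \<bar>t $ i\<bar> * (\<integral>\<^sup>+x. indicator Q x * ennreal \<bar>G i x\<bar> \<partial>lborel)
      + (\<Sum>i\<in>I. ennreal \<bar>t $ i\<bar> * (\<integral>\<^sup>+x. indicator Q x * ennreal \<bar>G i x\<bar> \<partial>lborel))"
    using insert.IH line_primitive_difference_bound[OF L g G, of a b "t $ i" i]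
    by (intro add_mono) (simp_all add: h_def e_def Q_def y_def)
  finally show ?case using insert.hyps by simp
qed

lemma mem_cube: "x \<in> cube a l \<longleftrightarrow> (\<forall>i. a $ i \<le> x $ i \<and> x $ i \<le> a $ i + l)"
  by (auto simp: cube_def mem_box_cart)

lemma emeasure_lborel_cube:
  fixes a :: "real ^ 'n::finite"
  assumes "0 \<le> l"
  shows "emeasure lborel (cube a l) = ennreal (l ^ CARD('n))"
proof -
  have "a \<in> cube a l" using assms by (simp add: mem_cube)
  then have "measure lborel (cube a l) = l ^ CARD('n)"
    unfolding cube_def by (subst content_cbox_cart) auto
  moreover have "emeasure lborel (cube a l) \<noteq> \<infinity>"
    unfolding cube_def using emeasure_lborel_cbox_finite[of a] by (auto simp: less_top)
  ultimately show ?thesis by (metis emeasure_eq_ennreal_measure infinity_ennreal_def)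
qed

section \<open>Poincare inequalities on cubes\<close>

definition bmean :: "'a::euclidean_space set \<Rightarrow> ('a \<Rightarrow> real) \<Rightarrow> real" where
  "bmean Q h = (LINT x|lborel. indicator Q x * h x) / measure lborel Q"

lemma measure_lborel_cube:
  fixes a :: "real ^ 'n::finite"
  assumes "0 \<le> l"
  shows "measure lborel (cube a l) = l ^ CARD('n)"
  using emeasure_lborel_cube[OF assms, of a] assms by (simp add: measure_def)

lemma cube_measurable [measurable]: "cube a l \<in> sets borel"
  by (simp add: cube_def)

lemma box_integrable_cube:
  "box_integrable h \<Longrightarrow> integrable lborel (\<lambda>x. indicator (cube a l) x * h x)"
  by (simp add: box_integrable_def cube_def)

lemma abs_diff_bmean_le:
  fixes g :: "real ^ 'n::finite \<Rightarrow> real"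
  assumes g: "box_integrable g" and l: "0 < l"
  shows "ennreal \<bar>g x - bmean (cube a l) g\<bar>
    \<le> ennreal (1 / l ^ CARD('n)) * (\<integral>\<^sup>+y. indicator (cube a l) y * ennreal \<bar>g y - g x\<bar> \<partial>lborel)"
proof -
  let ?Q = "cube a l" and ?V = "l ^ CARD('n)"
  have [measurable]: "g \<in> borel_measurable borel" using g by (rule box_integrable_measurable)
  have ig: "integrable lborel (\<lambda>y. indicator ?Q y * g y)" using g by (rule box_integrable_cube)
  have i1: "integrable lborel (\<lambda>y. indicator ?Q y * g x)"
    using emeasure_lborel_cube[of l a] l by (intro integrable_mult_left) (simp add: integrable_real_indicator)
  have V: "0 < ?V" using l by simp
  have "(LINT y|lborel. indicator ?Q y * (g y - g x)) = (LINT y|lborel. indicator ?Q y * g y) - ?V * g x"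
  proof -
    have "(LINT y|lborel. indicator ?Q y * (g y - g x))
      = (LINT y|lborel. indicator ?Q y * g y - indicator ?Q y * g x)" by (simp add: right_diff_distrib)
    also have "\<dots> = (LINT y|lborel. indicator ?Q y * g y) - (LINT y|lborel. indicator ?Q y * g x)"
      using ig i1 by (rule Bochner_Integration.integral_diff)
    also have "(LINT y|lborel. indicator ?Q y * g x) = ?V * g x"
      using l by (simp add: measure_lborel_cube)
    finally show ?thesis .
  qed
  moreover define A where "A = (LINT y|lborel. indicator ?Q y * g y)"
  moreover define J where "J = (LINT y|lborel. indicator ?Q y * (g y - g x))"
  ultimately have J: "A = J + ?V * g x" by simp
  have "bmean ?Q g = A / ?V" using l by (simp add: bmean_def measure_lborel_cube A_def)
  then have "g x - bmean ?Q g = - ((1 / ?V) * J)"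
    using V l by (simp add: J add_divide_distrib)
  then have "\<bar>g x - bmean ?Q g\<bar> = (1 / ?V) * \<bar>J\<bar>"
    using V by (simp add: abs_mult)
  then have "ennreal \<bar>g x - bmean ?Q g\<bar> = ennreal (1 / ?V) * ennreal \<bar>LINT y|lborel. indicator ?Q y * (g y - g x)\<bar>"
    using V ennreal_mult'[of "1 / ?V" "\<bar>J\<bar>"] by (simp only: J_def zero_le_divide_1_iff less_imp_le)
  also have "ennreal \<bar>LINT y|lborel. indicator ?Q y * (g y - g x)\<bar>
      \<le> (\<integral>\<^sup>+y. ennreal (norm (indicator ?Q y * (g y - g x))) \<partial>lborel)"
  proof -
    have "integrable lborel (\<lambda>y. indicator ?Q y * (g y - g x))"
      using ig i1 by (simp add: right_diff_distrib)
    from integral_norm_bound_ennreal[OF this] show ?thesis by simp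
  qed
  also have "\<dots> = (\<integral>\<^sup>+y. indicator ?Q y * ennreal \<bar>g y - g x\<bar> \<partial>lborel)"
    by (intro nn_integral_cong) (simp add: indicator_def)
  finally show ?thesis by (simp add: mult_left_mono)
qed

text \<open>With \<open>y = x + t\<close> only displacements with all
  \<open>\<bar>t $ i\<bar> \<le> l\<close> contribute. They fill a cube of side
  \<open>2 * l\<close>, whose volume is the power in the constant; the remaining factor
  \<open>l\<close> bounds each coordinate of \<open>t\<close>.\<close>

lemma double_difference_bound:
  fixes g :: "real ^ 'n::finite \<Rightarrow> real" and G :: "'n \<Rightarrow> real ^ 'n \<Rightarrow> real"
  assumes L: "\<And>i. line_primitive g i (G i)" and g: "box_integrable g" and G: "\<And>i. box_integrable (G i)"
    and l: "0 < l"
  shows "(\<integral>\<^sup>+x. indicator (cube a l) x * (\<integral>\<^sup>+y. indicator (cube a l) y * ennreal \<bar>g y - g x\<bar> \<partial>lborel) \<partial>lborel)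
    \<le> ennreal ((2 * l) ^ CARD('n) * l) * (\<Sum>i\<in>UNIV. \<integral>\<^sup>+x. indicator (cube a l) x * ennreal \<bar>G i x\<bar> \<partial>lborel)"
proof -
  let ?Q = "cube a l"
  let ?S = "\<Sum>i\<in>UNIV. \<integral>\<^sup>+x. indicator ?Q x * ennreal \<bar>G i x\<bar> \<partial>lborel"
  have [measurable]: "g \<in> borel_measurable borel" using g by (rule box_integrable_measurable)
  have "(\<integral>\<^sup>+x. indicator ?Q x * (\<integral>\<^sup>+y. indicator ?Q y * ennreal \<bar>g y - g x\<bar> \<partial>lborel) \<partial>lborel)
    = (\<integral>\<^sup>+x. \<integral>\<^sup>+t. indicator ?Q x * indicator ?Q (x + t) * ennreal \<bar>g (x + t) - g x\<bar> \<partial>lborel \<partial>lborel)"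
  proof (rule nn_integral_cong)
    fix x
    have "(\<integral>\<^sup>+y. indicator ?Q y * ennreal \<bar>g y - g x\<bar> \<partial>lborel)
      = (\<integral>\<^sup>+t. indicator ?Q (x + t) * ennreal \<bar>g (x + t) - g x\<bar> \<partial>lborel)"
      using nn_integral_lborel_translate[of "\<lambda>y. indicator ?Q y * ennreal \<bar>g y - g x\<bar>" x]
      by (simp add: add.commute)
    then show "indicator ?Q x * (\<integral>\<^sup>+y. indicator ?Q y * ennreal \<bar>g y - g x\<bar> \<partial>lborel)
      = (\<integral>\<^sup>+t. indicator ?Q x * indicator ?Q (x + t) * ennreal \<bar>g (x + t) - g x\<bar> \<partial>lborel)"
      by (simp add: nn_integral_cmult[symmetric] mult.assoc)
  qed
  also have "\<dots> = (\<integral>\<^sup>+t. \<integral>\<^sup>+x. indicator ?Q x * indicator ?Q (x + t) * ennreal \<bar>g (x + t) - g x\<bar> \<partial>lborel \<partial>lborel)"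
    by (rule lborel_pair.Fubini'[symmetric]) simp
  also have "\<dots> \<le> (\<integral>\<^sup>+t. (ennreal l * ?S) * indicator (cube (- (\<chi> i. l) :: real ^ 'n) (2 * l)) t \<partial>lborel)"
  proof (rule nn_integral_mono)
    fix t :: "real ^ 'n"
    have mem: "t \<in> cube (- (\<chi> i. l)) (2 * l) \<longleftrightarrow> (\<forall>i. \<bar>t $ i\<bar> \<le> l)"
      unfolding mem_cube abs_le_iff by (auto simp: minus_le_iff)
    show "(\<integral>\<^sup>+x. indicator ?Q x * indicator ?Q (x + t) * ennreal \<bar>g (x + t) - g x\<bar> \<partial>lborel)
      \<le> (ennreal l * ?S) * indicator (cube (- (\<chi> i. l) :: real ^ 'n) (2 * l)) t"
    proof (cases "t \<in> cube (- (\<chi> i. l)) (2 * l)")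
      case True
      then have t: "\<bar>t $ i\<bar> \<le> l" for i by (simp add: mem)
      have "axis_restrict UNIV t = t" by (simp add: axis_restrict_def vec_eq_iff)
      then have "(\<integral>\<^sup>+x. indicator ?Q x * indicator ?Q (x + t) * ennreal \<bar>g (x + t) - g x\<bar> \<partial>lborel)
        \<le> (\<Sum>i\<in>UNIV. ennreal \<bar>t $ i\<bar> * (\<integral>\<^sup>+x. indicator ?Q x * ennreal \<bar>G i x\<bar> \<partial>lborel))"
        using translation_difference_bound[OF L g G finite, where a = a and b = "a + (\<chi> i. l)" and t = t and I = UNIV]
        by (simp add: cube_def)
      also have "\<dots> \<le> ennreal l * ?S"
        unfolding sum_distrib_left using t by (intro sum_mono mult_right_mono ennreal_leI) auto
      finally show ?thesis using True by simp
    next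
      case False
      have z: "indicator ?Q x * indicator ?Q (x + t) = (0::ennreal)" for x
      proof -
        from False obtain i where "\<not> \<bar>t $ i\<bar> \<le> l" by (auto simp: mem)
        moreover have "\<bar>t $ i\<bar> \<le> l" if "x \<in> ?Q" "x + t \<in> ?Q"
          using that[unfolded mem_cube, rule_format, of i] by (simp add: abs_le_iff)
        ultimately have "\<not> (x \<in> ?Q \<and> x + t \<in> ?Q)" by blast
        then show ?thesis by (auto simp: indicator_def)
      qed
      show ?thesis by (simp only: z mult_zero_left nn_integral_const zero_le)
    qed
  qed
  also have "\<dots> = ennreal l * ?S * ennreal ((2 * l) ^ CARD('n))"
    using l by (subst nn_integral_cmult_indicator) (simp_all add: emeasure_lborel_cube)
  also have "\<dots> = ennreal ((2 * l) ^ CARD('n) * l) * ?S"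
  proof -
    have "ennreal ((2 * l) ^ CARD('n) * l) = ennreal ((2 * l) ^ CARD('n)) * ennreal l"
      using l by (intro ennreal_mult) auto
    then show ?thesis by (simp only: ac_simps)
  qed
  finally show ?thesis .
qed

text \<open>The deviation from the mean is at most the mean over \<open>y\<close> of
  \<open>\<bar>g y - g x\<bar>\<close>. Dividing the constant of the double integral by the volume
  \<open>l ^ CARD('n)\<close> leaves \<open>2 ^ CARD('n) * l\<close>.\<close>

lemma poincare_first_order:
  fixes g :: "real ^ 'n::finite \<Rightarrow> real" and G :: "'n \<Rightarrow> real ^ 'n \<Rightarrow> real"
  assumes L: "\<And>i. line_primitive g i (G i)" and g: "box_integrable g" and G: "\<And>i. box_integrable (G i)"
    and l: "0 < l"
  shows "(\<integral>\<^sup>+x. indicator (cube a l) x * ennreal \<bar>g x - bmean (cube a l) g\<bar> \<partial>lborel)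
    \<le> ennreal (2 ^ CARD('n) * l) * (\<Sum>i\<in>UNIV. \<integral>\<^sup>+x. indicator (cube a l) x * ennreal \<bar>G i x\<bar> \<partial>lborel)"
proof -
  let ?Q = "cube a l" and ?V = "l ^ CARD('n)"
  let ?S = "\<Sum>i\<in>UNIV. \<integral>\<^sup>+x. indicator ?Q x * ennreal \<bar>G i x\<bar> \<partial>lborel"
  have [measurable]: "g \<in> borel_measurable borel" using g by (rule box_integrable_measurable)
  have "(\<integral>\<^sup>+x. indicator ?Q x * ennreal \<bar>g x - bmean ?Q g\<bar> \<partial>lborel)
    \<le> (\<integral>\<^sup>+x. ennreal (1 / ?V) * (indicator ?Q x * (\<integral>\<^sup>+y. indicator ?Q y * ennreal \<bar>g y - g x\<bar> \<partial>lborel)) \<partial>lborel)"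
    using abs_diff_bmean_le[OF g l, of _ a]
    by (intro nn_integral_mono) (auto simp: indicator_def)
  also have "\<dots> = ennreal (1 / ?V) * (\<integral>\<^sup>+x. indicator ?Q x * (\<integral>\<^sup>+y. indicator ?Q y * ennreal \<bar>g y - g x\<bar> \<partial>lborel) \<partial>lborel)"
    by (rule nn_integral_cmult) measurable
  also have "\<dots> \<le> ennreal (1 / ?V) * (ennreal ((2 * l) ^ CARD('n) * l) * ?S)"
    by (intro mult_left_mono double_difference_bound[OF L g G l]) simp
  also have "\<dots> = ennreal (1 / ?V * ((2 * l) ^ CARD('n) * l)) * ?S"
  proof -
    have "0 \<le> 1 / ?V" using l by simp
    from ennreal_mult'[OF this] show ?thesis by (simp only: mult.assoc)
  qed
  also have "1 / ?V * ((2 * l) ^ CARD('n) * l) = 2 ^ CARD('n) * l"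
    using l by (simp add: power_mult_distrib)
  finally show ?thesis .
qed

section \<open>Multi-indices, polynomials of bounded degree and the inequality of order m\<close>

lemma finite_midx_le: "finite {\<sigma> :: 'n::finite \<Rightarrow> nat. midx_order \<sigma> \<le> k}"
proof (rule finite_subset)
  show "{\<sigma> :: 'n \<Rightarrow> nat. midx_order \<sigma> \<le> k} \<subseteq> PiE UNIV (\<lambda>_. {..k})"
  proof
    fix \<sigma> :: "'n \<Rightarrow> nat" assume "\<sigma> \<in> {\<sigma>. midx_order \<sigma> \<le> k}"
    then have "\<sigma> i \<le> k" for i
      using member_le_sum[of i UNIV \<sigma>] by (simp add: midx_order_def)
    then show "\<sigma> \<in> PiE UNIV (\<lambda>_. {..k})" by auto
  qed
qed (simp add: finite_PiE)

lemma finite_midx_eq: "finite {\<sigma> :: 'n::finite \<Rightarrow> nat. midx_order \<sigma> = k}"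
  by (rule finite_subset[OF _ finite_midx_le[of k]]) auto

lemma polys_upto_add:
  assumes "f \<in> polys_upto k" "g \<in> polys_upto k"
  shows "(\<lambda>x. f x + g x) \<in> polys_upto k"
proof -
  from assms obtain c d where "f = (\<lambda>x. \<Sum>\<sigma> | midx_order \<sigma> \<le> k. c \<sigma> * (\<Prod>i\<in>UNIV. (x $ i) ^ \<sigma> i))"
    "g = (\<lambda>x. \<Sum>\<sigma> | midx_order \<sigma> \<le> k. d \<sigma> * (\<Prod>i\<in>UNIV. (x $ i) ^ \<sigma> i))"
    unfolding polys_upto_def by blast
  then have "(\<lambda>x. f x + g x) = (\<lambda>x. \<Sum>\<sigma> | midx_order \<sigma> \<le> k. (c \<sigma> + d \<sigma>) * (\<Prod>i\<in>UNIV. (x $ i) ^ \<sigma> i))"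
    by (simp only: distrib_right sum.distrib)
  then show ?thesis unfolding polys_upto_def by (intro CollectI exI)
qed

lemma polys_upto_cmult:
  assumes "f \<in> polys_upto k"
  shows "(\<lambda>x. a * f x) \<in> polys_upto k"
proof -
  from assms obtain c where "f = (\<lambda>x. \<Sum>\<sigma> | midx_order \<sigma> \<le> k. c \<sigma> * (\<Prod>i\<in>UNIV. (x $ i) ^ \<sigma> i))"
    unfolding polys_upto_def by blast
  then have "(\<lambda>x. a * f x) = (\<lambda>x. \<Sum>\<sigma> | midx_order \<sigma> \<le> k. (a * c \<sigma>) * (\<Prod>i\<in>UNIV. (x $ i) ^ \<sigma> i))"
    by (simp only: sum_distrib_left mult.assoc)
  then show ?thesis unfolding polys_upto_def by (intro CollectI exI)
qed

lemma polys_upto_monomial: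
  fixes \<sigma> :: "'n::finite \<Rightarrow> nat"
  assumes "midx_order \<sigma> \<le> k"
  shows "(\<lambda>x :: real ^ 'n. \<Prod>i\<in>UNIV. (x $ i) ^ \<sigma> i) \<in> polys_upto k"
proof -
  have "(\<Prod>i\<in>UNIV. (x $ i) ^ \<sigma> i)
    = (\<Sum>\<tau> | midx_order \<tau> \<le> k. (if \<tau> = \<sigma> then 1 else 0) * (\<Prod>i\<in>UNIV. (x $ i) ^ \<tau> i))"
    for x :: "real ^ 'n"
  proof -
    have "(\<Sum>\<tau> | midx_order \<tau> \<le> k. (if \<tau> = \<sigma> then 1 else 0) * (\<Prod>i\<in>UNIV. (x $ i) ^ \<tau> i))
      = (\<Sum>\<tau> | midx_order \<tau> \<le> k. if \<tau> = \<sigma> then \<Prod>i\<in>UNIV. (x $ i) ^ \<tau> i else 0)"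
      by (intro sum.cong) auto
    then show ?thesis using assms by (simp add: sum.delta finite_midx_le)
  qed
  then show ?thesis
    unfolding polys_upto_def by (intro CollectI exI[of _ "\<lambda>\<tau>. if \<tau> = \<sigma> then 1 else 0"] ext)
qed

lemma polys_upto_zero: "(\<lambda>_. 0) \<in> polys_upto k"
  unfolding polys_upto_def by (rule CollectI, rule exI[of _ "\<lambda>_. 0"]) simp

lemma polys_upto_sum:
  assumes "\<And>i. i \<in> I \<Longrightarrow> f i \<in> polys_upto k"
  shows "(\<lambda>x. \<Sum>i\<in>I. f i x) \<in> polys_upto k"
  using assms by (induction I rule: infinite_finite_induct) (auto simp: polys_upto_zero polys_upto_add)

lemma polys_upto_diff:
  assumes "f \<in> polys_upto k" "g \<in> polys_upto k"
  shows "(\<lambda>x. f x - g x) \<in> polys_upto k"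
  using polys_upto_add[OF assms(1) polys_upto_cmult[OF assms(2), of "-1"]] by simp

text \<open>The polynomials are the linear span of the monomials, so a property that cuts out a
  linear subspace has to be checked on monomials only.\<close>

lemma polys_upto_induct:
  assumes "f \<in> polys_upto k"
    and "\<And>\<sigma>. midx_order \<sigma> \<le> k \<Longrightarrow> (\<lambda>x. \<Prod>i\<in>UNIV. (x $ i) ^ \<sigma> i) \<in> S"
    and "(\<lambda>_. 0) \<in> S"
    and "\<And>f g. f \<in> S \<Longrightarrow> g \<in> S \<Longrightarrow> (\<lambda>x. f x + g x) \<in> S"
    and "\<And>c f. f \<in> S \<Longrightarrow> (\<lambda>x. c * f x) \<in> S"
  shows "f \<in> S"
proof -
  from assms(1) obtain c where f: "f = (\<lambda>x. \<Sum>\<sigma> | midx_order \<sigma> \<le> k. c \<sigma> * (\<Prod>i\<in>UNIV. (x $ i) ^ \<sigma> i))"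
    unfolding polys_upto_def by blast
  have "(\<lambda>x. \<Sum>\<sigma>\<in>I. c \<sigma> * (\<Prod>i\<in>UNIV. (x $ i) ^ \<sigma> i)) \<in> S"
    if "finite I" "I \<subseteq> {\<sigma>. midx_order \<sigma> \<le> k}" for I
    using that
  proof (induction I)
    case (insert \<sigma> I)
    then have "(\<lambda>x. c \<sigma> * (\<Prod>i\<in>UNIV. (x $ i) ^ \<sigma> i)) \<in> S" by (intro assms) simp
    from assms(4)[OF this, of "\<lambda>x. \<Sum>\<sigma>\<in>I. c \<sigma> * (\<Prod>i\<in>UNIV. (x $ i) ^ \<sigma> i)"] insert
    show ?case by simp
  qed (simp add: assms)
  then show ?thesis unfolding f using finite_midx_le by blast
qed

lemma polys_upto_mono:
  assumes "f \<in> polys_upto j" "j \<le> k"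
  shows "f \<in> polys_upto k"
  using assms(1)
  by (rule polys_upto_induct)
     (use assms(2) in \<open>auto intro: polys_upto_monomial polys_upto_zero polys_upto_add polys_upto_cmult\<close>)

lemma polys_upto_continuous:
  fixes f :: "real ^ 'n::finite \<Rightarrow> real"
  assumes "f \<in> polys_upto k"
  shows "continuous_on UNIV f"
proof -
  have "f \<in> {f. continuous_on UNIV f}"
    using assms
    by (rule polys_upto_induct) (auto intro!: continuous_intros)
  then show ?thesis by simp
qed

text \<open>Derivatives of \<open>y ^ n / fact n\<close>. With the factorial each derivative is a
  normalised power again, and the one of order \<open>n\<close> is exactly 1.\<close>

definition power_tower :: "nat \<Rightarrow> nat \<Rightarrow> real \<Rightarrow> real" where
  "power_tower n k y = (if k \<le> n then y ^ (n - k) / fact (n - k) else 0)"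

lemma deriv_tower_power: "deriv_tower (power_tower n)"
  unfolding deriv_tower_def
proof (intro allI)
  fix k y
  consider "k < n" | "k = n" | "n < k" by linarith
  then show "(power_tower n k has_real_derivative power_tower n (Suc k) y) (at y)"
  proof cases
    case 1
    then obtain j where j: "n - k = Suc j" by (metis Suc_diff_Suc)
    have "((\<lambda>y::real. y ^ Suc j / fact (Suc j)) has_real_derivative (real (Suc j) * y ^ j) / fact (Suc j)) (at y)"
      using DERIV_pow[of "Suc j" y] by (intro DERIV_cdivide) simp
    moreover have "(real (Suc j) * y ^ j) / fact (Suc j) = y ^ j / fact j"
      by (simp add: field_simps del: of_nat_Suc)
    ultimately show ?thesis using 1 j Suc_diff_Suc[of k n]
      by (simp add: power_tower_def[abs_def] del: fact_Suc power_Suc of_nat_Suc)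
  qed (simp_all add: power_tower_def[abs_def])
qed

text \<open>For smooth products the fundamental theorem of calculus holds on every line. It keeps
  the chain of line primitives intact when polynomials are subtracted from a family of
  derivatives.\<close>

lemma tower_prod_line_primitive:
  assumes "\<And>j. deriv_tower (F j)"
  shows "line_primitive (tower_prod F \<sigma>) i (tower_prod F (\<sigma>(i := Suc (\<sigma> i))))"
  unfolding line_primitive_def
proof (intro allI impI AE_I2)
  fix t :: real and x :: "real ^ 'a" assume t: "0 \<le> t"
  define R where "R = (\<Prod>j\<in>UNIV - {i}. F j (\<sigma> j) (x $ j))"
  have line: "tower_prod F \<sigma> (x + s *\<^sub>R axis i 1) = F i (\<sigma> i) (x $ i + s) * R"
    "tower_prod F (\<sigma>(i := Suc (\<sigma> i))) (x + s *\<^sub>R axis i 1) = F i (Suc (\<sigma> i)) (x $ i + s) * R" for s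
    unfolding tower_prod_def R_def
    by (subst prod.remove[of UNIV i], auto simp: axis_def intro!: prod.cong)+
  have "has_bochner_integral lborel (\<lambda>s. (F i (Suc (\<sigma> i)) (x $ i + s) * R) * indicator {0..t} s)
     (F i (\<sigma> i) (x $ i + t) * R - F i (\<sigma> i) (x $ i + 0) * R)"
  proof (rule has_bochner_integral_FTC_Icc_real[OF t])
    fix s
    have "(F i (\<sigma> i) has_real_derivative F i (Suc (\<sigma> i)) (x $ i + s)) (at (x $ i + s))"
      using assms[of i] by (simp add: deriv_tower_def)
    moreover have "((\<lambda>s. x $ i + s) has_real_derivative 1) (at s)"
      by (auto intro!: derivative_eq_intros)
    ultimately have "((\<lambda>s. F i (\<sigma> i) (x $ i + s)) has_real_derivative F i (Suc (\<sigma> i)) (x $ i + s)) (at s)"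
      using DERIV_chain2[where g = "\<lambda>s. x $ i + s" and f = "F i (\<sigma> i)"] by fastforce
    then show "((\<lambda>s. F i (\<sigma> i) (x $ i + s) * R) has_real_derivative F i (Suc (\<sigma> i)) (x $ i + s) * R) (at s)"
      by (rule DERIV_cmult_right)
    have "continuous_on UNIV (\<lambda>s. F i (Suc (\<sigma> i)) (x $ i + s) * R)"
      by (intro continuous_intros continuous_on_compose2[OF deriv_tower_continuous[OF assms] _ subset_UNIV])
    then show "isCont (\<lambda>s. F i (Suc (\<sigma> i)) (x $ i + s) * R) s"
      by (simp add: continuous_on_eq_continuous_at)
  qed
  then show "has_bochner_integral lborel
      (\<lambda>s. indicator {0..t} s * tower_prod F (\<sigma>(i := Suc (\<sigma> i))) (x + s *\<^sub>R axis i 1))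
      (tower_prod F \<sigma> (x + t *\<^sub>R axis i 1) - tower_prod F \<sigma> x)"
    using line[of 0] by (simp add: line mult.commute)
qed

lemma line_primitive_add_cmult:
  assumes "line_primitive g i G" "line_primitive p i P"
  shows "line_primitive (\<lambda>x. g x + c * p x) i (\<lambda>x. G x + c * P x)"
  unfolding line_primitive_def
proof (intro allI impI)
  fix t :: real assume t: "0 \<le> t"
  let ?e = "axis i 1 :: real ^ 'a"
  have "AE x in lborel. has_bochner_integral lborel (\<lambda>s. indicator {0..t} s * G (x + s *\<^sub>R ?e)) (g (x + t *\<^sub>R ?e) - g x)"
    "AE x in lborel. has_bochner_integral lborel (\<lambda>s. indicator {0..t} s * P (x + s *\<^sub>R ?e)) (p (x + t *\<^sub>R ?e) - p x)"
    using assms t by (auto simp: line_primitive_def)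
  then show "AE x in lborel. has_bochner_integral lborel
      (\<lambda>s. indicator {0..t} s * (G (x + s *\<^sub>R ?e) + c * P (x + s *\<^sub>R ?e)))
      (g (x + t *\<^sub>R ?e) + c * p (x + t *\<^sub>R ?e) - (g x + c * p x))"
  proof eventually_elim
    case (elim x)
    from has_bochner_integral_add[OF elim(1) has_bochner_integral_mult_right[OF elim(2), of c]]
    show ?case by (simp add: algebra_simps)
  qed
qed

lemma line_primitive_minus_sum:
  assumes "finite I" "line_primitive g i G" "\<And>k. line_primitive (p k) i (P k)"
  shows "line_primitive (\<lambda>x. g x - (\<Sum>k\<in>I. c k * p k x)) i (\<lambda>x. G x - (\<Sum>k\<in>I. c k * P k x))"
  using assms(1)
proof (induction I)
  case (insert k I)
  from line_primitive_add_cmult[OF insert.IH assms(3)[of k], of "- c k"] insert.hyps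
  show ?case by (simp add: algebra_simps)
qed (simp add: assms(2))

lemma midx_order_Suc: "midx_order (\<sigma>(i := Suc (\<sigma> i))) = Suc (midx_order (\<sigma> :: 'n::finite \<Rightarrow> nat))"
  unfolding midx_order_def by (subst (1 2) sum.remove[of UNIV i]) auto

lemma midx_order_eq_0_iff: "midx_order (\<sigma> :: 'n::finite \<Rightarrow> nat) = 0 \<longleftrightarrow> \<sigma> = (\<lambda>_. 0)"
  by (auto simp: midx_order_def fun_eq_iff)

lemma tower_prod_continuous:
  "(\<And>j. deriv_tower (F j)) \<Longrightarrow> continuous_on UNIV (tower_prod F \<sigma>)"
  by (rule has_derivative_continuous_on, rule has_derivative_at_withinI, rule tower_prod_has_derivative)

lemma power_tower_prod_polys:
  fixes \<tau> :: "'n::finite \<Rightarrow> nat"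
  assumes "midx_order \<tau> \<le> k"
  shows "tower_prod (\<lambda>j. power_tower (\<tau> j)) (\<lambda>_. 0) \<in> polys_upto k"
proof -
  have "tower_prod (\<lambda>j. power_tower (\<tau> j)) (\<lambda>_. 0)
    = (\<lambda>x. (1 / (\<Prod>i\<in>UNIV. fact (\<tau> i))) * (\<Prod>i\<in>UNIV. (x $ i) ^ \<tau> i))"
    by (simp add: fun_eq_iff tower_prod_def power_tower_def prod_dividef)
  then show ?thesis by (simp only: polys_upto_cmult[OF polys_upto_monomial[OF assms]])
qed

text \<open>If the orders agree but the multi-indices differ, some coordinate is differentiated more
  often than its power allows. This Kronecker delta lets the means of all derivatives of top order
  be prescribed independently.\<close>

lemma power_tower_prod_same_order:
  fixes \<sigma> \<tau> :: "'n::finite \<Rightarrow> nat"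
  assumes "midx_order \<sigma> = midx_order \<tau>"
  shows "tower_prod (\<lambda>j. power_tower (\<tau> j)) \<sigma> x = (if \<sigma> = \<tau> then 1 else 0)"
proof (cases "\<sigma> = \<tau>")
  case False
  have "\<exists>i. \<tau> i < \<sigma> i"
  proof (rule ccontr)
    assume "\<not> (\<exists>i. \<tau> i < \<sigma> i)"
    then have "\<sigma> i \<le> \<tau> i" for i by (simp add: not_less)
    then have "\<sigma> i = \<tau> i" for i
      using assms sum_mono_inv[of \<sigma> UNIV \<tau> i] by (simp add: midx_order_def)
    with False show False by auto
  qed
  then obtain i where "\<tau> i < \<sigma> i" ..
  then have "power_tower (\<tau> i) (\<sigma> i) (x $ i) = 0" by (simp add: power_tower_def)
  with False show ?thesis unfolding tower_prod_def by (auto intro!: prod_zero)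
qed (simp add: tower_prod_def power_tower_def)

text \<open>Subtracting a homogeneous polynomial makes all derivatives of top order mean free, so the
  first-order inequality applies to them.\<close>

lemma poincare_polynomial:
  fixes h :: "('n::finite \<Rightarrow> nat) \<Rightarrow> real ^ 'n \<Rightarrow> real"
  assumes "\<And>\<sigma>. midx_order \<sigma> \<le> m \<Longrightarrow> box_integrable (h \<sigma>)"
    and "\<And>\<sigma> i. midx_order \<sigma> < m \<Longrightarrow> line_primitive (h \<sigma>) i (h (\<sigma>(i := Suc (\<sigma> i))))"
    and l: "0 < l"
  shows "\<exists>\<pi>. (if m = 0 then \<pi> = (\<lambda>_. 0) else \<pi> \<in> polys_upto (m - 1)) \<and>
    (\<integral>\<^sup>+x. indicator (cube a l) x * ennreal \<bar>h (\<lambda>_. 0) x - \<pi> x\<bar> \<partial>lborel)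
    \<le> ennreal ((2 ^ CARD('n) * l * CARD('n)) ^ m)
      * (\<Sum>\<sigma> | midx_order \<sigma> = m. \<integral>\<^sup>+x. indicator (cube a l) x * ennreal \<bar>h \<sigma> x\<bar> \<partial>lborel)"
  using assms(1,2)
proof (induction m arbitrary: h)
  case 0
  \<comment> \<open>Degree at most \<open>-1\<close> means the zero polynomial, which
    \<open>polys_upto (m - 1)\<close> does not express at \<open>m = 0\<close>. With it both sides
    are the same integral.\<close>
  show ?case by (intro exI[of _ "\<lambda>_. 0"]) (simp add: midx_order_eq_0_iff)
next
  case (Suc m)
  let ?Q = "cube a l" and ?C = "2 ^ CARD('n) * l * CARD('n)"
  define p where "p \<tau> = tower_prod (\<lambda>j. power_tower (\<tau> j))" for \<tau> :: "'n \<Rightarrow> nat"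
  define c where "c \<tau> = bmean ?Q (h \<tau>)" for \<tau>
  define h' where "h' \<sigma> x = h \<sigma> x - (\<Sum>\<tau> | midx_order \<tau> = m. c \<tau> * p \<tau> \<sigma> x)" for \<sigma> x
  define N where "N \<sigma> = (\<integral>\<^sup>+x. indicator ?Q x * ennreal \<bar>h \<sigma> x\<bar> \<partial>lborel)" for \<sigma>
  have pc: "continuous_on UNIV (p \<tau> \<sigma>)" for \<tau> \<sigma>
    unfolding p_def by (intro tower_prod_continuous deriv_tower_power)
  \<comment> \<open>The induction hypothesis, applied to the corrected family \<open>h'\<close>,
    leaves its integrals of order \<open>m\<close>. These functions are mean free, so the
    first-order inequality replaces them by derivatives of order \<open>Suc m\<close>.\<close>
  have "\<exists>\<pi>. (if m = 0 then \<pi> = (\<lambda>_. 0) else \<pi> \<in> polys_upto (m - 1)) \<and>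
    (\<integral>\<^sup>+x. indicator ?Q x * ennreal \<bar>h' (\<lambda>_. 0) x - \<pi> x\<bar> \<partial>lborel)
    \<le> ennreal (?C ^ m) * (\<Sum>\<sigma> | midx_order \<sigma> = m. \<integral>\<^sup>+x. indicator ?Q x * ennreal \<bar>h' \<sigma> x\<bar> \<partial>lborel)"
  proof (rule Suc.IH)
    fix \<sigma> :: "'n \<Rightarrow> nat" assume "midx_order \<sigma> \<le> m"
    then show "box_integrable (h' \<sigma>)"
      unfolding h'_def
      by (intro box_integrable_diff Suc.prems box_integrable_continuous continuous_intros pc) simp
  next
    fix \<sigma> :: "'n \<Rightarrow> nat" and i assume "midx_order \<sigma> < m"
    then show "line_primitive (h' \<sigma>) i (h' (\<sigma>(i := Suc (\<sigma> i))))"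
      unfolding h'_def[abs_def] p_def
      by (intro line_primitive_minus_sum finite_midx_eq Suc.prems tower_prod_line_primitive
          deriv_tower_power) simp
  qed
  then obtain \<pi> where \<pi>: "if m = 0 then \<pi> = (\<lambda>_. 0) else \<pi> \<in> polys_upto (m - 1)"
    and le: "(\<integral>\<^sup>+x. indicator ?Q x * ennreal \<bar>h' (\<lambda>_. 0) x - \<pi> x\<bar> \<partial>lborel)
      \<le> ennreal (?C ^ m) * (\<Sum>\<sigma> | midx_order \<sigma> = m. \<integral>\<^sup>+x. indicator ?Q x * ennreal \<bar>h' \<sigma> x\<bar> \<partial>lborel)"
    by blast
  define \<pi>' where "\<pi>' x = \<pi> x + (\<Sum>\<tau> | midx_order \<tau> = m. c \<tau> * p \<tau> (\<lambda>_. 0) x)" for x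
  have "\<pi> \<in> polys_upto m"
    using \<pi> polys_upto_mono[of \<pi> "m - 1" m] by (auto simp: polys_upto_zero split: if_splits)
  then have "\<pi>' \<in> polys_upto m"
    unfolding \<pi>'_def[abs_def] p_def
    by (intro polys_upto_add polys_upto_sum polys_upto_cmult power_tower_prod_polys) auto
  have top: "h' \<sigma> x = h \<sigma> x - c \<sigma>" if "midx_order \<sigma> = m" for \<sigma> x
  proof -
    have "(\<Sum>\<tau> | midx_order \<tau> = m. c \<tau> * p \<tau> \<sigma> x) = (\<Sum>\<tau> | midx_order \<tau> = m. if \<tau> = \<sigma> then c \<tau> else 0)"
      using that by (intro sum.cong) (auto simp: p_def power_tower_prod_same_order)
    with that show ?thesis by (simp add: h'_def sum.delta finite_midx_eq)
  qed
  have mean: "(\<integral>\<^sup>+x. indicator ?Q x * ennreal \<bar>h' \<sigma> x\<bar> \<partial>lborel)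
      \<le> ennreal (2 ^ CARD('n) * l) * (\<Sum>i\<in>UNIV. N (\<sigma>(i := Suc (\<sigma> i))))" if "midx_order \<sigma> = m" for \<sigma>
  proof -
    have "box_integrable (h \<sigma>)" "line_primitive (h \<sigma>) i (h (\<sigma>(i := Suc (\<sigma> i))))" for i
      using that by (intro Suc.prems; simp)+
    moreover have "box_integrable (h (\<sigma>(i := Suc (\<sigma> i))))" for i
      by (intro Suc.prems(1) eq_imp_le) (simp only: midx_order_Suc that)
    ultimately show ?thesis
      unfolding top[OF that] c_def N_def by (intro poincare_first_order l)
  qed
  \<comment> \<open>Raising coordinate \<open>i\<close> is injective, so each multi-index of order
    \<open>Suc m\<close> is hit at most once per direction. The sum over all directions then
    accounts for the factor \<open>CARD('n)\<close> in \<open>?C\<close>.\<close>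
  have shift: "(\<Sum>\<sigma> | midx_order \<sigma> = m. N (\<sigma>(i := Suc (\<sigma> i)))) \<le> (\<Sum>\<sigma> | midx_order \<sigma> = Suc m. N \<sigma>)" for i
  proof -
    have "inj_on (\<lambda>\<sigma>. \<sigma>(i := Suc (\<sigma> i))) {\<sigma>. midx_order \<sigma> = m}"
    proof (rule inj_onI)
      fix \<sigma> \<tau> :: "'n \<Rightarrow> nat"
      assume "\<sigma>(i := Suc (\<sigma> i)) = \<tau>(i := Suc (\<tau> i))"
      then have "(\<sigma>(i := Suc (\<sigma> i))) j = (\<tau>(i := Suc (\<tau> i))) j" for j by simp
      then show "\<sigma> = \<tau>" by (metis Suc_inject ext fun_upd_apply)
    qed
    then have "(\<Sum>\<sigma> | midx_order \<sigma> = m. N (\<sigma>(i := Suc (\<sigma> i))))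
      = (\<Sum>\<sigma>\<in>(\<lambda>\<sigma>. \<sigma>(i := Suc (\<sigma> i))) ` {\<sigma>. midx_order \<sigma> = m}. N \<sigma>)"
      by (simp add: sum.reindex)
    also have "\<dots> \<le> (\<Sum>\<sigma> | midx_order \<sigma> = Suc m. N \<sigma>)"
      by (intro sum_mono2 finite_midx_eq) (auto simp: midx_order_Suc)
    finally show ?thesis .
  qed
  have "(\<integral>\<^sup>+x. indicator ?Q x * ennreal \<bar>h (\<lambda>_. 0) x - \<pi>' x\<bar> \<partial>lborel)
      = (\<integral>\<^sup>+x. indicator ?Q x * ennreal \<bar>h' (\<lambda>_. 0) x - \<pi> x\<bar> \<partial>lborel)"
    by (simp add: h'_def \<pi>'_def algebra_simps)
  also note le
  also have "(\<Sum>\<sigma> | midx_order \<sigma> = m. \<integral>\<^sup>+x. indicator ?Q x * ennreal \<bar>h' \<sigma> x\<bar> \<partial>lborel)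
      \<le> (\<Sum>\<sigma> | midx_order \<sigma> = m. ennreal (2 ^ CARD('n) * l) * (\<Sum>i\<in>UNIV. N (\<sigma>(i := Suc (\<sigma> i)))))"
    by (intro sum_mono mean) simp
  also have "\<dots> = ennreal (2 ^ CARD('n) * l) * (\<Sum>i\<in>UNIV. \<Sum>\<sigma> | midx_order \<sigma> = m. N (\<sigma>(i := Suc (\<sigma> i))))"
    by (simp add: sum_distrib_left[symmetric]) (subst sum.swap, rule refl)
  also have "\<dots> \<le> ennreal (2 ^ CARD('n) * l) * (\<Sum>i\<in>(UNIV::'n set). \<Sum>\<sigma> | midx_order \<sigma> = Suc m. N \<sigma>)"
    by (intro mult_left_mono sum_mono shift) simp
  also have "\<dots> = ennreal ?C * (\<Sum>\<sigma> | midx_order \<sigma> = Suc m. N \<sigma>)"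
  proof -
    have "ennreal ?C = ennreal (2 ^ CARD('n) * l) * of_nat CARD('n)"
      using l by (subst ennreal_mult) (auto simp: ennreal_of_nat_eq_real_of_nat)
    then show ?thesis by (simp only: sum_constant mult.assoc)
  qed
  finally have "(\<integral>\<^sup>+x. indicator ?Q x * ennreal \<bar>h (\<lambda>_. 0) x - \<pi>' x\<bar> \<partial>lborel)
      \<le> ennreal (?C ^ m) * (ennreal ?C * (\<Sum>\<sigma> | midx_order \<sigma> = Suc m. N \<sigma>))"
    by (simp add: mult_left_mono)
  also have "\<dots> = ennreal (?C ^ Suc m) * (\<Sum>\<sigma> | midx_order \<sigma> = Suc m. N \<sigma>)"
  proof -
    have "ennreal (?C ^ Suc m) = ennreal (?C ^ m) * ennreal ?C"
      using l unfolding power_Suc2 by (intro ennreal_mult) auto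
    then show ?thesis by (simp only: mult.assoc)
  qed
  finally show ?case
    using \<open>\<pi>' \<in> polys_upto m\<close> by (intro exI[of _ \<pi>']) (simp add: N_def)
qed

section \<open>Projections on polynomials\<close>

lemma polys_upto_line_polynomial:
  fixes p :: "real ^ 'n::finite \<Rightarrow> real"
  assumes "p \<in> polys_upto k"
  shows "real_polynomial_function (\<lambda>t. p (x + t *\<^sub>R v))"
proof -
  have "p \<in> {p. real_polynomial_function (\<lambda>t. p (x + t *\<^sub>R v))}"
    using assms
  proof (rule polys_upto_induct)
    fix \<sigma> :: "'n \<Rightarrow> nat"
    have lin: "real_polynomial_function (\<lambda>t. (x + t *\<^sub>R v) $ i)" for i
      by (simp, intro real_polynomial_function.intros bounded_linear_mult_left)
    have "real_polynomial_function (\<lambda>t. \<Prod>i\<in>I. ((x + t *\<^sub>R v) $ i) ^ \<sigma> i)" if "finite I" for I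
      using that
    proof (induction I)
      case empty
      show ?case by (simp add: real_polynomial_function.intros(2))
    next
      case (insert i I)
      from real_polynomial_function.intros(4)[OF real_polynomial_function_power[OF lin[of i]] insert.IH, of "\<sigma> i"]
        insert.hyps
      show ?case by simp
    qed
    then show "(\<lambda>x. \<Prod>i\<in>UNIV. (x $ i) ^ \<sigma> i) \<in> {p. real_polynomial_function (\<lambda>t. p (x + t *\<^sub>R v))}"
      by simp
  qed (auto intro: real_polynomial_function.intros)
  then show ?thesis by simp
qed

text \<open>On the line through the point of \<open>U\<close> and an arbitrary \<open>y\<close> the
  restriction is a polynomial in one variable with infinitely many zeros, since \<open>U\<close>
  meets the line in an open set of parameters.\<close>

lemma polys_upto_eq_0_if_zero_on_open:
  fixes p :: "real ^ 'n::finite \<Rightarrow> real"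
  assumes p: "p \<in> polys_upto k" and U: "open U" "x \<in> U" and zero: "\<And>y. y \<in> U \<Longrightarrow> p y = 0"
  shows "p = (\<lambda>_. 0)"
proof
  fix y
  let ?q = "\<lambda>t. p (x + t *\<^sub>R (y - x))"
  from polys_upto_line_polynomial[OF p, of x "y - x"] obtain a n where
    q: "?q = (\<lambda>t. \<Sum>i\<le>n. a i * t ^ i)" by (auto simp: real_polynomial_function_iff_sum)
  have "open ((\<lambda>t::real. x + t *\<^sub>R (y - x)) -` U)"
    by (intro open_vimage U continuous_intros)
  moreover have "0 \<in> (\<lambda>t::real. x + t *\<^sub>R (y - x)) -` U" using U by simp
  ultimately have "infinite ((\<lambda>t::real. x + t *\<^sub>R (y - x)) -` U)"
    using finite_imp_not_open by blast
  moreover have "(\<lambda>t. x + t *\<^sub>R (y - x)) -` U \<subseteq> {t. ?q t = 0}" using zero by auto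
  ultimately have "infinite {t. ?q t = 0}" using finite_subset by blast
  then have "infinite {t. (\<Sum>i\<le>n. a i * t ^ i) = 0}"
    using fun_cong[OF q] by simp
  then have "\<forall>i\<le>n. a i = 0" using polyfun_finite_roots[of a n] by blast
  then have "?q 1 = 0" using fun_cong[OF q, of 1] by simp
  then show "p y = 0" by simp
qed

lemma continuous_set_integrable_cube:
  fixes f :: "real ^ 'n::finite \<Rightarrow> real"
  assumes "continuous_on UNIV f"
  shows "set_integrable lebesgue (cube a l) f"
  unfolding cube_def
  using absolutely_integrable_continuous[OF continuous_on_subset[OF assms subset_UNIV]] by blast

lemma set_integrable_mult_continuous_cube:
  fixes f g :: "real ^ 'n::finite \<Rightarrow> real"
  assumes f: "set_integrable lebesgue (cube a l) f" and g: "continuous_on UNIV g"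
  shows "set_integrable lebesgue (cube a l) (\<lambda>x. f x * g x)"
proof -
  have "bounded (g ` cube a l)"
    unfolding cube_def
    by (intro compact_imp_bounded compact_continuous_image continuous_on_subset[OF g]) auto
  then have "(\<lambda>x. g x * f x) absolutely_integrable_on cube a l"
    using f borel_measurable_continuous_onI[OF g]
    by (intro absolutely_integrable_bounded_measurable_product[OF bilinear_times])
       (auto simp: cube_def intro!: measurable_completion measurable_restrict_space1)
  then show ?thesis by (simp add: mult.commute)
qed

lemma average_cmult: "average Q (\<lambda>x. c * f x) = c * average Q f"
  by (simp add: average_def)

lemma average_sum:
  assumes "\<And>i. i \<in> I \<Longrightarrow> set_integrable lebesgue Q (f i)"
  shows "average Q (\<lambda>x. \<Sum>i\<in>I. f i x) = (\<Sum>i\<in>I. average Q (f i))"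
  using assms
  by (simp add: average_def set_lebesgue_integral_def set_integrable_def sum_distrib_left
      sum_divide_distrib[symmetric] flip: scaleR_sum_right)

lemma average_diff:
  assumes "set_integrable lebesgue Q f" "set_integrable lebesgue Q g"
  shows "average Q (\<lambda>x. f x - g x) = average Q f - average Q g"
  using assms by (simp add: average_def diff_divide_distrib)

lemma average_square_nonneg: "0 \<le> average Q (\<lambda>x. f x * f x)"
  unfolding average_def set_lebesgue_integral_def
  by (intro divide_nonneg_nonneg Bochner_Integration.integral_nonneg) auto

text \<open>Definiteness of the inner product: a continuous nonnegative function with integral zero
  vanishes on the cube, and a polynomial that vanishes on an open set vanishes everywhere.\<close>

lemma polys_upto_average_square_eq_0:
  fixes p :: "real ^ 'n::finite \<Rightarrow> real"
  assumes p: "p \<in> polys_upto k" and l: "0 < l" and zero: "average (cube a l) (\<lambda>x. p x * p x) = 0"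
  shows "p = (\<lambda>_. 0)"
proof -
  have cont: "continuous_on UNIV p" using p by (rule polys_upto_continuous)
  have "(LINT x:cube a l|lebesgue. p x * p x) = 0"
    using zero l by (simp add: average_def measure_lborel_cube)
  moreover have ai: "set_integrable lebesgue (cube a l) (\<lambda>x. p x * p x)"
    by (intro continuous_set_integrable_cube continuous_intros cont)
  ultimately have "((\<lambda>x. p x * p x) has_integral 0) (cbox a (a + (\<chi> i. l)))"
    using has_integral_set_lebesgue[OF ai] by (simp add: cube_def)
  moreover have "a + (\<chi> i. l / 2) \<in> box a (a + (\<chi> i. l))"
    using l by (simp add: mem_box_cart)
  ultimately have "p x * p x = 0" if "x \<in> cbox a (a + (\<chi> i. l))" for x
    using that
    by (intro has_integral_0_cbox_imp_0[where f = "\<lambda>x. p x * p x" and a = a and b = "a + (\<chi> i. l)"])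
       (auto intro!: continuous_intros continuous_on_subset[OF cont])
  then show ?thesis
    using box_subset_cbox \<open>a + (\<chi> i. l / 2) \<in> box a _\<close>
    by (intro polys_upto_eq_0_if_zero_on_open[OF p open_box, of "a + (\<chi> i. l / 2)" a "a + (\<chi> i. l)"]) auto
qed

lemma average_lincomb_mult:
  fixes g :: "real ^ 'n::finite \<Rightarrow> real"
  assumes B: "\<And>\<phi>. \<phi> \<in> B \<Longrightarrow> continuous_on UNIV \<phi>" and g: "set_integrable lebesgue (cube a l) g"
  shows "average (cube a l) (\<lambda>x. (\<Sum>\<phi>\<in>B. c \<phi> * \<phi> x) * g x)
    = (\<Sum>\<phi>\<in>B. c \<phi> * average (cube a l) (\<lambda>x. \<phi> x * g x))"
proof -
  have "set_integrable lebesgue (cube a l) (\<lambda>x. c \<phi> * (\<phi> x * g x))" if "\<phi> \<in> B" for \<phi>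
    using set_integrable_mult_continuous_cube[OF g B[OF that]]
    by (intro set_integrable_mult_right) (simp add: mult.commute)
  then have "average (cube a l) (\<lambda>x. \<Sum>\<phi>\<in>B. c \<phi> * (\<phi> x * g x))
    = (\<Sum>\<phi>\<in>B. average (cube a l) (\<lambda>x. c \<phi> * (\<phi> x * g x)))"
    by (rule average_sum)
  then show ?thesis by (simp add: sum_distrib_right average_cmult mult.assoc)
qed

lemma average_lincomb_basis:
  assumes B: "finite B" "\<And>\<phi>. \<phi> \<in> B \<Longrightarrow> continuous_on UNIV \<phi>" and \<psi>: "\<psi> \<in> B"
    and orth: "\<And>\<phi> \<psi>. \<phi> \<in> B \<Longrightarrow> \<psi> \<in> B \<Longrightarrow> average (cube a l) (\<lambda>x. \<phi> x * \<psi> x) = (if \<phi> = \<psi> then 1 else 0)"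
  shows "average (cube a l) (\<lambda>x. (\<Sum>\<phi>\<in>B. c \<phi> * \<phi> x) * \<psi> x) = c \<psi>"
proof -
  have "average (cube a l) (\<lambda>x. (\<Sum>\<phi>\<in>B. c \<phi> * \<phi> x) * \<psi> x)
    = (\<Sum>\<phi>\<in>B. c \<phi> * average (cube a l) (\<lambda>x. \<phi> x * \<psi> x))"
    by (intro average_lincomb_mult continuous_set_integrable_cube B \<psi>)
  also have "\<dots> = (\<Sum>\<phi>\<in>B. if \<phi> = \<psi> then c \<phi> else 0)"
    using orth \<psi> by (intro sum.cong) auto
  finally show ?thesis using B(1) \<psi> by simp
qed

text \<open>Gram-Schmidt for a finite set that may be linearly dependent: an element with vanishing
  residual \<open>r\<close> adds nothing to the basis. Any other residual has positive norm by
  definiteness and can be normalised.\<close>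

lemma gram_schmidt_polys:
  fixes S :: "(real ^ 'n::finite \<Rightarrow> real) set"
  assumes "finite S" "S \<subseteq> polys_upto k" and l: "0 < l"
  shows "\<exists>B. finite B \<and> B \<subseteq> polys_upto k \<and>
    (\<forall>\<phi>\<in>B. \<forall>\<psi>\<in>B. average (cube a l) (\<lambda>x. \<phi> x * \<psi> x) = (if \<phi> = \<psi> then 1 else 0)) \<and>
    (\<forall>f\<in>S. \<exists>c. f = (\<lambda>x. \<Sum>\<phi>\<in>B. c \<phi> * \<phi> x))"
  using assms(1,2)
proof (induction S)
  case empty
  show ?case by (intro exI[of _ "{}"]) simp
next
  case (insert s S)
  let ?Q = "cube a l"
  have "S \<subseteq> polys_upto k" using insert.prems by simp
  from insert.IH[OF this] obtain B where B: "finite B" "B \<subseteq> polys_upto k"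
    and "\<forall>\<phi>\<in>B. \<forall>\<psi>\<in>B. average ?Q (\<lambda>x. \<phi> x * \<psi> x) = (if \<phi> = \<psi> then 1 else 0)"
    and "\<forall>f\<in>S. \<exists>c. f = (\<lambda>x. \<Sum>\<phi>\<in>B. c \<phi> * \<phi> x)" by (elim exE conjE)
  note orth = this(3)[rule_format] and span = this(4)[rule_format]
  have s: "s \<in> polys_upto k" using insert by simp
  have cont: "continuous_on UNIV f" if "f \<in> polys_upto k" for f :: "real ^ 'n \<Rightarrow> real"
    using that by (rule polys_upto_continuous)
  define d where "d \<phi> = average ?Q (\<lambda>x. s x * \<phi> x)" for \<phi>
  define r where "r x = s x - (\<Sum>\<phi>\<in>B. d \<phi> * \<phi> x)" for x
  have r: "r \<in> polys_upto k"
    unfolding r_def[abs_def] using s B by (intro polys_upto_diff polys_upto_sum polys_upto_cmult) auto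
  have r_orth: "average ?Q (\<lambda>x. r x * \<psi> x) = 0" if \<psi>: "\<psi> \<in> B" for \<psi>
  proof -
    have "average ?Q (\<lambda>x. r x * \<psi> x)
      = average ?Q (\<lambda>x. s x * \<psi> x) - average ?Q (\<lambda>x. (\<Sum>\<phi>\<in>B. d \<phi> * \<phi> x) * \<psi> x)"
      unfolding r_def left_diff_distrib using B \<psi> s
      by (intro average_diff continuous_set_integrable_cube continuous_intros cont) auto
    also have "average ?Q (\<lambda>x. (\<Sum>\<phi>\<in>B. d \<phi> * \<phi> x) * \<psi> x) = d \<psi>"
      using B cont by (intro average_lincomb_basis \<psi> orth) auto
    finally show ?thesis by (simp add: d_def)
  qed
  show ?case
  proof (cases "r = (\<lambda>_. 0)")
    case True
    then have "s = (\<lambda>x. \<Sum>\<phi>\<in>B. d \<phi> * \<phi> x)" by (simp add: r_def fun_eq_iff)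
    then have "\<exists>c. s = (\<lambda>x. \<Sum>\<phi>\<in>B. c \<phi> * \<phi> x)" by blast
    with B orth span show ?thesis by (intro exI[of _ B]) auto
  next
    case False
    define N where "N = sqrt (average ?Q (\<lambda>x. r x * r x))"
    have "average ?Q (\<lambda>x. r x * r x) \<noteq> 0"
      using False polys_upto_average_square_eq_0[OF r l] by blast
    then have N: "N * N = average ?Q (\<lambda>x. r x * r x)" "N > 0"
      using average_square_nonneg[of ?Q r] by (auto simp: N_def)
    define e where "e x = (1 / N) * r x" for x
    have e: "e \<in> polys_upto k" unfolding e_def[abs_def] by (intro polys_upto_cmult r)
    have e_orth: "average ?Q (\<lambda>x. e x * \<psi> x) = 0" "average ?Q (\<lambda>x. \<psi> x * e x) = 0" if "\<psi> \<in> B" for \<psi>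
      using average_cmult[of ?Q "1 / N" "\<lambda>x. r x * \<psi> x"] r_orth[OF that]
      by (simp_all add: e_def mult.assoc mult.commute[of "\<psi> _"])
    have "average ?Q (\<lambda>x. e x * e x) = (1 / (N * N)) * average ?Q (\<lambda>x. r x * r x)"
      using average_cmult[of ?Q "1 / (N * N)" "\<lambda>x. r x * r x"] by (simp add: e_def)
    then have e_norm: "average ?Q (\<lambda>x. e x * e x) = 1"
      unfolding N(1)[symmetric] using N(2) by simp
    have "e \<notin> B" using e_orth(1)[of e] e_norm by auto
    have extend: "\<exists>c. (\<lambda>x. (\<Sum>\<phi>\<in>B. c' \<phi> * \<phi> x) + t * e x) = (\<lambda>x. \<Sum>\<phi>\<in>insert e B. c \<phi> * \<phi> x)" for c' t
    proof (intro exI ext)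
      fix x
      have "(\<Sum>\<phi>\<in>B. c' \<phi> * \<phi> x) = (\<Sum>\<phi>\<in>B. (c'(e := t)) \<phi> * \<phi> x)"
        using \<open>e \<notin> B\<close> by (intro sum.cong) auto
      then show "(\<Sum>\<phi>\<in>B. c' \<phi> * \<phi> x) + t * e x = (\<Sum>\<phi>\<in>insert e B. (c'(e := t)) \<phi> * \<phi> x)"
        using B(1) \<open>e \<notin> B\<close> by simp
    qed
    have "s = (\<lambda>x. (\<Sum>\<phi>\<in>B. d \<phi> * \<phi> x) + N * e x)"
      using N(2) by (simp add: fun_eq_iff e_def r_def)
    then have s_span: "\<exists>c. s = (\<lambda>x. \<Sum>\<phi>\<in>insert e B. c \<phi> * \<phi> x)" using extend[of d N] by metis
    have S_span: "\<exists>c. f = (\<lambda>x. \<Sum>\<phi>\<in>insert e B. c \<phi> * \<phi> x)" if "f \<in> S" for f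
    proof -
      from span[OF that] obtain c where c: "f = (\<lambda>x. \<Sum>\<phi>\<in>B. c \<phi> * \<phi> x)" ..
      from extend[of c 0] show ?thesis unfolding c by simp
    qed
    show ?thesis
    proof (intro exI[of _ "insert e B"] conjI ballI)
      fix \<phi> \<psi> assume "\<phi> \<in> insert e B" "\<psi> \<in> insert e B"
      then show "average ?Q (\<lambda>x. \<phi> x * \<psi> x) = (if \<phi> = \<psi> then 1 else 0)"
        using orth e_orth e_norm \<open>e \<notin> B\<close> by auto
    qed (use B e s_span S_span in auto)
  qed
qed

text \<open>Gives content to the choice inside \<open>poly_proj\<close>, whose properties are
  derived from whichever basis is chosen.\<close>

lemma exists_orthonormal_poly_basis:
  fixes a :: "real ^ 'n::finite"
  assumes l: "0 < l"
  shows "\<exists>B. orthonormal_poly_basis k (cube a l) B"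
proof -
  define M where "M = (\<lambda>\<sigma>. \<lambda>x :: real ^ 'n. \<Prod>i\<in>UNIV. (x $ i) ^ \<sigma> i) ` {\<sigma>. midx_order \<sigma> \<le> k}"
  have "finite M" "M \<subseteq> polys_upto k"
    using finite_midx_le polys_upto_monomial by (auto simp: M_def)
  from gram_schmidt_polys[OF this l, of a] obtain B where B: "finite B" "B \<subseteq> polys_upto k"
    "\<forall>\<phi>\<in>B. \<forall>\<psi>\<in>B. average (cube a l) (\<lambda>x. \<phi> x * \<psi> x) = (if \<phi> = \<psi> then 1 else 0)"
    and "\<forall>f\<in>M. \<exists>c. f = (\<lambda>x. \<Sum>\<phi>\<in>B. c \<phi> * \<phi> x)" by (elim exE conjE)
  note span = this(4)[rule_format]
  have "f \<in> {f. \<exists>c. f = (\<lambda>x. \<Sum>\<phi>\<in>B. c \<phi> * \<phi> x)}" if "f \<in> polys_upto k" for f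
    using that
  proof (rule polys_upto_induct)
    fix \<sigma> :: "'n \<Rightarrow> nat" assume "midx_order \<sigma> \<le> k"
    then show "(\<lambda>x. \<Prod>i\<in>UNIV. (x $ i) ^ \<sigma> i) \<in> {f. \<exists>c. f = (\<lambda>x. \<Sum>\<phi>\<in>B. c \<phi> * \<phi> x)}"
      using span by (auto simp: M_def)
  next
    show "(\<lambda>_. 0) \<in> {f. \<exists>c. f = (\<lambda>x. \<Sum>\<phi>\<in>B. c \<phi> * \<phi> x)}"
      by (intro CollectI exI[of _ "\<lambda>_. 0"]) simp
  next
    fix f g assume "f \<in> {f. \<exists>c. f = (\<lambda>x. \<Sum>\<phi>\<in>B. c \<phi> * \<phi> x)}" "g \<in> {f. \<exists>c. f = (\<lambda>x. \<Sum>\<phi>\<in>B. c \<phi> * \<phi> x)}"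
    then obtain c d where "f = (\<lambda>x. \<Sum>\<phi>\<in>B. c \<phi> * \<phi> x)" "g = (\<lambda>x. \<Sum>\<phi>\<in>B. d \<phi> * \<phi> x)" by blast
    then have "(\<lambda>x. f x + g x) = (\<lambda>x. \<Sum>\<phi>\<in>B. (c \<phi> + d \<phi>) * \<phi> x)"
      by (simp only: distrib_right sum.distrib)
    then show "(\<lambda>x. f x + g x) \<in> {f. \<exists>c. f = (\<lambda>x. \<Sum>\<phi>\<in>B. c \<phi> * \<phi> x)}"
      by (intro CollectI exI)
  next
    fix t f assume "f \<in> {f. \<exists>c. f = (\<lambda>x. \<Sum>\<phi>\<in>B. c \<phi> * \<phi> x)}"
    then obtain c where "f = (\<lambda>x. \<Sum>\<phi>\<in>B. c \<phi> * \<phi> x)" by blast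
    then have "(\<lambda>x. t * f x) = (\<lambda>x. \<Sum>\<phi>\<in>B. (t * c \<phi>) * \<phi> x)"
      by (simp only: sum_distrib_left mult.assoc)
    then show "(\<lambda>x. t * f x) \<in> {f. \<exists>c. f = (\<lambda>x. \<Sum>\<phi>\<in>B. c \<phi> * \<phi> x)}"
      by (intro CollectI exI)
  qed
  with B have "orthonormal_poly_basis k (cube a l) B"
    unfolding orthonormal_poly_basis_def by blast
  then show ?thesis ..
qed

section \<open>Scaling of polynomials and the uniform bound for the projection\<close>

lemma polys_upto_mult:
  fixes f g :: "real ^ 'n::finite \<Rightarrow> real"
  assumes "f \<in> polys_upto j" "g \<in> polys_upto k"
  shows "(\<lambda>x. f x * g x) \<in> polys_upto (j + k)"
proof -
  have "f \<in> {f. (\<lambda>x. f x * g x) \<in> polys_upto (j + k)}"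
    using assms(1)
  proof (rule polys_upto_induct)
    fix \<sigma> :: "'n \<Rightarrow> nat" assume \<sigma>: "midx_order \<sigma> \<le> j"
    let ?m = "\<lambda>x :: real ^ 'n. \<Prod>i\<in>UNIV. (x $ i) ^ \<sigma> i"
    have "g \<in> {g. (\<lambda>x. ?m x * g x) \<in> polys_upto (j + k)}"
      using assms(2)
    proof (rule polys_upto_induct)
      fix \<tau> :: "'n \<Rightarrow> nat" assume \<tau>: "midx_order \<tau> \<le> k"
      have "(\<lambda>x :: real ^ 'n. \<Prod>i\<in>UNIV. (x $ i) ^ (\<sigma> i + \<tau> i)) \<in> polys_upto (j + k)"
        using \<sigma> \<tau> by (intro polys_upto_monomial) (simp add: midx_order_def sum.distrib)
      then show "(\<lambda>x. \<Prod>i\<in>UNIV. (x $ i) ^ \<tau> i) \<in> {g. (\<lambda>x. ?m x * g x) \<in> polys_upto (j + k)}"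
        by (simp add: power_add prod.distrib)
    next
      fix c and g :: "real ^ 'n \<Rightarrow> real" assume "g \<in> {g. (\<lambda>x. ?m x * g x) \<in> polys_upto (j + k)}"
      then show "(\<lambda>x. c * g x) \<in> {g. (\<lambda>x. ?m x * g x) \<in> polys_upto (j + k)}"
        using polys_upto_cmult[of "\<lambda>x. ?m x * g x" "j + k" c] by (simp add: mult.left_commute)
    qed (simp_all add: polys_upto_zero polys_upto_add distrib_left)
    then show "?m \<in> {f. (\<lambda>x. f x * g x) \<in> polys_upto (j + k)}" by simp
  next
    fix c and f :: "real ^ 'n \<Rightarrow> real" assume "f \<in> {f. (\<lambda>x. f x * g x) \<in> polys_upto (j + k)}"
    then show "(\<lambda>x. c * f x) \<in> {f. (\<lambda>x. f x * g x) \<in> polys_upto (j + k)}"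
      using polys_upto_cmult[of "\<lambda>x. f x * g x" "j + k" c] by (simp add: mult.assoc)
  qed (simp_all add: polys_upto_zero polys_upto_add distrib_right)
  then show ?thesis by simp
qed

lemma polys_upto_const: "(\<lambda>_. c) \<in> polys_upto k"
  using polys_upto_cmult[OF polys_upto_monomial[of "\<lambda>_. 0"], of k c] by (simp add: midx_order_def)

lemma polys_upto_coordinate:
  fixes i :: "'n::finite"
  shows "(\<lambda>x :: real ^ 'n. x $ i) \<in> polys_upto 1"
proof -
  have "(\<Prod>j\<in>UNIV. (x $ j) ^ ((\<lambda>_. 0)(i := 1)) j) = x $ i" for x :: "real ^ 'n"
    by (subst prod.remove[of UNIV i]) auto
  moreover have "midx_order ((\<lambda>_. 0)(i := 1)) \<le> 1"
    unfolding midx_order_def by (subst sum.remove[of UNIV i]) auto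
  ultimately show ?thesis using polys_upto_monomial[of "(\<lambda>_. 0)(i := 1)" 1] by simp
qed

lemma polys_upto_affine:
  fixes q :: "real ^ 'n::finite \<Rightarrow> real"
  assumes "q \<in> polys_upto k"
  shows "(\<lambda>x. q (a + l *\<^sub>R x)) \<in> polys_upto k"
proof -
  have "q \<in> {q. (\<lambda>x. q (a + l *\<^sub>R x)) \<in> polys_upto k}"
    using assms
  proof (rule polys_upto_induct)
    fix \<sigma> :: "'n \<Rightarrow> nat" assume \<sigma>: "midx_order \<sigma> \<le> k"
    have lin: "(\<lambda>x :: real ^ 'n. a $ i + l * x $ i) \<in> polys_upto 1" for i
      by (intro polys_upto_add polys_upto_cmult polys_upto_const polys_upto_coordinate)
    have pow: "(\<lambda>x :: real ^ 'n. (a $ i + l * x $ i) ^ n) \<in> polys_upto n" for i n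
    proof (induction n)
      case (Suc n)
      from polys_upto_mult[OF lin[of i] Suc] show ?case by simp
    qed (simp add: polys_upto_const)
    have "(\<lambda>x :: real ^ 'n. \<Prod>i\<in>I. (a $ i + l * x $ i) ^ \<sigma> i) \<in> polys_upto (\<Sum>i\<in>I. \<sigma> i)" if "finite I" for I
      using that
    proof (induction I)
      case (insert i I)
      from polys_upto_mult[OF pow[of i "\<sigma> i"] insert.IH] insert.hyps show ?case by simp
    qed (simp add: polys_upto_const)
    from this[of UNIV] \<sigma>
    show "(\<lambda>x. \<Prod>i\<in>UNIV. (x $ i) ^ \<sigma> i) \<in> {q. (\<lambda>x. q (a + l *\<^sub>R x)) \<in> polys_upto k}"
      by (auto simp: midx_order_def intro: polys_upto_mono)
  qed (simp_all add: polys_upto_zero polys_upto_add polys_upto_cmult)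
  then show ?thesis by simp
qed

lemma orthonormal_poly_basisD:
  assumes "orthonormal_poly_basis k Q B"
  shows "finite B" "B \<subseteq> polys_upto k"
    and "\<phi> \<in> B \<Longrightarrow> \<psi> \<in> B \<Longrightarrow> average Q (\<lambda>x. \<phi> x * \<psi> x) = (if \<phi> = \<psi> then 1 else 0)"
    and "f \<in> polys_upto k \<Longrightarrow> \<exists>c. f = (\<lambda>x. \<Sum>\<phi>\<in>B. c \<phi> * \<phi> x)"
  using assms unfolding orthonormal_poly_basis_def by blast+

text \<open>The Jacobian of the affine map cancels against the volume of the cube, so averages are
  invariant.\<close>

lemma average_cube_scale:
  fixes h :: "real ^ 'n::finite \<Rightarrow> real"
  assumes h: "continuous_on UNIV h" and l: "0 < l"
  shows "average (cube a l) h = average (cube 0 1) (\<lambda>x. h (a + l *\<^sub>R x))"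
proof -
  have h': "continuous_on UNIV (\<lambda>x. h (a + l *\<^sub>R x))"
    by (rule continuous_on_compose2[OF h]) (auto intro!: continuous_intros)
  define J where "J = (LINT x:cube a l|lebesgue. h x)"
  have "(h has_integral J) (cbox a (a + (\<chi> i. l)))"
    using has_integral_set_lebesgue[OF continuous_set_integrable_cube[OF h, of a l]]
    by (simp add: cube_def J_def)
  from has_integral_affinity'[OF this l, of a]
  have "((\<lambda>x. h (a + l *\<^sub>R x)) has_integral J / l ^ CARD('n)) (cbox 0 ((\<chi> i. l) /\<^sub>R l))"
    by (simp add: add.commute divide_inverse_commute)
  moreover have "cbox 0 ((\<chi> i. l) /\<^sub>R l) = (cube 0 1 :: (real ^ 'n) set)"
    using l by (auto simp: cube_def mem_box_cart)
  ultimately have "((\<lambda>x. h (a + l *\<^sub>R x)) has_integral J / l ^ CARD('n)) (cube 0 1)" by simp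
  moreover have "((\<lambda>x. h (a + l *\<^sub>R x)) has_integral (LINT x:cube 0 1|lebesgue. h (a + l *\<^sub>R x))) (cube 0 1)"
    by (intro has_integral_set_lebesgue continuous_set_integrable_cube h')
  ultimately have "(LINT x:cube 0 1|lebesgue. h (a + l *\<^sub>R x)) = J / l ^ CARD('n)"
    by (rule has_integral_unique[rotated])
  then show ?thesis
    using l by (simp add: average_def J_def measure_lborel_cube)
qed

text \<open>Norms on a finite-dimensional space are equivalent, and scaling to the unit cube makes
  the constant the same for all cubes. Cauchy-Schwarz is applied to the coefficients in an
  orthonormal basis: their squares add up to the average of the squared polynomial, and
  \<open>K\<close> bounds \<open>\<Sum>\<phi>\<in>B. (\<phi> x)\<^sup>2\<close> on the unit
  cube.\<close>

lemma poly_square_le_average: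
  obtains K where "0 \<le> K"
    "\<And>(a :: real ^ 'n::finite) l q x. 0 < l \<Longrightarrow> q \<in> polys_upto k \<Longrightarrow> x \<in> cube a l \<Longrightarrow>
       (q x)\<^sup>2 \<le> K * average (cube a l) (\<lambda>y. q y * q y)"
proof -
  obtain B where "orthonormal_poly_basis k (cube (0 :: real ^ 'n) 1) B"
    using exists_orthonormal_poly_basis[of 1 k 0] by auto
  note basis = orthonormal_poly_basisD[OF this]
  note B = basis(1,2) and orth = basis(3) and span = basis(4)
  have cont: "continuous_on UNIV \<phi>" if "\<phi> \<in> B" for \<phi>
    using B that polys_upto_continuous by blast
  have "continuous_on UNIV (\<lambda>x. \<Sum>\<phi>\<in>B. (\<phi> x)\<^sup>2)"
    by (intro continuous_intros cont)
  then have "bounded ((\<lambda>x. \<Sum>\<phi>\<in>B. (\<phi> x)\<^sup>2) ` cube 0 1)"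
    unfolding cube_def
    by (intro compact_imp_bounded compact_continuous_image) (auto intro: continuous_on_subset)
  then obtain K where K: "0 < K" "\<And>x. x \<in> cube 0 1 \<Longrightarrow> \<bar>\<Sum>\<phi>\<in>B. (\<phi> x)\<^sup>2\<bar> \<le> K"
    by (auto simp: bounded_pos)
  show ?thesis
  proof (rule that[of K])
    show "0 \<le> K" using K by simp
    fix a x :: "real ^ 'n" and l :: real and q :: "real ^ 'n \<Rightarrow> real"
    assume l: "0 < l" and q: "q \<in> polys_upto k" and x: "x \<in> cube a l"
    define q' where "q' = (\<lambda>x. q (a + l *\<^sub>R x))"
    have q': "q' \<in> polys_upto k" unfolding q'_def by (rule polys_upto_affine[OF q])
    from span[OF this] obtain c where c: "q' = (\<lambda>x. \<Sum>\<phi>\<in>B. c \<phi> * \<phi> x)" ..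
    have "average (cube a l) (\<lambda>y. q y * q y) = average (cube 0 1) (\<lambda>y. q' y * q' y)"
      unfolding q'_def
      by (intro average_cube_scale[OF _ l] continuous_intros polys_upto_continuous[OF q])
    also have "\<dots> = (\<Sum>\<phi>\<in>B. c \<phi> * average (cube 0 1) (\<lambda>x. \<phi> x * q' x))"
      by (subst (1) c, intro average_lincomb_mult continuous_set_integrable_cube
          polys_upto_continuous[OF q'] cont)
    also have "\<dots> = (\<Sum>\<phi>\<in>B. (c \<phi>)\<^sup>2)"
    proof (rule sum.cong[OF refl])
      fix \<psi> assume \<psi>: "\<psi> \<in> B"
      have "average (cube 0 1) (\<lambda>x. q' x * \<psi> x) = c \<psi>"
        unfolding c by (rule average_lincomb_basis[OF B(1) cont \<psi> orth])
      then show "c \<psi> * average (cube 0 1) (\<lambda>x. \<psi> x * q' x) = (c \<psi>)\<^sup>2"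
        by (simp add: mult.commute power2_eq_square)
    qed
    finally have avg: "average (cube a l) (\<lambda>y. q y * q y) = (\<Sum>\<phi>\<in>B. (c \<phi>)\<^sup>2)" .
    define z where "z = (1 / l) *\<^sub>R (x - a)"
    have z: "z \<in> cube 0 1" using x l by (auto simp: z_def mem_cube field_simps)
    have "q x = q' z" using l by (simp add: q'_def z_def)
    also have "\<dots> = (\<Sum>\<phi>\<in>B. c \<phi> * \<phi> z)" by (simp add: c)
    finally have "(q x)\<^sup>2 = (\<Sum>\<phi>\<in>B. c \<phi> * \<phi> z)\<^sup>2" by simp
    also have "\<dots> \<le> (\<Sum>\<phi>\<in>B. (c \<phi>)\<^sup>2) * (\<Sum>\<phi>\<in>B. (\<phi> z)\<^sup>2)"
      by (rule Cauchy_Schwarz_ineq_sum)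
    also have "\<dots> \<le> (\<Sum>\<phi>\<in>B. (c \<phi>)\<^sup>2) * K"
      using K(2)[OF z] by (intro mult_left_mono sum_nonneg) auto
    finally show "(q x)\<^sup>2 \<le> K * average (cube a l) (\<lambda>y. q y * q y)"
      by (simp add: avg mult.commute)
  qed
qed

text \<open>The bound on the reproducing kernel \<open>\<Sum>\<phi>. \<phi> x * \<phi> y\<close> follows from the bound on
  polynomials, applied to the kernel itself as a function of \<open>y\<close>.\<close>

lemma poly_proj_bound:
  obtains K where "0 \<le> K"
    "\<And>(a :: real ^ 'n::finite) l f. 0 < l \<Longrightarrow> set_integrable lebesgue (cube a l) f \<Longrightarrow>
       poly_proj k (cube a l) f \<in> polys_upto k"
    "\<And>(a :: real ^ 'n::finite) l f q x. 0 < l \<Longrightarrow> set_integrable lebesgue (cube a l) f \<Longrightarrow>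
       q \<in> polys_upto k \<Longrightarrow> x \<in> cube a l \<Longrightarrow>
       \<bar>poly_proj k (cube a l) f x - q x\<bar> \<le> K * average (cube a l) (\<lambda>y. \<bar>f y - q y\<bar>)"
proof -
  obtain K where K: "0 \<le> K" and sup: "\<And>(a :: real ^ 'n) l q x. 0 < l \<Longrightarrow> q \<in> polys_upto k \<Longrightarrow>
      x \<in> cube a l \<Longrightarrow> (q x)\<^sup>2 \<le> K * average (cube a l) (\<lambda>y. q y * q y)"
    using poly_square_le_average[of k] by blast
  have basis: "orthonormal_poly_basis k (cube a l) (SOME B. orthonormal_poly_basis k (cube a l) B)"
    if "0 < l" for a :: "real ^ 'n" and l
    using someI_ex[OF exists_orthonormal_poly_basis[OF that]] .
  show ?thesis
  proof (rule that[OF K])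
    fix a :: "real ^ 'n" and l :: real and f :: "real ^ 'n \<Rightarrow> real"
    assume l: "0 < l" and f: "set_integrable lebesgue (cube a l) f"
    define B where "B = (SOME B. orthonormal_poly_basis k (cube a l) B)"
    have "orthonormal_poly_basis k (cube a l) B" unfolding B_def by (rule basis[OF l])
    note B_basis = orthonormal_poly_basisD[OF this]
    note B = B_basis(1,2) and orth = B_basis(3) and span = B_basis(4)
    have cont: "continuous_on UNIV \<phi>" if "\<phi> \<in> B" for \<phi>
      using B that polys_upto_continuous by blast
    have proj: "poly_proj k (cube a l) f = (\<lambda>x. \<Sum>\<phi>\<in>B. average (cube a l) (\<lambda>y. f y * \<phi> y) * \<phi> x)"
      by (simp add: poly_proj_def B_def)
    show "poly_proj k (cube a l) f \<in> polys_upto k"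
      unfolding proj using B by (intro polys_upto_sum polys_upto_cmult) auto
    fix q :: "real ^ 'n \<Rightarrow> real" and x assume q: "q \<in> polys_upto k" and x: "x \<in> cube a l"
    define ker where "ker = (\<lambda>y. \<Sum>\<phi>\<in>B. \<phi> x * \<phi> y)"
    have ker: "ker \<in> polys_upto k"
      unfolding ker_def using B by (intro polys_upto_sum polys_upto_cmult) auto
    have "average (cube a l) (\<lambda>y. ker y * ker y) = (\<Sum>\<phi>\<in>B. \<phi> x * average (cube a l) (\<lambda>y. \<phi> y * ker y))"
      by (subst (1) ker_def, intro average_lincomb_mult continuous_set_integrable_cube
          polys_upto_continuous[OF ker] cont)
    also have "\<dots> = (\<Sum>\<phi>\<in>B. \<phi> x * \<phi> x)"
    proof (rule sum.cong[OF refl])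
      fix \<psi> assume \<psi>: "\<psi> \<in> B"
      have "average (cube a l) (\<lambda>y. ker y * \<psi> y) = \<psi> x"
        unfolding ker_def by (rule average_lincomb_basis[OF B(1) cont \<psi> orth])
      then show "\<psi> x * average (cube a l) (\<lambda>y. \<psi> y * ker y) = \<psi> x * \<psi> x"
        by (simp add: mult.commute)
    qed
    finally have ker_avg: "average (cube a l) (\<lambda>y. ker y * ker y) = ker x" by (simp add: ker_def)
    have "0 \<le> ker x" unfolding ker_def by (intro sum_nonneg) simp
    \<comment> \<open>The mean square of the kernel equals its value \<open>ker x\<close> on the
      diagonal, by the reproducing property. The bound for polynomials at \<open>y = x\<close> is
      thus quadratic in \<open>ker x\<close> on the left and linear on the right, which gives
      \<open>ker x \<le> K\<close>; at any other \<open>y\<close> it gives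
      \<open>K * K\<close>.\<close>
    have "ker x * ker x \<le> K * ker x"
      using sup[OF l ker x] by (simp add: ker_avg power2_eq_square)
    then have kerx: "ker x \<le> K" using \<open>0 \<le> ker x\<close> K by (cases "ker x = 0") auto
    have ker_bound: "\<bar>ker y\<bar> \<le> K" if "y \<in> cube a l" for y
    proof -
      have "(ker y)\<^sup>2 \<le> K * K"
        using sup[OF l ker that] mult_left_mono[OF kerx K] by (simp add: ker_avg)
      then show ?thesis using K by (simp add: power2_eq_square[symmetric] abs_le_square_iff[symmetric])
    qed
    define h where "h y = f y - q y" for y
    have h: "set_integrable lebesgue (cube a l) h"
      unfolding h_def by (intro set_integral_diff f continuous_set_integrable_cube polys_upto_continuous[OF q])
    obtain c where c: "q = (\<lambda>x. \<Sum>\<phi>\<in>B. c \<phi> * \<phi> x)" using span[OF q] ..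
    \<comment> \<open>The projection reproduces \<open>q\<close>, so the difference is the
      projection of \<open>h = f - q\<close>, an integral of \<open>h\<close> against the
      kernel.\<close>
    have "poly_proj k (cube a l) f x - q x = (\<Sum>\<phi>\<in>B. \<phi> x * average (cube a l) (\<lambda>y. \<phi> y * h y))"
    proof -
      have "average (cube a l) (\<lambda>y. f y * \<phi> y) * \<phi> x - c \<phi> * \<phi> x = \<phi> x * average (cube a l) (\<lambda>y. \<phi> y * h y)"
        if \<phi>: "\<phi> \<in> B" for \<phi>
      proof -
        have "average (cube a l) (\<lambda>y. \<phi> y * h y) = average (cube a l) (\<lambda>y. f y * \<phi> y - q y * \<phi> y)"
          by (simp add: h_def algebra_simps)
        also have "\<dots> = average (cube a l) (\<lambda>y. f y * \<phi> y) - average (cube a l) (\<lambda>y. q y * \<phi> y)"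
          by (rule average_diff[OF set_integrable_mult_continuous_cube[OF f cont[OF \<phi>]]
              continuous_set_integrable_cube[OF continuous_on_mult[OF polys_upto_continuous[OF q] cont[OF \<phi>]]]])
        also have "average (cube a l) (\<lambda>y. q y * \<phi> y) = c \<phi>"
          unfolding c by (rule average_lincomb_basis[OF B(1) cont \<phi> orth])
        finally have eq: "average (cube a l) (\<lambda>y. \<phi> y * h y) = average (cube a l) (\<lambda>y. f y * \<phi> y) - c \<phi>" .
        show ?thesis unfolding eq by (simp only: right_diff_distrib mult.commute[of "\<phi> x"])
      qed
      moreover have "poly_proj k (cube a l) f x - q x
        = (\<Sum>\<phi>\<in>B. average (cube a l) (\<lambda>y. f y * \<phi> y) * \<phi> x - c \<phi> * \<phi> x)"
        by (simp add: proj c sum_subtractf)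
      ultimately show ?thesis by simp
    qed
    also have "\<dots> = average (cube a l) (\<lambda>y. ker y * h y)"
      unfolding ker_def by (rule average_lincomb_mult[OF cont h, symmetric])
    also have "\<bar>\<dots>\<bar> \<le> K * average (cube a l) (\<lambda>y. \<bar>h y\<bar>)"
    proof -
      have kh: "set_integrable lebesgue (cube a l) (\<lambda>y. ker y * h y)"
        using set_integrable_mult_continuous_cube[OF h polys_upto_continuous[OF ker]]
        by (simp add: mult.commute)
      have "\<bar>LINT y:cube a l|lebesgue. ker y * h y\<bar> \<le> (LINT y:cube a l|lebesgue. \<bar>ker y * h y\<bar>)"
        using set_integral_norm_bound[OF kh] by simp
      also have "\<dots> \<le> (LINT y:cube a l|lebesgue. K * \<bar>h y\<bar>)"
      proof (rule set_integral_mono)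
        show "set_integrable lebesgue (cube a l) (\<lambda>y. \<bar>ker y * h y\<bar>)"
          using set_integrable_abs[OF kh] by simp
        show "set_integrable lebesgue (cube a l) (\<lambda>y. K * \<bar>h y\<bar>)"
          using set_integrable_abs[OF h] by simp
        show "\<bar>ker y * h y\<bar> \<le> K * \<bar>h y\<bar>" if "y \<in> cube a l" for y
          using ker_bound[OF that] by (simp add: abs_mult mult_right_mono)
      qed
      finally have "\<bar>LINT y:cube a l|lebesgue. ker y * h y\<bar> \<le> K * (LINT y:cube a l|lebesgue. \<bar>h y\<bar>)"
        by simp
      then show ?thesis
        unfolding average_def abs_divide by (simp add: divide_right_mono)
    qed
    finally show "\<bar>poly_proj k (cube a l) f x - q x\<bar> \<le> K * average (cube a l) (\<lambda>y. \<bar>f y - q y\<bar>)"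
      by (simp add: h_def)
  qed
qed

section \<open>The Poincare inequality for Sobolev functions\<close>

lemma locally_integrable_cbox:
  "locally_integrable f \<Longrightarrow> integrable lebesgue (\<lambda>x. indicator (cbox a b) x * f x)"
  using compact_cbox unfolding locally_integrable_def set_integrable_def by fastforce

lemma locally_integrable_measurable:
  fixes f :: "real ^ 'n::finite \<Rightarrow> real"
  assumes "locally_integrable f"
  shows "f \<in> borel_measurable lebesgue"
proof (rule borel_measurable_LIMSEQ_real)
  define B where "B n = cbox (- (real n *\<^sub>R One)) (real n *\<^sub>R One :: real ^ 'n)" for n
  show "(\<lambda>x. indicator (B n) x * f x) \<in> borel_measurable lebesgue" for n
    using locally_integrable_cbox[OF assms] unfolding B_def by blast
  fix x
  have "x \<in> (\<Union>n. box (- (real n *\<^sub>R One)) (real n *\<^sub>R One :: real ^ 'n))" using UN_box_eq_UNIV by auto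
  then obtain N where N: "x \<in> box (- (real N *\<^sub>R One)) (real N *\<^sub>R One)" by blast
  have "x \<in> B n" if "N \<le> n" for n
  proof -
    have "real N \<le> real n" using that by simp
    with N show ?thesis
      unfolding B_def mem_box by (auto simp: inner_sum_left_Basis)
  qed
  then have "\<forall>\<^sub>F n in sequentially. indicator (B n) x * f x = f x"
    by (auto simp: eventually_sequentially intro!: exI[of _ N])
  then show "(\<lambda>n. indicator (B n) x * f x) \<longlonglongrightarrow> f x" by (rule tendsto_eventually)
qed

text \<open>Passage from \<open>lebesgue\<close> to \<open>lborel\<close>, where the arguments with
  translations and Fubini take place; integrals do not notice the change of representative.\<close>

lemma locally_integrable_borel_representative:
  fixes f :: "real ^ 'n::finite \<Rightarrow> real"
  assumes f: "locally_integrable f"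
  obtains f' where "box_integrable f'" "AE x in lborel. f x = f' x"
proof -
  obtain f' where f'[measurable]: "f' \<in> borel_measurable lborel" and ae: "AE x in lborel. f x = f' x"
    using completion_ex_borel_measurable_real[OF locally_integrable_measurable[OF f]] by blast
  have "integrable lborel (\<lambda>x. indicator (cbox a b) x * f' x)" for a b
  proof -
    have "integrable lebesgue (\<lambda>x. indicator (cbox a b) x * f' x)"
    proof (rule Bochner_Integration.integrable_cong_AE_imp[OF locally_integrable_cbox[OF f]])
      show "(\<lambda>x. indicator (cbox a b) x * f' x) \<in> borel_measurable lebesgue"
        by (rule measurable_completion) measurable
      from AE_completion[OF ae]
      show "AE x in lebesgue. indicator (cbox a b) x * f x = indicator (cbox a b) x * f' x"
        by eventually_elim simp
    qed
    then show ?thesis by (subst (asm) integrable_completion) auto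
  qed
  then have "box_integrable f'" using f' by (simp add: box_integrable_def)
  then show ?thesis using that ae by blast
qed

lemma weak_partial_cong:
  assumes w: "weak_partial g i G"
    and g: "g \<in> borel_measurable lebesgue" "g' \<in> borel_measurable lebesgue" "AE x in lborel. g x = g' x"
    and G: "G \<in> borel_measurable lebesgue" "G' \<in> borel_measurable lebesgue" "AE x in lborel. G x = G' x"
  shows "weak_partial g' i G'"
  unfolding weak_partial_def
proof (intro allI impI)
  fix F :: "'a \<Rightarrow> nat \<Rightarrow> real \<Rightarrow> real" assume F: "test_tower F"
  have T: "tower_prod F \<sigma> \<in> borel_measurable lebesgue" for \<sigma>
  proof -
    have "continuous_on UNIV (tower_prod F \<sigma>)"
      using F by (intro tower_prod_continuous) (simp add: test_tower_def)
    from borel_measurable_continuous_onI[OF this] show ?thesis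
      by (intro measurable_completion) simp
  qed
  have eq: "(LINT x|lebesgue. k x * tower_prod F \<sigma> x) = (LINT x|lebesgue. k' x * tower_prod F \<sigma> x)"
    if "k \<in> borel_measurable lebesgue" "k' \<in> borel_measurable lebesgue" "AE x in lborel. k x = k' x" for k k' \<sigma>
    using AE_completion[OF that(3)]
    by (intro integral_cong_AE borel_measurable_times that T) (auto elim!: eventually_mono)
  show "(LINT x|lebesgue. g' x * tower_prod F ((\<lambda>_. 0)(i := 1)) x)
     = - (LINT x|lebesgue. G' x * tower_prod F (\<lambda>_. 0) x)"
    using w F eq[OF g] eq[OF G] unfolding weak_partial_def by (metis (no_types))
qed

lemma has_weak_derivative_self:
  assumes "locally_integrable f"
  shows "has_weak_derivative f (\<lambda>_. 0) f"
proof -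
  have "mixed_partial (\<lambda>_. 0) \<phi> = \<phi>" for \<phi> :: "real ^ 'a \<Rightarrow> real"
  proof -
    have "(SOME is. \<forall>i::'a. count_list is i = 0) = []"
    proof (rule some_equality)
      fix xs assume "\<forall>i::'a. count_list xs i = 0"
      then show "xs = []" by (cases xs) (auto dest: spec[of _ "hd xs"])
    qed simp
    then show ?thesis by (simp add: mixed_partial_def iter_partial_def)
  qed
  with assms show ?thesis by (simp add: has_weak_derivative_def midx_order_def)
qed

lemma sobolev_poincare_polynomial:
  fixes f :: "real ^ 'n::finite \<Rightarrow> real"
  assumes m: "1 \<le> m" and f: "sobolev_loc m f" and l: "0 < l"
  obtains \<pi> where "\<pi> \<in> polys_upto (m - 1)"
    "(\<integral>\<^sup>+x. indicator (cube a l) x * ennreal \<bar>f x - \<pi> x\<bar> \<partial>lebesgue)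
      \<le> ennreal ((2 ^ CARD('n) * l * CARD('n)) ^ m)
        * (\<integral>\<^sup>+x. indicator (cube a l) x * ennreal (grad_norm m f x) \<partial>lebesgue)"
proof -
  \<comment> \<open>At order 0 the function \<open>f\<close> itself is taken instead of the chosen
    representative of its weak derivative. The conclusion then speaks of \<open>f\<close> without
    appeal to the uniqueness of weak derivatives.\<close>
  define w where "w \<sigma> = (if \<sigma> = (\<lambda>_. 0) then f else weak_derivative \<sigma> f)" for \<sigma> :: "'n \<Rightarrow> nat"
  have f_loc: "locally_integrable f" using f by (simp add: sobolev_loc_def)
  have w: "has_weak_derivative f \<sigma> (w \<sigma>)" if "midx_order \<sigma> \<le> m" for \<sigma>
  proof (cases "\<sigma> = (\<lambda>_. 0)")
    case True
    then show ?thesis using has_weak_derivative_self[OF f_loc] by (simp add: w_def)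
  next
    case False
    have "\<exists>g. has_weak_derivative f \<sigma> g" using f that by (simp add: sobolev_loc_def)
    from someI_ex[OF this] False show ?thesis by (simp add: w_def weak_derivative_def)
  qed
  then have w_loc: "locally_integrable (w \<sigma>)" if "midx_order \<sigma> \<le> m" for \<sigma>
    using that by (simp add: has_weak_derivative_def)
  define h where "h \<sigma> = (SOME h. box_integrable h \<and> (AE x in lborel. w \<sigma> x = h x))" for \<sigma>
  have "box_integrable (h \<sigma>) \<and> (AE x in lborel. w \<sigma> x = h \<sigma> x)" if "midx_order \<sigma> \<le> m" for \<sigma>
  proof -
    have "\<exists>h. box_integrable h \<and> (AE x in lborel. w \<sigma> x = h x)"
      using locally_integrable_borel_representative[OF w_loc[OF that]] by metis
    from someI_ex[OF this] show ?thesis by (simp add: h_def)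
  qed
  then have h: "box_integrable (h \<sigma>)" "AE x in lborel. w \<sigma> x = h \<sigma> x" if "midx_order \<sigma> \<le> m" for \<sigma>
    using that by auto
  have hm: "h \<sigma> \<in> borel_measurable lborel" if "midx_order \<sigma> \<le> m" for \<sigma>
    using box_integrable_measurable[OF h(1)[OF that]] by simp
  have lines: "line_primitive (h \<sigma>) i (h (\<sigma>(i := Suc (\<sigma> i))))" if "midx_order \<sigma> < m" for \<sigma> i
  proof -
    have le: "midx_order \<sigma> \<le> m" "midx_order (\<sigma>(i := Suc (\<sigma> i))) \<le> m"
      using that by (simp_all only: midx_order_Suc)
    have "weak_partial (w \<sigma>) i (w (\<sigma>(i := Suc (\<sigma> i))))"
      by (rule has_weak_derivative_imp_weak_partial[OF w[OF le(1)] w[OF le(2)]])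
    then have "weak_partial (h \<sigma>) i (h (\<sigma>(i := Suc (\<sigma> i))))"
      by (rule weak_partial_cong[OF _
          locally_integrable_measurable[OF w_loc[OF le(1)]] measurable_completion[OF hm[OF le(1)]] h(2)[OF le(1)]
          locally_integrable_measurable[OF w_loc[OF le(2)]] measurable_completion[OF hm[OF le(2)]] h(2)[OF le(2)]])
    then show ?thesis
      by (rule weak_partial_imp_line_primitive) (intro h le)+
  qed
  from poincare_polynomial[of m h l a, OF h(1) lines l] m
  obtain \<pi> where \<pi>: "\<pi> \<in> polys_upto (m - 1)"
    and le: "(\<integral>\<^sup>+x. indicator (cube a l) x * ennreal \<bar>h (\<lambda>_. 0) x - \<pi> x\<bar> \<partial>lborel)
      \<le> ennreal ((2 ^ CARD('n) * l * CARD('n)) ^ m)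
      * (\<Sum>\<sigma> | midx_order \<sigma> = m. \<integral>\<^sup>+x. indicator (cube a l) x * ennreal \<bar>h \<sigma> x\<bar> \<partial>lborel)"
    by auto
  have "AE x in lborel. f x = h (\<lambda>_. 0) x"
    using h(2)[of "\<lambda>_. 0"] by (simp add: w_def midx_order_def)
  then have lhs: "(\<integral>\<^sup>+x. indicator (cube a l) x * ennreal \<bar>f x - \<pi> x\<bar> \<partial>lebesgue)
      = (\<integral>\<^sup>+x. indicator (cube a l) x * ennreal \<bar>h (\<lambda>_. 0) x - \<pi> x\<bar> \<partial>lborel)"
    unfolding nn_integral_completion by (intro nn_integral_cong_AE) (auto elim!: eventually_mono)
  have "(\<Sum>\<sigma> | midx_order \<sigma> = m. \<integral>\<^sup>+x. indicator (cube a l) x * ennreal \<bar>h \<sigma> x\<bar> \<partial>lborel)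
      = (\<integral>\<^sup>+x. (\<Sum>\<sigma> | midx_order \<sigma> = m. indicator (cube a l) x * ennreal \<bar>h \<sigma> x\<bar>) \<partial>lborel)"
  proof (rule nn_integral_sum[symmetric])
    fix \<sigma> :: "'n \<Rightarrow> nat" assume "\<sigma> \<in> {\<sigma>. midx_order \<sigma> = m}"
    then have [measurable]: "h \<sigma> \<in> borel_measurable lborel" by (intro hm) simp
    show "(\<lambda>x. indicator (cube a l) x * ennreal \<bar>h \<sigma> x\<bar>) \<in> borel_measurable lborel" by measurable
  qed
  also have "\<dots> = (\<integral>\<^sup>+x. indicator (cube a l) x * ennreal (grad_norm m f x) \<partial>lborel)"
  proof (rule nn_integral_cong_AE)
    have "AE x in lborel. \<forall>\<sigma>\<in>{\<sigma>. midx_order \<sigma> = m}. w \<sigma> x = h \<sigma> x"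
      by (subst AE_finite_all[OF finite_midx_eq]) (auto intro: h(2))
    then show "AE x in lborel. (\<Sum>\<sigma> | midx_order \<sigma> = m. indicator (cube a l) x * ennreal \<bar>h \<sigma> x\<bar>)
      = indicator (cube a l) x * ennreal (grad_norm m f x)"
    proof eventually_elim
      case (elim x)
      have "grad_norm m f x = (\<Sum>\<sigma> | midx_order \<sigma> = m. \<bar>h \<sigma> x\<bar>)"
        unfolding grad_norm_def
      proof (intro sum.cong refl)
        fix \<sigma> :: "'n \<Rightarrow> nat" assume \<sigma>: "\<sigma> \<in> {\<sigma>. midx_order \<sigma> = m}"
        \<comment> \<open>As \<open>m \<ge> 1\<close>, the exceptional choice of \<open>w\<close> at
          order 0 does not affect the derivatives that make up \<open>grad_norm\<close>.\<close>
        with m have "\<sigma> \<noteq> (\<lambda>_. 0)" by (auto simp: midx_order_eq_0_iff[symmetric])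
        then have "w \<sigma> = weak_derivative \<sigma> f" by (simp add: w_def)
        with elim \<sigma> show "\<bar>weak_derivative \<sigma> f x\<bar> = \<bar>h \<sigma> x\<bar>" by metis
      qed
      then show ?case by (simp add: sum_distrib_left[symmetric] sum_ennreal)
    qed
  qed
  finally have rhs: "(\<Sum>\<sigma> | midx_order \<sigma> = m. \<integral>\<^sup>+x. indicator (cube a l) x * ennreal \<bar>h \<sigma> x\<bar> \<partial>lborel)
      = (\<integral>\<^sup>+x. indicator (cube a l) x * ennreal (grad_norm m f x) \<partial>lebesgue)"
    by (simp only: nn_integral_completion)
  show ?thesis using that[OF \<pi>] le unfolding lhs rhs by blast
qed

lemma locally_integrable_cube:
  fixes a :: "real ^ 'n::finite"
  shows "locally_integrable f \<Longrightarrow> set_integrable lebesgue (cube a l) f"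
  unfolding locally_integrable_def cube_def using compact_cbox by blast

lemma emeasure_cube:
  fixes a :: "real ^ 'n::finite"
  shows "0 \<le> l \<Longrightarrow> emeasure lebesgue (cube a l) = ennreal (l ^ CARD('n))"
  using emeasure_lborel_cube[of l a] by simp

lemma ennreal_average:
  fixes h :: "real ^ 'n::finite \<Rightarrow> real"
  assumes h: "set_integrable lebesgue (cube a l) h" and nonneg: "\<And>x. 0 \<le> h x" and l: "0 < l"
  shows "ennreal (average (cube a l) h)
    = ennreal (1 / l ^ CARD('n)) * (\<integral>\<^sup>+x. indicator (cube a l) x * ennreal (h x) \<partial>lebesgue)"
proof -
  have "(\<integral>\<^sup>+x. ennreal (indicator (cube a l) x * h x) \<partial>lebesgue) = ennreal (LINT x:cube a l|lebesgue. h x)"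
    using h nonneg unfolding set_integrable_def set_lebesgue_integral_def real_scaleR_def
    by (intro nn_integral_eq_integral) auto
  moreover have "ennreal (indicator (cube a l) x * h x) = indicator (cube a l) x * ennreal (h x)" for x
    by (simp add: indicator_def)
  ultimately have eq: "(\<integral>\<^sup>+x. indicator (cube a l) x * ennreal (h x) \<partial>lebesgue) = ennreal (LINT x:cube a l|lebesgue. h x)"
    by simp
  have "average (cube a l) h = (1 / l ^ CARD('n)) * (LINT x:cube a l|lebesgue. h x)"
    using l by (simp add: average_def measure_lborel_cube)
  moreover have "0 \<le> 1 / l ^ CARD('n)" using l by simp
  ultimately show ?thesis unfolding eq by (simp only: ennreal_mult')
qed

text \<open>The projection is as good an approximation in mean as any polynomial
  \<open>\<pi>\<close>, up to the factor \<open>1 + K\<close>: by the triangle inequality only its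
  distance to \<open>\<pi>\<close> is added, and this is at most \<open>K\<close> times the mean of
  \<open>\<bar>f - \<pi>\<bar>\<close>. Both constants are fixed before cube and function.\<close>

lemma projection_poincare:
  assumes m: "1 \<le> m"
  obtains K C where "0 \<le> K" "0 \<le> C"
    "\<And>(a :: real ^ 'n::finite) l f. 0 < l \<Longrightarrow> locally_integrable f \<Longrightarrow>
       poly_proj (m - 1) (cube a l) f \<in> polys_upto (m - 1)"
    "\<And>(a :: real ^ 'n::finite) l f q x. 0 < l \<Longrightarrow> locally_integrable f \<Longrightarrow>
       q \<in> polys_upto (m - 1) \<Longrightarrow> x \<in> cube a l \<Longrightarrow>
       ennreal \<bar>poly_proj (m - 1) (cube a l) f x - q x\<bar>
       \<le> ennreal (K / l ^ CARD('n)) * (\<integral>\<^sup>+y. indicator (cube a l) y * ennreal \<bar>f y - q y\<bar> \<partial>lebesgue)"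
    "\<And>(a :: real ^ 'n::finite) l f. 0 < l \<Longrightarrow> sobolev_loc m f \<Longrightarrow>
       (\<integral>\<^sup>+x. indicator (cube a l) x * ennreal \<bar>f x - poly_proj (m - 1) (cube a l) f x\<bar> \<partial>lebesgue)
       \<le> ennreal (C * l ^ m) * (\<integral>\<^sup>+x. indicator (cube a l) x * ennreal (grad_norm m f x) \<partial>lebesgue)"
proof -
  obtain K where K: "0 \<le> K"
    and poly: "\<And>(a :: real ^ 'n) l f. 0 < l \<Longrightarrow> set_integrable lebesgue (cube a l) f \<Longrightarrow>
       poly_proj (m - 1) (cube a l) f \<in> polys_upto (m - 1)"
    and bound: "\<And>(a :: real ^ 'n) l f q x. 0 < l \<Longrightarrow> set_integrable lebesgue (cube a l) f \<Longrightarrow>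
       q \<in> polys_upto (m - 1) \<Longrightarrow> x \<in> cube a l \<Longrightarrow>
       \<bar>poly_proj (m - 1) (cube a l) f x - q x\<bar> \<le> K * average (cube a l) (\<lambda>y. \<bar>f y - q y\<bar>)"
    using poly_proj_bound[of "m - 1"] by blast
  define C where "C = (1 + K) * (2 ^ CARD('n) * CARD('n)) ^ m"
  have nn_bound: "ennreal \<bar>poly_proj (m - 1) (cube a l) f x - q x\<bar>
       \<le> ennreal (K / l ^ CARD('n)) * (\<integral>\<^sup>+y. indicator (cube a l) y * ennreal \<bar>f y - q y\<bar> \<partial>lebesgue)"
    if l: "0 < l" and f: "locally_integrable f" and q: "q \<in> polys_upto (m - 1)" and x: "x \<in> cube a l"
    for a :: "real ^ 'n" and l f q x
  proof -
    have f': "set_integrable lebesgue (cube a l) f" using f by (rule locally_integrable_cube)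
    have "set_integrable lebesgue (cube a l) (\<lambda>y. f y - q y)"
      by (intro set_integral_diff f' continuous_set_integrable_cube polys_upto_continuous[OF q])
    from set_integrable_abs[OF this]
    have "ennreal (average (cube a l) (\<lambda>y. \<bar>f y - q y\<bar>))
      = ennreal (1 / l ^ CARD('n)) * (\<integral>\<^sup>+y. indicator (cube a l) y * ennreal \<bar>f y - q y\<bar> \<partial>lebesgue)"
      using l by (intro ennreal_average) auto
    then have "ennreal (K * average (cube a l) (\<lambda>y. \<bar>f y - q y\<bar>))
      = ennreal K * ennreal (1 / l ^ CARD('n)) * (\<integral>\<^sup>+y. indicator (cube a l) y * ennreal \<bar>f y - q y\<bar> \<partial>lebesgue)"
      using K by (simp only: ennreal_mult' mult.assoc)
    moreover have "ennreal K * ennreal (1 / l ^ CARD('n)) = ennreal (K / l ^ CARD('n))"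
      using K l by (subst ennreal_mult[symmetric]) auto
    ultimately show ?thesis using ennreal_leI[OF bound[OF l f' q x]] by simp
  qed
  have main: "(\<integral>\<^sup>+x. indicator (cube a l) x * ennreal \<bar>f x - poly_proj (m - 1) (cube a l) f x\<bar> \<partial>lebesgue)
       \<le> ennreal (C * l ^ m) * (\<integral>\<^sup>+x. indicator (cube a l) x * ennreal (grad_norm m f x) \<partial>lebesgue)"
    if l: "0 < l" and f: "sobolev_loc m f" for a :: "real ^ 'n" and l f
  proof -
    let ?Q = "cube a l" and ?P = "poly_proj (m - 1) (cube a l) f" and ?V = "l ^ CARD('n)"
    have f_loc: "locally_integrable f" using f by (simp add: sobolev_loc_def)
    have [measurable]: "f \<in> borel_measurable lebesgue" using f_loc by (rule locally_integrable_measurable)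
    obtain \<pi> where \<pi>: "\<pi> \<in> polys_upto (m - 1)"
      and le: "(\<integral>\<^sup>+x. indicator ?Q x * ennreal \<bar>f x - \<pi> x\<bar> \<partial>lebesgue)
      \<le> ennreal ((2 ^ CARD('n) * l * CARD('n)) ^ m)
        * (\<integral>\<^sup>+x. indicator ?Q x * ennreal (grad_norm m f x) \<partial>lebesgue)"
      using sobolev_poincare_polynomial[OF m f l, of a] by blast
    have [measurable]: "\<pi> \<in> borel_measurable lebesgue"
      using borel_measurable_continuous_onI[OF polys_upto_continuous[OF \<pi>]]
      by (intro measurable_completion) simp
    have Q[measurable]: "?Q \<in> sets lebesgue" by (simp add: cube_def)
    define J where "J = (\<integral>\<^sup>+x. indicator ?Q x * ennreal \<bar>f x - \<pi> x\<bar> \<partial>lebesgue)"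
    have "(\<integral>\<^sup>+x. indicator ?Q x * ennreal \<bar>f x - ?P x\<bar> \<partial>lebesgue)
      \<le> (\<integral>\<^sup>+x. indicator ?Q x * ennreal \<bar>f x - \<pi> x\<bar> + (ennreal (K / ?V) * J) * indicator ?Q x \<partial>lebesgue)"
    proof (rule nn_integral_mono)
      fix x
      show "indicator ?Q x * ennreal \<bar>f x - ?P x\<bar>
        \<le> indicator ?Q x * ennreal \<bar>f x - \<pi> x\<bar> + (ennreal (K / ?V) * J) * indicator ?Q x"
      proof (cases "x \<in> ?Q")
        case True
        have "ennreal \<bar>f x - ?P x\<bar> \<le> ennreal \<bar>f x - \<pi> x\<bar> + ennreal \<bar>?P x - \<pi> x\<bar>"
          by (subst ennreal_plus[symmetric]) (auto simp del: ennreal_plus intro!: ennreal_leI)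
        also have "\<dots> \<le> ennreal \<bar>f x - \<pi> x\<bar> + ennreal (K / ?V) * J"
          unfolding J_def by (intro add_left_mono nn_bound l f_loc \<pi> True)
        finally show ?thesis using True by simp
      qed simp
    qed
    also have "\<dots> = J + ennreal (K / ?V) * J * emeasure lebesgue ?Q"
      by (subst nn_integral_add) (simp_all only: J_def nn_integral_cmult_indicator[OF Q], measurable)
    also have "\<dots> = ennreal (1 + K) * J"
    proof -
      have "ennreal (K / ?V) * J * emeasure lebesgue ?Q = (ennreal (K / ?V) * ennreal ?V) * J"
        using l by (simp only: emeasure_cube less_imp_le ac_simps)
      also have "ennreal (K / ?V) * ennreal ?V = ennreal K"
        using K l by (subst ennreal_mult[symmetric]) auto
      finally show ?thesis using K by (simp add: distrib_right)
    qed
    also have "\<dots> \<le> ennreal (1 + K) * (ennreal ((2 ^ CARD('n) * l * CARD('n)) ^ m)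
        * (\<integral>\<^sup>+x. indicator ?Q x * ennreal (grad_norm m f x) \<partial>lebesgue))"
      using le unfolding J_def by (intro mult_left_mono) auto
    also have "\<dots> = ennreal ((1 + K) * (2 ^ CARD('n) * l * CARD('n)) ^ m)
        * (\<integral>\<^sup>+x. indicator ?Q x * ennreal (grad_norm m f x) \<partial>lebesgue)"
    proof -
      have "0 \<le> 1 + K" using K by simp
      from ennreal_mult'[OF this] show ?thesis by (simp only: mult.assoc)
    qed
    also have "(1 + K) * (2 ^ CARD('n) * l * CARD('n)) ^ m = C * l ^ m"
      by (simp add: C_def power_mult_distrib)
    finally show ?thesis .
  qed
  have "0 \<le> C" using K by (simp add: C_def)
  show ?thesis
    by (rule that[OF K \<open>0 \<le> C\<close> poly[OF _ locally_integrable_cube] nn_bound main])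
qed

section \<open>Dyadic subcubes\<close>

definition dyadic_index :: "nat \<Rightarrow> ('n::finite \<Rightarrow> nat) set" where
  "dyadic_index k = {j. \<forall>i. j i < 2 ^ k}"

definition dyadic_corner :: "real ^ 'n \<Rightarrow> real \<Rightarrow> nat \<Rightarrow> ('n::finite \<Rightarrow> nat) \<Rightarrow> real ^ 'n" where
  "dyadic_corner a l k j = a + (\<chi> i. l / 2 ^ k * real (j i))"

definition dyadic_cube :: "real ^ 'n \<Rightarrow> real \<Rightarrow> nat \<Rightarrow> ('n::finite \<Rightarrow> nat) \<Rightarrow> (real ^ 'n) set" where
  "dyadic_cube a l k j = cube (dyadic_corner a l k j) (l / 2 ^ k)"

text \<open>Half-open, so that the cells of one generation are disjoint. The closed
  \<open>dyadic_cube\<close> is kept beside it because the weight condition and the Poincare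
  inequality concern closed cubes; the two differ by a null set.\<close>

definition dyadic_cell :: "real ^ 'n \<Rightarrow> real \<Rightarrow> nat \<Rightarrow> ('n::finite \<Rightarrow> nat) \<Rightarrow> (real ^ 'n) set" where
  "dyadic_cell a l k j = {x. \<forall>i. dyadic_corner a l k j $ i \<le> x $ i \<and> x $ i < dyadic_corner a l k j $ i + l / 2 ^ k}"

definition dyadic_position :: "real ^ 'n \<Rightarrow> real \<Rightarrow> nat \<Rightarrow> real ^ 'n \<Rightarrow> 'n::finite \<Rightarrow> nat" where
  "dyadic_position a l k x = (\<lambda>i. nat \<lfloor>(x $ i - a $ i) / (l / 2 ^ k)\<rfloor>)"

lemma finite_dyadic_index: "finite (dyadic_index k :: ('n::finite \<Rightarrow> nat) set)"
proof -
  have "(dyadic_index k :: ('n \<Rightarrow> nat) set) \<subseteq> PiE UNIV (\<lambda>_. {..<2 ^ k})"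
    by (auto simp: dyadic_index_def)
  then show ?thesis by (rule finite_subset) (simp add: finite_PiE)
qed

lemma dyadic_cell_subset: "dyadic_cell a l k j \<subseteq> dyadic_cube a l k j"
  by (auto simp: dyadic_cell_def dyadic_cube_def mem_cube less_imp_le)

lemma dyadic_cube_0: "dyadic_cube a l 0 (\<lambda>_. 0) = cube a l"
  by (simp add: dyadic_cube_def dyadic_corner_def zero_vec_def[symmetric])

lemma mem_dyadic_cell:
  "x \<in> dyadic_cell a l k j \<longleftrightarrow>
    (\<forall>i. l / 2 ^ k * real (j i) \<le> x $ i - a $ i \<and> x $ i - a $ i < l / 2 ^ k * (real (j i) + 1))"
  by (auto simp: dyadic_cell_def dyadic_corner_def algebra_simps add_divide_distrib)

lemma mem_dyadic_cell_0: "x \<in> dyadic_cell a l 0 (\<lambda>_. 0) \<longleftrightarrow> (\<forall>i. 0 \<le> x $ i - a $ i \<and> x $ i - a $ i < l)"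
  by (simp add: mem_dyadic_cell)

lemma dyadic_position_bounds:
  assumes l: "0 < l" and x: "x \<in> dyadic_cell a l 0 (\<lambda>_. 0)"
  shows "real (dyadic_position a l k x i) \<le> (x $ i - a $ i) / (l / 2 ^ k)"
    and "(x $ i - a $ i) / (l / 2 ^ k) < real (dyadic_position a l k x i) + 1"
    and "dyadic_position a l k x i < 2 ^ k"
proof -
  let ?y = "(x $ i - a $ i) / (l / 2 ^ k)"
  have x': "0 \<le> x $ i - a $ i" "x $ i - a $ i < l" using x by (auto simp: mem_dyadic_cell_0)
  have s: "0 < l / 2 ^ k" using l by simp
  have "0 \<le> ?y" using x' s by simp
  moreover have "?y < 2 ^ k" unfolding pos_divide_less_eq[OF s] using x' by simp
  ultimately have "real (dyadic_position a l k x i) = of_int \<lfloor>?y\<rfloor>"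
    by (simp add: dyadic_position_def)
  then show 1: "real (dyadic_position a l k x i) \<le> ?y" "?y < real (dyadic_position a l k x i) + 1"
    by linarith+
  from 1(1) \<open>?y < 2 ^ k\<close> have "real (dyadic_position a l k x i) < 2 ^ k" by (rule le_less_trans)
  also have "2 ^ k = real (2 ^ k)" by simp
  finally have "real (dyadic_position a l k x i) < real (2 ^ k)" .
  then show "dyadic_position a l k x i < 2 ^ k" by (simp only: of_nat_less_iff)
qed

lemma dyadic_position_index:
  "0 < l \<Longrightarrow> x \<in> dyadic_cell a l 0 (\<lambda>_. 0) \<Longrightarrow> dyadic_position a l k x \<in> dyadic_index k"
  using dyadic_position_bounds(3) by (auto simp: dyadic_index_def)

text \<open>The cells of one generation tile the cell of generation 0, since the floor in
  \<open>dyadic_position\<close> is the only index that fits. A sum over the cells thus picks out a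
  single term at each point.\<close>

lemma mem_dyadic_cell_iff:
  assumes l: "0 < l" and j: "j \<in> dyadic_index k"
  shows "x \<in> dyadic_cell a l k j \<longleftrightarrow> x \<in> dyadic_cell a l 0 (\<lambda>_. 0) \<and> j = dyadic_position a l k x"
proof
  assume x: "x \<in> dyadic_cell a l k j"
  have s: "0 < l / 2 ^ k" using l by simp
  have "0 \<le> x $ i - a $ i \<and> x $ i - a $ i < l" for i
  proof -
    have 1: "l / 2 ^ k * real (j i) \<le> x $ i - a $ i" "x $ i - a $ i < l / 2 ^ k * (real (j i) + 1)"
      using x by (auto simp: mem_dyadic_cell)
    have "real (j i) + 1 \<le> 2 ^ k"
    proof -
      have "j i + 1 \<le> 2 ^ k" using j by (auto simp: dyadic_index_def Suc_le_eq)
      then have "real (j i + 1) \<le> real (2 ^ k)" by (simp only: of_nat_le_iff)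
      then show ?thesis by simp
    qed
    then have "l / 2 ^ k * (real (j i) + 1) \<le> l / 2 ^ k * 2 ^ k"
      using s by (intro mult_left_mono) auto
    moreover have "0 \<le> l / 2 ^ k * real (j i)" using l by simp
    ultimately show ?thesis using 1 by simp
  qed
  moreover have "j i = dyadic_position a l k x i" for i
  proof -
    have "real (j i) \<le> (x $ i - a $ i) / (l / 2 ^ k)" "(x $ i - a $ i) / (l / 2 ^ k) < real (j i) + 1"
      unfolding pos_le_divide_eq[OF s] pos_divide_less_eq[OF s]
      using x[unfolded mem_dyadic_cell, rule_format, of i] by (simp_all only: mult.commute)
    then have "\<lfloor>(x $ i - a $ i) / (l / 2 ^ k)\<rfloor> = int (j i)" by linarith
    then show ?thesis by (simp add: dyadic_position_def)
  qed
  ultimately show "x \<in> dyadic_cell a l 0 (\<lambda>_. 0) \<and> j = dyadic_position a l k x"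
    by (auto simp: mem_dyadic_cell_0)
next
  assume x: "x \<in> dyadic_cell a l 0 (\<lambda>_. 0) \<and> j = dyadic_position a l k x"
  have s: "0 < l / 2 ^ k" using l by simp
  show "x \<in> dyadic_cell a l k j"
    unfolding mem_dyadic_cell
  proof
    fix i
    have "real (j i) \<le> (x $ i - a $ i) / (l / 2 ^ k)" "(x $ i - a $ i) / (l / 2 ^ k) < real (j i) + 1"
      using dyadic_position_bounds[OF l, where x = x and a = a and k = k and i = i] x by auto
    then show "l / 2 ^ k * real (j i) \<le> x $ i - a $ i \<and> x $ i - a $ i < l / 2 ^ k * (real (j i) + 1)"
      unfolding pos_le_divide_eq[OF s] pos_divide_less_eq[OF s] by (simp only: mult.commute)
  qed
qed

lemma dyadic_cells_sum:
  fixes c :: "('n::finite \<Rightarrow> nat) \<Rightarrow> ennreal"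
  assumes l: "0 < l"
  shows "(\<Sum>j\<in>dyadic_index k. indicator (dyadic_cell a l k j) x * c j)
    = indicator (dyadic_cell a l 0 (\<lambda>_. 0)) x * c (dyadic_position a l k x)"
proof (cases "x \<in> dyadic_cell a l 0 (\<lambda>_. 0)")
  case True
  have "(\<Sum>j\<in>dyadic_index k. indicator (dyadic_cell a l k j) x * c j)
    = (\<Sum>j\<in>dyadic_index k. if j = dyadic_position a l k x then c j else 0)"
    using mem_dyadic_cell_iff[OF l, of _ k x a] True by (intro sum.cong) (auto simp: indicator_def)
  then show ?thesis
    using True dyadic_position_index[OF l True] by (simp add: finite_dyadic_index)
next
  case False
  then have "x \<notin> dyadic_cell a l k j" if "j \<in> dyadic_index k" for j
    using mem_dyadic_cell_iff[OF l that] by blast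
  with False show ?thesis by simp
qed

lemma dyadic_nested:
  assumes l: "0 < l" and x: "x \<in> dyadic_cell a l 0 (\<lambda>_. 0)"
  shows "dyadic_cube a l (Suc k) (dyadic_position a l (Suc k) x) \<subseteq> dyadic_cube a l k (dyadic_position a l k x)"
proof
  fix y assume y: "y \<in> dyadic_cube a l (Suc k) (dyadic_position a l (Suc k) x)"
  define s where "s = l / 2 ^ Suc k"
  have s: "0 < s" "l / 2 ^ k = 2 * s" using l by (auto simp: s_def)
  show "y \<in> dyadic_cube a l k (dyadic_position a l k x)"
    unfolding dyadic_cube_def mem_cube
  proof
    fix i
    define j where "j = dyadic_position a l k x i"
    define j' where "j' = dyadic_position a l (Suc k) x i"
    define z where "z = (x $ i - a $ i) / (2 * s)"
    have "(x $ i - a $ i) / s = 2 * z"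
      using mult_divide_mult_cancel_left[of 2 "x $ i - a $ i" s] by (simp add: z_def)
    then have z: "real j \<le> z" "z < real j + 1" "real j' \<le> 2 * z" "2 * z < real j' + 1"
      using dyadic_position_bounds[OF l x, where k = k and i = i]
        dyadic_position_bounds[OF l x, where k = "Suc k" and i = i] s
      by (simp_all add: j_def j'_def z_def s_def[symmetric] del: power_Suc)
    \<comment> \<open>In units of the larger side, \<open>j\<close> is the floor of \<open>z\<close>
      and \<open>j'\<close> that of \<open>2 * z\<close>. Comparing integers leaves only
      \<open>j' = 2 * j\<close> or \<open>j' = 2 * j + 1\<close>, the two halves of the parent in
      this coordinate.\<close>
    have "real (2 * j) < real (j' + 1)" using z(1,4) by simp
    then have "2 * j \<le> j'" by linarith
    have "real j' < real (2 * j + 2)" using z(2,3) by simp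
    then have "j' + 1 \<le> 2 * j + 2" by linarith
    with \<open>2 * j \<le> j'\<close> have "2 * real j \<le> real j'" "real j' + 1 \<le> 2 * real j + 2" by linarith+
    then have "s * (2 * real j) \<le> s * real j'" "s * (real j' + 1) \<le> s * (2 * real j + 2)"
      using s by (simp_all only: mult_le_cancel_left_pos)
    moreover have "a $ i + s * real j' \<le> y $ i" "y $ i \<le> a $ i + s * real j' + s"
      using y by (auto simp: dyadic_cube_def mem_cube dyadic_corner_def s_def j'_def)
    ultimately show "dyadic_corner a l k (dyadic_position a l k x) $ i \<le> y $ i \<and>
      y $ i \<le> dyadic_corner a l k (dyadic_position a l k x) $ i + l / 2 ^ k"
      by (simp add: dyadic_corner_def s(2) j_def[symmetric] algebra_simps)
  qed
qed

lemma dyadic_cell_measurable [measurable]: "dyadic_cell a l k j \<in> sets borel"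
proof -
  have "dyadic_cell a l k j = (\<Inter>i. {x. dyadic_corner a l k j $ i \<le> x $ i} \<inter> {x. x $ i < dyadic_corner a l k j $ i + l / 2 ^ k})"
    by (auto simp: dyadic_cell_def)
  also have "\<dots> \<in> sets borel"
    by (intro sets.finite_INT) (auto intro!: sets.Int borel_closed borel_open closed_Collect_le open_Collect_less continuous_intros)
  finally show ?thesis .
qed

lemma AE_dyadic_cell_cube: "AE x in lebesgue. x \<in> dyadic_cell a l k j \<longleftrightarrow> x \<in> dyadic_cube a l k j"
proof -
  let ?c = "dyadic_corner a l k j" and ?s = "\<chi> i. l / 2 ^ k"
  have "negligible (cbox ?c (?c + ?s) - box ?c (?c + ?s))" by (rule negligible_frontier_interval)
  moreover have "box ?c (?c + ?s) \<subseteq> dyadic_cell a l k j"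
    by (auto simp: dyadic_cell_def mem_box_cart less_imp_le)
  then have "dyadic_cube a l k j - dyadic_cell a l k j \<subseteq> cbox ?c (?c + ?s) - box ?c (?c + ?s)"
    by (auto simp: dyadic_cube_def cube_def)
  ultimately have "negligible (dyadic_cube a l k j - dyadic_cell a l k j)"
    by (rule negligible_subset)
  then have "AE x in lebesgue. x \<notin> dyadic_cube a l k j - dyadic_cell a l k j"
    by (intro AE_not_in) (simp add: negligible_iff_null_sets)
  then show ?thesis
  proof eventually_elim
    case (elim x)
    then show ?case using dyadic_cell_subset by blast
  qed
qed

lemma nn_integral_dyadic_cell:
  "(\<integral>\<^sup>+x. indicator (dyadic_cell a l k j) x * h x \<partial>lebesgue) = (\<integral>\<^sup>+x. indicator (dyadic_cube a l k j) x * h x \<partial>lebesgue)"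
proof (rule nn_integral_cong_AE)
  show "AE x in lebesgue. indicator (dyadic_cell a l k j) x * h x = indicator (dyadic_cube a l k j) x * h x"
    using AE_dyadic_cell_cube by eventually_elim (auto simp: indicator_def)
qed

text \<open>The closed cubes overlap only on their boundaries, so each is replaced by its cell,
  where the tiling is exact.\<close>

lemma dyadic_cubes_sum:
  fixes a :: "real ^ 'n::finite"
  assumes l: "0 < l" and [measurable]: "h \<in> borel_measurable lebesgue"
  shows "(\<Sum>j\<in>dyadic_index k. \<integral>\<^sup>+x. indicator (dyadic_cube a l k j) x * h x \<partial>lebesgue)
    = (\<integral>\<^sup>+x. indicator (cube a l) x * h x \<partial>lebesgue)"
proof -
  have [measurable]: "dyadic_cell a l k j \<in> sets lebesgue" for k j
    using dyadic_cell_measurable[of a l k j] by simp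
  have "(\<Sum>j\<in>dyadic_index k. \<integral>\<^sup>+x. indicator (dyadic_cube a l k j) x * h x \<partial>lebesgue)
    = (\<integral>\<^sup>+x. (\<Sum>j\<in>dyadic_index k. indicator (dyadic_cell a l k j) x * h x) \<partial>lebesgue)"
    unfolding nn_integral_dyadic_cell[symmetric] by (rule nn_integral_sum[symmetric]) measurable
  also have "\<dots> = (\<integral>\<^sup>+x. indicator (dyadic_cell a l 0 (\<lambda>_. 0)) x * h x \<partial>lebesgue)"
    by (simp add: dyadic_cells_sum[OF l])
  finally show ?thesis by (simp add: nn_integral_dyadic_cell dyadic_cube_0)
qed

section \<open>The two-weight condition\<close>

lemma powr_minus_one_mult:
  fixes z p :: real
  assumes "0 \<le> z"
  shows "z powr (p - 1) * z = z powr p"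
proof (cases "z = 0")
  case False
  then show ?thesis using assms powr_add[of z "p - 1" 1] by simp
qed simp

text \<open>Young's inequality for \<open>y\<close> and \<open>z powr (p - 1)\<close> with exponents
  \<open>p\<close> and \<open>p / (p - 1)\<close>. This form of convexity includes the boundary
  values \<open>y = 0\<close> and \<open>z = 0\<close>.\<close>

lemma powr_above_tangent:
  fixes y z p :: real
  assumes y: "0 \<le> y" and z: "0 \<le> z" and p: "1 < p"
  shows "z powr p + p * z powr (p - 1) * (y - z) \<le> y powr p"
proof -
  have "y * z powr (p - 1) \<le> y powr p / p + (z powr (p - 1)) powr (p / (p - 1)) / (p / (p - 1))"
    using y p by (intro Youngs_inequality) (auto simp: field_simps)
  also have "(z powr (p - 1)) powr (p / (p - 1)) = z powr p"
    using p by (simp add: powr_powr)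
  finally have "p * (y * z powr (p - 1)) \<le> p * (y powr p / p + z powr p / (p / (p - 1)))"
    using p by (intro mult_left_mono) auto
  also have "\<dots> = y powr p + (p - 1) * z powr p"
    using p by (simp add: field_simps)
  finally have "p * (y * z powr (p - 1)) \<le> y powr p + (p - 1) * z powr p" .
  moreover have "p * z powr (p - 1) * (y - z) = p * (y * z powr (p - 1)) - p * z powr p"
    unfolding powr_minus_one_mult[OF z, of p, symmetric] by (simp add: algebra_simps)
  ultimately show ?thesis by (simp only: left_diff_distrib)
qed

text \<open>Jensen's inequality for weights of total mass at most 1: the tangent inequality at the
  weighted sum \<open>S\<close> is added up over all \<open>k\<close>.\<close>

lemma powr_weighted_sum_le:
  fixes A :: "nat \<Rightarrow> real"
  assumes A: "\<And>k. 0 \<le> A k" and p: "1 < p"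
  shows "(\<Sum>k<K. (1 / 2) ^ Suc k * A k) powr p \<le> (\<Sum>k<K. (1 / 2) ^ Suc k * A k powr p)"
proof -
  define w where "w k = (1 / 2 :: real) ^ Suc k" for k
  define S where "S = (\<Sum>k<K. w k * A k)"
  have w: "0 \<le> w k" for k by (simp add: w_def)
  have S: "0 \<le> S" unfolding S_def using w A by (intro sum_nonneg) simp
  have W: "(\<Sum>k<K. w k) \<le> 1"
  proof -
    have "(\<Sum>k<K. w k) = 1 - (1 / 2) ^ K" by (induction K) (auto simp: w_def)
    then show ?thesis by simp
  qed
  define q where "q = S powr p"
  define t where "t = S powr (p - 1)"
  have SS: "q = t * S" unfolding q_def t_def using powr_minus_one_mult[OF S] by simp
  have q: "0 \<le> q" by (simp add: q_def)
  \<comment> \<open>The missing mass \<open>1 - (\<Sum>k<K. w k)\<close> is nonnegative. With this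
    multiple of it added, the expression equals the weighted sum of the tangent values, because
    \<open>q = t * S\<close>.\<close>
  have "q \<le> q + (p - 1) * q * (1 - (\<Sum>k<K. w k))"
    using W p q by simp
  also have "\<dots> = (\<Sum>k<K. w k) * q + (p * t) * S - (\<Sum>k<K. w k) * ((p * t) * S)"
    by (simp add: SS algebra_simps)
  also have "\<dots> = (\<Sum>k<K. w k * q) + (\<Sum>k<K. (p * t) * (w k * A k)) - (\<Sum>k<K. w k * ((p * t) * S))"
  proof -
    have "(\<Sum>k<K. w k) * q = (\<Sum>k<K. w k * q)" by (rule sum_distrib_right)
    moreover have "(\<Sum>k<K. w k) * ((p * t) * S) = (\<Sum>k<K. w k * ((p * t) * S))"
      by (rule sum_distrib_right)
    moreover have "(p * t) * S = (\<Sum>k<K. (p * t) * (w k * A k))"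
      unfolding S_def by (rule sum_distrib_left)
    ultimately show ?thesis by linarith
  qed
  also have "\<dots> = (\<Sum>k<K. w k * q + (p * t) * (w k * A k) - w k * ((p * t) * S))"
    by (simp only: sum.distrib sum_subtractf)
  also have "\<dots> = (\<Sum>k<K. w k * (q + p * t * (A k - S)))"
    by (intro sum.cong) (simp_all add: algebra_simps)
  also have "\<dots> \<le> (\<Sum>k<K. w k * A k powr p)"
    unfolding q_def t_def by (intro sum_mono mult_left_mono powr_above_tangent A S p w)
  finally show ?thesis by (simp add: S_def w_def q_def)
qed

lemma epowr_negative:
  assumes "r < 0" "0 \<le> t"
  shows "epowr (ennreal t) r = (if t = 0 then top else ennreal (t powr r))"
  using assms by (auto simp: epowr_def)

lemma epowr_positive:
  assumes "0 < r" "0 \<le> t"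
  shows "epowr (ennreal t) r = ennreal (t powr r)"
  using assms by (auto simp: epowr_def)

text \<open>Hoelder's inequality for \<open>g = (g v\<^bsup>1/p\<^esup>) v\<^bsup>-1/p\<^esup>\<close>, obtained by integrating the tangent inequality
  at the mean of \<open>g v\<^bsup>1/(p-1)\<^esup>\<close> with respect to the weight \<open>v\<^bsup>-1/(p-1)\<^esup>\<close>.\<close>

lemma dual_weight_hoelder:
  fixes v g :: "real ^ 'n::finite \<Rightarrow> real"
  assumes p: "1 < p" and v: "\<And>x. 0 \<le> v x" and g: "\<And>x. 0 \<le> g x"
    and [measurable]: "v \<in> borel_measurable lebesgue" "g \<in> borel_measurable lebesgue" "Q \<in> sets lebesgue"
    and T: "(\<integral>\<^sup>+x. indicator Q x * ennreal (g x) \<partial>lebesgue) = ennreal T" "0 \<le> T"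
    and J: "(\<integral>\<^sup>+x. epowr (ennreal (v x)) (1 - p / (p - 1)) * indicator Q x \<partial>lebesgue) = ennreal J" "0 < J"
  shows "ennreal (T powr p) \<le> ennreal (J powr (p - 1)) * (\<integral>\<^sup>+x. indicator Q x * ennreal (g x powr p * v x) \<partial>lebesgue)"
proof -
  define r where "r = 1 - p / (p - 1)"
  have r: "r < 0" "r * (1 - p) = 1" using p by (auto simp: r_def field_simps)
  define \<sigma> where "\<sigma> x = epowr (ennreal (v x)) r" for x
  have \<sigma>: "\<sigma> x = (if v x = 0 then top else ennreal (v x powr r))" for x
    unfolding \<sigma>_def using r v by (intro epowr_negative) auto
  have [measurable]: "\<sigma> \<in> borel_measurable lebesgue" unfolding \<sigma> by measurable
  define y where "y = T / J"
  have y: "0 \<le> y" "y * J = T" using T J by (auto simp: y_def)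
  define N where "N = (\<integral>\<^sup>+x. indicator Q x * ennreal (g x powr p * v x) \<partial>lebesgue)"
  have J': "(\<integral>\<^sup>+x. \<sigma> x * indicator Q x \<partial>lebesgue) = ennreal J"
    unfolding \<sigma>_def r_def by (rule J(1))
  have m: "(\<lambda>x. \<sigma> x * indicator Q x) \<in> borel_measurable lebesgue"
    "(\<lambda>x. indicator Q x * ennreal (g x)) \<in> borel_measurable lebesgue"
    "(\<lambda>x. indicator Q x * ennreal (g x powr p * v x)) \<in> borel_measurable lebesgue"
    by measurable
  have "(\<integral>\<^sup>+x. \<sigma> x * indicator Q x \<partial>lebesgue) \<noteq> \<infinity>" by (simp add: J')
  then have "AE x in lebesgue. \<sigma> x * indicator Q x \<noteq> \<infinity>"
    by (intro nn_integral_noteq_infinite) auto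
  \<comment> \<open>The tangent inequality multiplied by the dual weight, with its negative term
    moved to the right so that everything stays within extended nonnegative reals.\<close>
  then have "AE x in lebesgue. ennreal (y powr p) * (\<sigma> x * indicator Q x)
      + ennreal (p * y powr (p - 1)) * (indicator Q x * ennreal (g x))
    \<le> indicator Q x * ennreal (g x powr p * v x) + ennreal (p * y powr p) * (\<sigma> x * indicator Q x)"
  proof eventually_elim
    case (elim x)
    show ?case
    proof (cases "x \<in> Q")
      case True
      with elim have vx: "0 < v x" using v[of x] by (auto simp: \<sigma> split: if_splits)
      define s where "s = v x powr r"
      have s: "0 < s" using vx by (simp add: s_def)
      \<comment> \<open>The exponent satisfies \<open>r * (1 - p) = 1\<close>, so multiplying
        \<open>(g x / s) powr p\<close> by the dual weight \<open>s\<close> restores the weight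
        \<open>v x\<close>.\<close>
      have "s / s powr p = v x" using vx r powr_diff[of s 1 p] s by (simp add: s_def powr_powr)
      moreover have "s * (g x / s) powr p = g x powr p * (s / s powr p)"
        using s g[of x] by (simp add: powr_divide)
      ultimately have sv: "s * (g x / s) powr p = g x powr p * v x" by simp
      have "y powr p + p * y powr (p - 1) * (g x / s - y) \<le> (g x / s) powr p"
        using y(1) g s p by (intro powr_above_tangent) auto
      then have "s * (y powr p + p * y powr (p - 1) * (g x / s - y)) \<le> g x powr p * v x"
        unfolding sv[symmetric] using s by (intro mult_left_mono) auto
      moreover have "s * (y powr p + p * y powr (p - 1) * (g x / s - y))
        = y powr p * s + p * y powr (p - 1) * g x - p * (y powr (p - 1) * y) * s"
        using s by (simp add: field_simps)
      moreover note powr_minus_one_mult[OF y(1), of p]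
      ultimately have le: "y powr p * s + p * y powr (p - 1) * g x \<le> g x powr p * v x + p * y powr p * s"
        by simp
      have "\<sigma> x = ennreal s" using vx by (simp add: \<sigma> s_def)
      moreover have "ennreal (y powr p) * ennreal s + ennreal (p * y powr (p - 1)) * ennreal (g x)
        \<le> ennreal (g x powr p * v x) + ennreal (p * y powr p) * ennreal s"
        using le p s g[of x] v[of x]
        by (simp add: ennreal_mult[symmetric] ennreal_plus[symmetric] ennreal_leI del: ennreal_plus)
      ultimately show ?thesis using True by simp
    qed simp
  qed
  then have "(\<integral>\<^sup>+x. ennreal (y powr p) * (\<sigma> x * indicator Q x)
      + ennreal (p * y powr (p - 1)) * (indicator Q x * ennreal (g x)) \<partial>lebesgue)
    \<le> (\<integral>\<^sup>+x. indicator Q x * ennreal (g x powr p * v x) + ennreal (p * y powr p) * (\<sigma> x * indicator Q x) \<partial>lebesgue)"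
    by (rule nn_integral_mono_AE)
  moreover have "(\<integral>\<^sup>+x. ennreal (y powr p) * (\<sigma> x * indicator Q x)
      + ennreal (p * y powr (p - 1)) * (indicator Q x * ennreal (g x)) \<partial>lebesgue)
    = ennreal (y powr p) * ennreal J + ennreal (p * y powr (p - 1)) * ennreal T"
    by (simp only: nn_integral_add[OF borel_measurable_times_ennreal[OF borel_measurable_const m(1)]
          borel_measurable_times_ennreal[OF borel_measurable_const m(2)]]
        nn_integral_cmult[OF m(1)] nn_integral_cmult[OF m(2)] T(1) J')
  moreover have "(\<integral>\<^sup>+x. indicator Q x * ennreal (g x powr p * v x) + ennreal (p * y powr p) * (\<sigma> x * indicator Q x) \<partial>lebesgue)
    = N + ennreal (p * y powr p) * ennreal J"
    by (simp only: nn_integral_add[OF m(3) borel_measurable_times_ennreal[OF borel_measurable_const m(1)]]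
        nn_integral_cmult[OF m(1)] N_def J')
  \<comment> \<open>For \<open>y = T / J\<close> the linear terms of the tangent balance. They are
    finite and cancel, leaving \<open>y powr p * J \<le> N\<close>, which is the claim up to the
    factor \<open>J powr (p - 1)\<close>.\<close>
  moreover have "ennreal (p * y powr (p - 1)) * ennreal T = ennreal (p * y powr p) * ennreal J"
  proof -
    have "p * y powr (p - 1) * T = p * y powr p * J"
      unfolding y(2)[symmetric] powr_minus_one_mult[OF y(1), of p, symmetric] by simp
    then show ?thesis using p T J by (simp add: ennreal_mult[symmetric])
  qed
  ultimately have "ennreal (y powr p) * ennreal J + ennreal (p * y powr p) * ennreal J
    \<le> N + ennreal (p * y powr p) * ennreal J" by simp
  moreover have "ennreal (p * y powr p) * ennreal J \<noteq> top" by (simp add: ennreal_mult_eq_top_iff)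
  ultimately have "ennreal (y powr p) * ennreal J \<le> N"
    by (simp add: add.commute[of _ "ennreal (p * y powr p) * ennreal J"])
  then have "ennreal (y powr p * J) \<le> N" using J by (simp add: ennreal_mult)
  then have "ennreal (J powr (p - 1)) * ennreal (y powr p * J) \<le> ennreal (J powr (p - 1)) * N"
    by (rule mult_left_mono) simp
  moreover have "J powr (p - 1) * (y powr p * J) = T powr p"
  proof -
    have "J powr (p - 1) * (y powr p * J) = (J powr (p - 1) * J) * y powr p" by (simp only: ac_simps)
    also have "\<dots> = J powr p * y powr p" using J by (simp only: powr_minus_one_mult less_imp_le)
    also have "\<dots> = T powr p"
      using J y by (metis less_imp_le mult.commute powr_mult)
    finally show ?thesis .
  qed
  ultimately show ?thesis
    using J by (simp add: ennreal_mult[symmetric] N_def)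
qed

lemma weight_measurable: "weight w \<Longrightarrow> w \<in> borel_measurable lebesgue"
  by (simp add: weight_def locally_integrable_measurable)

lemma locally_integrable_nn_finite:
  fixes a :: "real ^ 'n::finite"
  assumes "locally_integrable h"
  shows "(\<integral>\<^sup>+x. indicator (cube a l) x * ennreal \<bar>h x\<bar> \<partial>lebesgue) < top"
proof -
  have "integrable lebesgue (\<lambda>x. indicator (cube a l) x * h x)"
    using locally_integrable_cube[OF assms, of a l] by (simp add: set_integrable_def)
  then have "(\<integral>\<^sup>+x. ennreal (norm (indicator (cube a l) x * h x)) \<partial>lebesgue) < top"
    by (simp add: integrable_iff_bounded)
  moreover have "ennreal (norm (indicator (cube a l) x * h x)) = indicator (cube a l) x * ennreal \<bar>h x\<bar>" for x
    by (simp add: indicator_def)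
  ultimately show ?thesis by simp
qed

text \<open>Hoelder's inequality bounds \<open>T powr p\<close> through the integral of the dual
  weight. Multiplied by the measure \<open>U\<close> and divided by the \<open>p\<close>-th power of
  the volume, the coefficient becomes the product of averages that \<open>Ap_const\<close>
  dominates, one volume going to \<open>u\<close> and \<open>p - 1\<close> of them to the dual
  weight.\<close>

lemma Ap_average_bound:
  fixes u v g :: "real ^ 'n::finite \<Rightarrow> real"
  assumes p: "1 < p" and u: "weight u" and v: "weight v" and uv: "Ap_pair p u v" and l: "0 < l"
    and g: "\<And>x. 0 \<le> g x" and gm[measurable]: "g \<in> borel_measurable lebesgue"
    and T: "(\<integral>\<^sup>+x. indicator (cube a l) x * ennreal (g x) \<partial>lebesgue) = ennreal T" "0 \<le> T"
  shows "wmeasure u (cube a l) * ennreal ((T / l ^ CARD('n)) powr p)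
    \<le> Ap_const p u v * (\<integral>\<^sup>+x. indicator (cube a l) x * ennreal (g x powr p * v x) \<partial>lebesgue)"
proof -
  let ?Q = "cube a l" and ?V = "l ^ CARD('n)"
  let ?\<sigma> = "\<lambda>x. epowr (ennreal (v x)) (1 - p / (p - 1))"
  have [measurable]: "v \<in> borel_measurable lebesgue" "?Q \<in> sets lebesgue"
    using v by (auto simp: weight_measurable cube_def)
  have v0: "0 \<le> v x" and u0: "0 \<le> u x" for x using u v by (auto simp: weight_def)
  have V: "0 < ?V" using l by simp
  have eV: "emeasure lebesgue ?Q = ennreal ?V" "emeasure lborel ?Q = ennreal ?V"
    using l emeasure_lborel_cube[of l a] by simp_all
  define N where "N = (\<integral>\<^sup>+x. indicator ?Q x * ennreal (g x powr p * v x) \<partial>lebesgue)"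
  have "wmeasure u ?Q < top"
    using locally_integrable_nn_finite[of u a l] u u0 by (simp add: wmeasure_def weight_def mult.commute)
  then obtain U where U: "wmeasure u ?Q = ennreal U" "0 \<le> U" by (cases "wmeasure u ?Q") auto
  define S where "S = (\<integral>\<^sup>+x. ?\<sigma> x * indicator ?Q x \<partial>lebesgue)"
  have A: "ennreal (U / ?V) * epowr (S / ennreal ?V) (p - 1) \<le> Ap_const p u v"
  proof -
    have "nn_average ?Q (\<lambda>x. ennreal (u x)) * epowr (nn_average ?Q ?\<sigma>) (p - 1) \<le> Ap_const p u v"
      unfolding Ap_const_def by (rule SUP_upper2[of "(a, l)"]) (use l in auto)
    moreover have "nn_average ?Q (\<lambda>x. ennreal (u x)) = ennreal (U / ?V)"
      using U V by (simp add: nn_average_def wmeasure_def eV divide_ennreal)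
    ultimately show ?thesis by (simp add: nn_average_def S_def eV)
  qed
  show ?thesis
  proof (cases "U = 0")
    case False
    then have U0: "0 < U" using U by simp
    \<comment> \<open>An infinite integral of the dual weight, combined with \<open>U > 0\<close>,
      would make the constant of the pair infinite.\<close>
    have "S \<noteq> top"
    proof
      assume "S = top"
      then have "epowr (S / ennreal ?V) (p - 1) = top"
        using p by (simp add: epowr_def ennreal_top_divide)
      then have "Ap_const p u v = top"
        using A U0 V l by (simp add: ennreal_mult_top top_unique)
      with uv show False by (simp add: Ap_pair_def)
    qed
    then obtain J where J: "S = ennreal J" "0 \<le> J" by (cases S) auto
    \<comment> \<open>A negative power of a finite value is never 0 (it is \<open>top\<close> where
      \<open>v\<close> vanishes), so its integral over a cube of positive volume is
      positive.\<close>
    have "J \<noteq> 0"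
    proof
      assume "J = 0"
      have r: "1 - p / (p - 1) < 0" using p by (simp add: field_simps)
      have \<sigma>: "?\<sigma> = (\<lambda>x. if v x = 0 then top else ennreal (v x powr (1 - p / (p - 1))))"
        using epowr_negative[OF r v0] by (simp add: fun_eq_iff)
      have "?\<sigma> \<in> borel_measurable lebesgue" unfolding \<sigma> by measurable
      then have "(\<lambda>x. ?\<sigma> x * indicator ?Q x) \<in> borel_measurable lebesgue" by measurable
      moreover have "S = 0" using J \<open>J = 0\<close> by simp
      ultimately have "AE x in lebesgue. ?\<sigma> x * indicator ?Q x = 0"
        unfolding S_def by (simp add: nn_integral_0_iff_AE)
      then have "AE x in lebesgue. x \<notin> ?Q"
      proof eventually_elim
        case (elim x)
        have "?\<sigma> x \<noteq> 0" using v0[of x] by (simp add: fun_cong[OF \<sigma>, of x])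
        with elim show ?case by (auto simp: indicator_def)
      qed
      then have "emeasure lebesgue ?Q = 0" using AE_iff_null_sets[of ?Q lebesgue] by auto
      with eV V l show False by simp
    qed
    then have J0: "0 < J" using J by simp
    have hoelder: "ennreal (T powr p) \<le> ennreal (J powr (p - 1)) * N"
      unfolding N_def using p v0 g T J0 J
      by (intro dual_weight_hoelder) (auto simp: S_def)
    have "epowr (S / ennreal ?V) (p - 1) = ennreal ((J / ?V) powr (p - 1))"
      using J0 V p by (simp add: J divide_ennreal epowr_positive)
    with A have A': "ennreal (U / ?V * (J / ?V) powr (p - 1)) \<le> Ap_const p u v"
    proof -
      have "0 \<le> U / ?V" using U0 V by simp
      from ennreal_mult'[OF this] A \<open>epowr (S / ennreal ?V) (p - 1) = _\<close> show ?thesis by (simp only:)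
    qed
    have "wmeasure u ?Q * ennreal ((T / ?V) powr p) = ennreal (U / ?V powr p) * ennreal (T powr p)"
    proof -
      have "U * (T / ?V) powr p = U / ?V powr p * T powr p" using V T by (simp add: powr_divide)
      moreover have "0 \<le> U / ?V powr p" using U by simp
      ultimately show ?thesis
        using U by (simp only: ennreal_mult'[symmetric])
    qed
    also have "\<dots> \<le> ennreal (U / ?V powr p) * (ennreal (J powr (p - 1)) * N)"
      by (intro mult_left_mono hoelder) simp
    also have "\<dots> = ennreal (U / ?V powr p * J powr (p - 1)) * N"
    proof -
      have "0 \<le> U / ?V powr p" using U by simp
      from ennreal_mult'[OF this] show ?thesis by (simp only: mult.assoc)
    qed
    also have "U / ?V powr p * J powr (p - 1) = U / ?V * (J / ?V) powr (p - 1)"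
    proof -
      have "?V powr p = ?V powr (p - 1) * ?V" using V by (simp only: powr_minus_one_mult less_imp_le)
      then show ?thesis using V J0 by (simp add: powr_divide)
    qed
    also have "ennreal (U / ?V * (J / ?V) powr (p - 1)) * N \<le> Ap_const p u v * N"
      by (intro mult_right_mono A') simp
    finally show ?thesis by (simp add: N_def)
  qed (simp add: U)
qed

lemma epowr_mono:
  assumes "x \<le> y" "0 < r"
  shows "epowr x r \<le> epowr y r"
proof (cases y)
  case (real b)
  then obtain a where "x = ennreal a" "0 \<le> a" using assms(1) by (cases x) (auto simp: top_unique)
  with real assms show ?thesis by (auto simp: epowr_positive intro!: ennreal_leI powr_mono2)
qed (use assms in \<open>auto simp: epowr_def\<close>)

text \<open>The product \<open>0 * top = 0\<close> causes no exception: a positive power fixes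
  \<open>0\<close> and \<open>top\<close>, so both sides are 0.\<close>

lemma epowr_mult:
  assumes "0 < r"
  shows "epowr (x * y) r = epowr x r * epowr y r"
proof (cases x; cases y)
  fix a b assume "x = ennreal a" "0 \<le> a" "y = ennreal b" "0 \<le> b"
  then show ?thesis
    using assms by (simp add: ennreal_mult[symmetric] epowr_positive powr_mult)
qed (use assms in \<open>auto simp: epowr_def ennreal_mult_top ennreal_top_mult ennreal_mult_eq_top_iff\<close>)

lemma grad_norm_nonneg: "0 \<le> grad_norm m f x"
  unfolding grad_norm_def by (intro sum_nonneg) simp

lemma weak_derivative_locally_integrable:
  assumes "sobolev_loc m f" "midx_order \<sigma> \<le> m"
  shows "locally_integrable (weak_derivative \<sigma> f)"
proof -
  have "\<exists>g. has_weak_derivative f \<sigma> g" using assms by (simp add: sobolev_loc_def)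
  from someI_ex[OF this] have "has_weak_derivative f \<sigma> (weak_derivative \<sigma> f)"
    by (simp add: weak_derivative_def)
  then show ?thesis by (simp add: has_weak_derivative_def)
qed

lemma grad_norm_locally_integrable:
  fixes f :: "real ^ 'n::finite \<Rightarrow> real"
  assumes "sobolev_loc m f"
  shows "locally_integrable (grad_norm m f)"
  unfolding locally_integrable_def
proof (intro allI impI)
  fix S :: "(real ^ 'n) set" assume S: "compact S"
  have "set_integrable lebesgue S (\<lambda>x. \<bar>weak_derivative \<sigma> f x\<bar>)" if "midx_order \<sigma> = m" for \<sigma>
    using weak_derivative_locally_integrable[OF assms, of \<sigma>] that S
    by (intro set_integrable_abs) (simp add: locally_integrable_def)
  then show "set_integrable lebesgue S (grad_norm m f)"
    unfolding grad_norm_def[abs_def] set_integrable_def real_scaleR_def sum_distrib_left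
    by (intro Bochner_Integration.integrable_sum) simp
qed

text \<open>The series \<open>\<Sum>k. 2\<^sup>-\<^sup>k * A k\<close> is estimated in the \<open>p\<close>-th power by convexity; this costs only
  the factor \<open>2\<close>, uniformly in \<open>p\<close>.\<close>

lemma telescoping_powr_bound:
  fixes q A :: "nat \<Rightarrow> real"
  assumes lim: "(\<lambda>k. y - q k) \<longlonglongrightarrow> 0" and step: "\<And>k. \<bar>q (Suc k) - q k\<bar> \<le> D * (1 / 2) ^ k * A k"
    and D: "0 < D" and A: "\<And>k. 0 \<le> A k" and p: "1 < p"
  shows "ennreal (\<bar>y - q 0\<bar> powr p) \<le> ennreal ((2 * D) powr p) * (\<Sum>k. ennreal ((1 / 2) ^ Suc k) * ennreal (A k powr p))"
proof -
  define w where "w k = (1 / 2 :: real) ^ Suc k * A k powr p" for k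
  have w: "0 \<le> w k" for k by (simp add: w_def)
  have series: "(\<Sum>k. ennreal ((1 / 2) ^ Suc k) * ennreal (A k powr p)) = (\<Sum>k. ennreal (w k))"
    unfolding w_def by (intro suminf_cong ennreal_mult[symmetric]) auto
  show ?thesis
  \<comment> \<open>A divergent series makes the right side \<open>top\<close>, because
    \<open>(2 * D) powr p\<close> is positive; otherwise the estimate can be carried out in the
    reals.\<close>
  proof (cases "(\<Sum>k. ennreal (w k)) = top")
    case True
    then show ?thesis unfolding series using D by (simp add: ennreal_mult_top)
  next
    case False
    then have sw: "summable w" using w by (intro summable_suminf_not_top)
    define R where "R = (\<Sum>k. w k)"
    have R: "(\<Sum>k. ennreal (w k)) = ennreal R" unfolding R_def by (rule suminf_ennreal2[OF w sw])
    have R0: "0 \<le> R" unfolding R_def by (rule suminf_nonneg[OF sw w])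
    have partial: "\<bar>y - q 0\<bar> \<le> \<bar>y - q K\<bar> + 2 * D * R powr (1 / p)" for K
    proof -
      have "\<bar>q K - q 0\<bar> \<le> (\<Sum>k<K. D * (1 / 2) ^ k * A k)"
      proof (induction K)
        case (Suc K)
        have "\<bar>q (Suc K) - q 0\<bar> \<le> \<bar>q (Suc K) - q K\<bar> + \<bar>q K - q 0\<bar>" by linarith
        also have "\<dots> \<le> D * (1 / 2) ^ K * A K + (\<Sum>k<K. D * (1 / 2) ^ k * A k)"
          by (intro add_mono step Suc)
        finally show ?case by simp
      qed simp
      \<comment> \<open>Replacing \<open>(1 / 2) ^ k\<close> by twice \<open>(1 / 2) ^ Suc k\<close>
        brings the total mass of the weights below 1, as Jensen's inequality requires. This is the
        origin of the factor 2.\<close>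
      also have "\<dots> = 2 * D * (\<Sum>k<K. (1 / 2) ^ Suc k * A k)"
        by (simp add: sum_distrib_left mult.assoc)
      also have "(\<Sum>k<K. (1 / 2) ^ Suc k * A k) \<le> R powr (1 / p)"
      proof -
        have S: "0 \<le> (\<Sum>k<K. (1 / 2) ^ Suc k * A k)" using A by (intro sum_nonneg) simp
        have "(\<Sum>k<K. (1 / 2) ^ Suc k * A k) powr p \<le> (\<Sum>k<K. w k)"
          unfolding w_def by (rule powr_weighted_sum_le[OF A p])
        also have "\<dots> \<le> R" unfolding R_def using w by (intro sum_le_suminf sw) auto
        finally have "((\<Sum>k<K. (1 / 2) ^ Suc k * A k) powr p) powr (1 / p) \<le> R powr (1 / p)"
          using p by (intro powr_mono2) auto
        then show ?thesis using S p by (simp add: powr_powr)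
      qed
      finally have "\<bar>q K - q 0\<bar> \<le> 2 * D * R powr (1 / p)" using D by (simp add: mult_left_mono)
      then show ?thesis by linarith
    qed
    have "(\<lambda>K. \<bar>y - q K\<bar> + 2 * D * R powr (1 / p)) \<longlonglongrightarrow> \<bar>0\<bar> + 2 * D * R powr (1 / p)"
      by (intro tendsto_intros lim)
    then have "\<bar>y - q 0\<bar> \<le> 2 * D * R powr (1 / p)"
      using LIMSEQ_le_const[of _ _ "\<bar>y - q 0\<bar>"] partial by fastforce
    then have "\<bar>y - q 0\<bar> powr p \<le> (2 * D * R powr (1 / p)) powr p"
      using p by (intro powr_mono2) auto
    also have "\<dots> = (2 * D) powr p * R"
      using D R0 p by (simp add: powr_mult powr_powr)
    finally show ?thesis
      unfolding series R using R0 by (simp add: ennreal_mult[symmetric] ennreal_leI)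
  qed
qed

section \<open>Summation over the dyadic generations\<close>

lemma suminf_half_powers: "(\<Sum>k. ennreal ((1 / 2) ^ Suc k)) = 1"
proof -
  have "(\<lambda>k. (1 / 2 :: real) ^ Suc k) sums 1" by (rule power_half_series)
  then show ?thesis by (subst suminf_ennreal_eq[of _ 1]) auto
qed

text \<open>The assertion in \<open>p\<close>-th powers, before normalisation by the measure of the
  cube. The constant \<open>D\<close> is fixed before \<open>p\<close>, the weights, the function
  and the cube; the exponent acts only on the whole factor \<open>D * l ^ m\<close>.\<close>

lemma two_weight_estimate:
  assumes m: "1 \<le> m"
  obtains D where "0 < D"
    "\<And>(p::real) (u :: real ^ 'n::finite \<Rightarrow> real) v f a l.
       1 < p \<Longrightarrow> weight u \<Longrightarrow> weight v \<Longrightarrow> Ap_pair p u v \<Longrightarrow> sobolev_loc m f \<Longrightarrow> 0 < l \<Longrightarrow>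
       (\<integral>\<^sup>+x. indicator (cube a l) x * ennreal (\<bar>f x - poly_proj (m - 1) (cube a l) f x\<bar> powr p * u x) \<partial>lebesgue)
       \<le> ennreal ((D * l ^ m) powr p) * (Ap_const p u v
         * (\<integral>\<^sup>+x. indicator (cube a l) x * ennreal (grad_norm m f x powr p * v x) \<partial>lebesgue))"
proof -
  obtain K C where K: "0 \<le> K" and C: "0 \<le> C"
    and poly: "\<And>(a :: real ^ 'n) l f. 0 < l \<Longrightarrow> locally_integrable f \<Longrightarrow>
       poly_proj (m - 1) (cube a l) f \<in> polys_upto (m - 1)"
    and proj: "\<And>(a :: real ^ 'n) l f q x. 0 < l \<Longrightarrow> locally_integrable f \<Longrightarrow>
       q \<in> polys_upto (m - 1) \<Longrightarrow> x \<in> cube a l \<Longrightarrow>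
       ennreal \<bar>poly_proj (m - 1) (cube a l) f x - q x\<bar>
       \<le> ennreal (K / l ^ CARD('n)) * (\<integral>\<^sup>+y. indicator (cube a l) y * ennreal \<bar>f y - q y\<bar> \<partial>lebesgue)"
    and poincare: "\<And>(a :: real ^ 'n) l f. 0 < l \<Longrightarrow> sobolev_loc m f \<Longrightarrow>
       (\<integral>\<^sup>+x. indicator (cube a l) x * ennreal \<bar>f x - poly_proj (m - 1) (cube a l) f x\<bar> \<partial>lebesgue)
       \<le> ennreal (C * l ^ m) * (\<integral>\<^sup>+x. indicator (cube a l) x * ennreal (grad_norm m f x) \<partial>lebesgue)"
    using projection_poincare[OF m, where 'n = 'n] by blast
  \<comment> \<open>\<open>K\<close> bounds the projection on a child cube, \<open>C\<close> is the
    Poincare constant on its parent and \<open>2 ^ CARD('n)\<close> the ratio of their volumes. The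
    summand 1 only secures positivity.\<close>
  define D where "D = K * C * 2 ^ CARD('n) + 1"
  have D: "0 < D" using K C by (simp add: D_def add_nonneg_pos)
  show ?thesis
  proof (rule that[of "2 * D"])
    show "0 < 2 * D" using D by simp
    fix p :: real and u v f :: "real ^ 'n \<Rightarrow> real" and a :: "real ^ 'n" and l :: real
    assume p: "1 < p" and u: "weight u" and v: "weight v" and uv: "Ap_pair p u v"
      and f: "sobolev_loc m f" and l: "0 < l"
    have f_loc: "locally_integrable f" using f by (simp add: sobolev_loc_def)
    define g where "g = grad_norm m f"
    have g_loc: "locally_integrable g" unfolding g_def by (rule grad_norm_locally_integrable[OF f])
    have g0: "0 \<le> g x" for x by (simp add: g_def grad_norm_nonneg)
    have [measurable]: "f \<in> borel_measurable lebesgue" "g \<in> borel_measurable lebesgue"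
      "u \<in> borel_measurable lebesgue" "v \<in> borel_measurable lebesgue"
      using f_loc g_loc u v by (auto simp: locally_integrable_measurable weight_measurable)
    have u0: "0 \<le> u x" for x using u by (simp add: weight_def)
    have cell_m[measurable]: "dyadic_cell a l k j \<in> sets lebesgue" for k j
      using dyadic_cell_measurable[of a l k j] by simp
    define s where "s k = l / 2 ^ k" for k :: nat
    have s: "0 < s k" for k using l by (simp add: s_def)
    define Q where "Q k j = dyadic_cube a l k j" for k j
    have Q: "Q k j = cube (dyadic_corner a l k j) (s k)" for k j
      by (simp add: Q_def dyadic_cube_def s_def)
    define P where "P k j = poly_proj (m - 1) (Q k j) f" for k j
    have P_poly: "P k j \<in> polys_upto (m - 1)" for k j
      unfolding P_def Q by (rule poly[OF s f_loc])
    have [measurable]: "P k j \<in> borel_measurable lebesgue" for k j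
      using borel_measurable_continuous_onI[OF polys_upto_continuous[OF P_poly[of k j]]]
      by (intro measurable_completion) simp
    define T where "T k j = enn2real (\<integral>\<^sup>+x. indicator (Q k j) x * ennreal (g x) \<partial>lebesgue)" for k j
    have T: "(\<integral>\<^sup>+x. indicator (Q k j) x * ennreal (g x) \<partial>lebesgue) = ennreal (T k j)" "0 \<le> T k j" for k j
      using locally_integrable_nn_finite[OF g_loc, of "dyadic_corner a l k j" "s k"] g0
      unfolding T_def Q by (simp_all add: less_top)
    define A where "A k j = T k j / s k ^ CARD('n)" for k j
    have A0: "0 \<le> A k j" for k j using T(2) s[of k] by (simp add: A_def)
    \<comment> \<open>Since \<open>m \<ge> 1\<close>, the gain in side length yields at least one
      factor \<open>1 / 2\<close> per generation, and a single one suffices for convergence.\<close>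
    have sm: "s k ^ m \<le> l ^ m * (1 / 2) ^ k" for k
    proof -
      have "((1 / 2 :: real) ^ k) ^ m \<le> ((1 / 2) ^ k) ^ 1"
        using m by (intro power_decreasing) (auto simp: power_le_one)
      then show ?thesis using l by (simp add: s_def power_divide divide_simps mult_left_mono)
    qed
    let ?cell = "dyadic_cell a l 0 (\<lambda>_. 0)"
    define pos where "pos k x = dyadic_position a l k x" for k x
    define q where "q x k = P k (pos k x) x" for x k
    have in_cube: "x \<in> Q k (pos k x)" if "x \<in> ?cell" for x k
      using mem_dyadic_cell_iff[OF l dyadic_position_index[OF l that, where k = k], where x = x and a = a] that
        dyadic_cell_subset[of a l k "pos k x"]
      by (auto simp: Q_def pos_def)
    have q_0: "q x 0 = poly_proj (m - 1) (cube a l) f x" if "x \<in> ?cell" for x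
    proof -
      have "pos 0 x = (\<lambda>_. 0)"
        using mem_dyadic_cell_iff[OF l, where j = "\<lambda>_. 0" and k = 0 and x = x and a = a] that by (simp add: dyadic_index_def pos_def)
      then show ?thesis by (simp add: q_def P_def Q_def dyadic_cube_0)
    qed
    have poincare_kj: "(\<integral>\<^sup>+x. indicator (Q k j) x * ennreal \<bar>f x - P k j x\<bar> \<partial>lebesgue)
        \<le> ennreal (C * s k ^ m) * (\<integral>\<^sup>+x. indicator (Q k j) x * ennreal (g x) \<partial>lebesgue)" for k j
      unfolding Q P_def g_def by (rule poincare[OF s f])

    \<comment> \<open>The polynomial of generation \<open>k\<close> serves as comparison polynomial
      for the projection on the child cube. The error \<open>\<bar>f - P k\<bar>\<close> is then
      integrated over the parent instead, where the Poincare inequality is available.\<close>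
    have step: "\<bar>q x (Suc k) - q x k\<bar> \<le> (D * l ^ m) * (1 / 2) ^ k * A k (pos k x)" if x: "x \<in> ?cell" for x k
    proof -
      let ?j = "pos k x" and ?j' = "pos (Suc k) x"
      have nested: "Q (Suc k) ?j' \<subseteq> Q k ?j"
        unfolding Q_def pos_def by (rule dyadic_nested[OF l x])
      have "ennreal \<bar>q x (Suc k) - q x k\<bar> \<le> ennreal (K / s (Suc k) ^ CARD('n))
          * (\<integral>\<^sup>+y. indicator (Q (Suc k) ?j') y * ennreal \<bar>f y - P k ?j y\<bar> \<partial>lebesgue)"
        unfolding q_def P_def[of "Suc k"] Q
        by (rule proj[OF s f_loc P_poly in_cube[OF x, of "Suc k", unfolded Q]])
      also have "\<dots> \<le> ennreal (K / s (Suc k) ^ CARD('n))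
          * (\<integral>\<^sup>+y. indicator (Q k ?j) y * ennreal \<bar>f y - P k ?j y\<bar> \<partial>lebesgue)"
        using nested by (intro mult_left_mono nn_integral_mono) (auto simp: indicator_def)
      also have "\<dots> \<le> ennreal (K / s (Suc k) ^ CARD('n)) * (ennreal (C * s k ^ m) * ennreal (T k ?j))"
        using poincare_kj[of k ?j] by (intro mult_left_mono) (simp_all add: T)
      also have "\<dots> = ennreal (K / s (Suc k) ^ CARD('n) * (C * s k ^ m * T k ?j))"
        using K C T(2) s[of k] s[of "Suc k"] by (simp add: ennreal_mult[symmetric])
      finally have "\<bar>q x (Suc k) - q x k\<bar> \<le> K / s (Suc k) ^ CARD('n) * (C * s k ^ m * T k ?j)"
        using K C T(2)[of k ?j] s[of k] s[of "Suc k"] by (subst (asm) ennreal_le_iff) auto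
      also have "\<dots> = (K * C * 2 ^ CARD('n)) * s k ^ m * A k ?j"
      proof -
        have "s k = 2 * s (Suc k)" by (simp add: s_def)
        then have "s k ^ CARD('n) = 2 ^ CARD('n) * s (Suc k) ^ CARD('n)" by (simp only: power_mult_distrib)
        then show ?thesis using s[of "Suc k"] by (simp add: A_def)
      qed
      also have "\<dots> \<le> D * (l ^ m * (1 / 2) ^ k) * A k ?j"
        using sm[of k] K C D s[of k] A0 by (intro mult_right_mono mult_mono) (auto simp: D_def)
      finally show ?thesis by (simp add: mult.assoc)
    qed

    \<comment> \<open>On the cell of generation 0 this is \<open>\<bar>f x - q x k\<bar>\<close>; as
      a finite sum over cells it is visibly measurable.\<close>
    define E where "E k x = (\<Sum>j\<in>dyadic_index k. indicator (dyadic_cell a l k j) x * ennreal \<bar>f x - P k j x\<bar>)" for k x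
    have [measurable]: "E k \<in> borel_measurable lebesgue" for k
      unfolding E_def by measurable
    define G where "G = (\<integral>\<^sup>+x. indicator (cube a l) x * ennreal (g x) \<partial>lebesgue)"
    have "G < top" unfolding G_def using locally_integrable_nn_finite[OF g_loc, of a l] g0 by simp
    have E_int: "(\<integral>\<^sup>+x. E k x \<partial>lebesgue) \<le> ennreal (C * l ^ m * (1 / 2) ^ k) * G" for k
    proof -
      have "(\<integral>\<^sup>+x. E k x \<partial>lebesgue)
        = (\<Sum>j\<in>dyadic_index k. \<integral>\<^sup>+x. indicator (dyadic_cell a l k j) x * ennreal \<bar>f x - P k j x\<bar> \<partial>lebesgue)"
        unfolding E_def by (rule nn_integral_sum) measurable
      also have "\<dots> \<le> (\<Sum>j\<in>dyadic_index k. ennreal (C * s k ^ m) * (\<integral>\<^sup>+x. indicator (Q k j) x * ennreal (g x) \<partial>lebesgue))"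
        unfolding nn_integral_dyadic_cell by (intro sum_mono poincare_kj[unfolded Q_def] | simp add: Q_def)+
      also have "\<dots> = ennreal (C * s k ^ m) * G"
        unfolding sum_distrib_left[symmetric] Q_def G_def by (subst dyadic_cubes_sum[OF l]) auto
      also have "\<dots> \<le> ennreal (C * l ^ m * (1 / 2) ^ k) * G"
        using mult_left_mono[OF sm[of k] C] by (intro mult_right_mono ennreal_leI) (auto simp: mult.assoc)
      finally show ?thesis .
    qed
    have "(\<integral>\<^sup>+x. (\<Sum>k. E k x) \<partial>lebesgue) = (\<Sum>k. \<integral>\<^sup>+x. E k x \<partial>lebesgue)"
      by (rule nn_integral_suminf) measurable
    also have "\<dots> \<le> (\<Sum>k. ennreal (C * l ^ m * (1 / 2) ^ k) * G)"
      by (intro suminf_le E_int) auto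
    also have "\<dots> = (\<Sum>k. ennreal (C * l ^ m * (1 / 2) ^ k)) * G"
      by (rule ennreal_suminf_multc)
    also have "(\<Sum>k. ennreal (C * l ^ m * (1 / 2) ^ k)) = ennreal (C * l ^ m * 2)"
    proof (rule suminf_ennreal_eq)
      show "(\<lambda>k. C * l ^ m * (1 / 2) ^ k) sums (C * l ^ m * 2)"
        using geometric_sums[of "1 / 2 :: real"] by (intro sums_mult) simp
    qed (use C l in simp)
    also have "ennreal (C * l ^ m * 2) * G < top"
      using \<open>G < top\<close> by (simp add: ennreal_mult_less_top)
    finally have "(\<integral>\<^sup>+x. (\<Sum>k. E k x) \<partial>lebesgue) \<noteq> \<infinity>" by simp
    \<comment> \<open>The errors are summable in mean by geometric decay, hence summable at almost
      every point and convergent to 0 there. This takes the place of the Lebesgue differentiation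
      theorem.\<close>
    then have "AE x in lebesgue. (\<Sum>k. E k x) \<noteq> \<infinity>"
      by (intro nn_integral_noteq_infinite) measurable
    then have "AE x in lebesgue. x \<in> ?cell \<longrightarrow> (\<lambda>k. f x - q x k) \<longlonglongrightarrow> 0"
    proof eventually_elim
      case (elim x)
      show ?case
      proof
        assume x: "x \<in> ?cell"
        have "E k x = ennreal \<bar>f x - q x k\<bar>" for k
          unfolding E_def dyadic_cells_sum[OF l] using x by (simp add: q_def pos_def)
        with elim have "(\<Sum>k. ennreal \<bar>f x - q x k\<bar>) \<noteq> top" by simp
        then have "summable (\<lambda>k. \<bar>f x - q x k\<bar>)" by (intro summable_suminf_not_top) auto
        then have "(\<lambda>k. \<bar>f x - q x k\<bar>) \<longlonglongrightarrow> 0" by (rule summable_LIMSEQ_zero)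
        then show "(\<lambda>k. f x - q x k) \<longlonglongrightarrow> 0" by (simp add: tendsto_rabs_zero_iff)
      qed
    qed
    then have pointwise: "AE x in lebesgue. indicator ?cell x * ennreal (\<bar>f x - poly_proj (m - 1) (cube a l) f x\<bar> powr p * u x)
      \<le> ennreal ((2 * D * l ^ m) powr p) * (\<Sum>k. ennreal ((1 / 2) ^ Suc k)
          * (\<Sum>j\<in>dyadic_index k. indicator (dyadic_cell a l k j) x * (ennreal (A k j powr p) * ennreal (u x))))"
    proof eventually_elim
      case (elim x)
      show ?case
      proof (cases "x \<in> ?cell")
        case True
        have "ennreal (\<bar>f x - q x 0\<bar> powr p)
          \<le> ennreal ((2 * (D * l ^ m)) powr p) * (\<Sum>k. ennreal ((1 / 2) ^ Suc k) * ennreal (A k (pos k x) powr p))"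
          by (rule telescoping_powr_bound) (use True elim step D l A0 p in auto)
        then have "ennreal (\<bar>f x - q x 0\<bar> powr p) * ennreal (u x)
          \<le> ennreal ((2 * (D * l ^ m)) powr p) * (\<Sum>k. ennreal ((1 / 2) ^ Suc k) * ennreal (A k (pos k x) powr p)) * ennreal (u x)"
          by (rule mult_right_mono) simp
        also have "\<dots> = ennreal ((2 * D * l ^ m) powr p)
            * (\<Sum>k. ennreal ((1 / 2) ^ Suc k) * (ennreal (A k (pos k x) powr p) * ennreal (u x)))"
          by (simp only: mult.assoc ennreal_suminf_multc[symmetric])
        finally show ?thesis
          using True u0[of x] unfolding dyadic_cells_sum[OF l]
          by (simp add: ennreal_mult q_0 pos_def)
      qed simp
    qed
    define N where "N = (\<integral>\<^sup>+x. indicator (cube a l) x * ennreal (g x powr p * v x) \<partial>lebesgue)"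
    \<comment> \<open>The average is constant on each cell, so integrating it against
      \<open>u\<close> produces the measure of the cube, as in \<open>Ap_average_bound\<close>. The
      right sides then add up over the cubes of the generation.\<close>
    have level: "(\<integral>\<^sup>+x. (\<Sum>j\<in>dyadic_index k. indicator (dyadic_cell a l k j) x * (ennreal (A k j powr p) * ennreal (u x))) \<partial>lebesgue)
        \<le> Ap_const p u v * N" for k
    proof -
      have "(\<integral>\<^sup>+x. (\<Sum>j\<in>dyadic_index k. indicator (dyadic_cell a l k j) x * (ennreal (A k j powr p) * ennreal (u x))) \<partial>lebesgue)
        = (\<Sum>j\<in>dyadic_index k. \<integral>\<^sup>+x. indicator (dyadic_cell a l k j) x * (ennreal (A k j powr p) * ennreal (u x)) \<partial>lebesgue)"
        by (rule nn_integral_sum) measurable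
      also have "\<dots> \<le> (\<Sum>j\<in>dyadic_index k. Ap_const p u v
          * (\<integral>\<^sup>+x. indicator (Q k j) x * ennreal (g x powr p * v x) \<partial>lebesgue))"
      proof (rule sum_mono)
        fix j :: "'n \<Rightarrow> nat"
        have [measurable]: "Q k j \<in> sets lebesgue" by (simp add: Q cube_def)
        have "(\<integral>\<^sup>+x. indicator (dyadic_cell a l k j) x * (ennreal (A k j powr p) * ennreal (u x)) \<partial>lebesgue)
          = (\<integral>\<^sup>+x. ennreal (A k j powr p) * (ennreal (u x) * indicator (Q k j) x) \<partial>lebesgue)"
          unfolding nn_integral_dyadic_cell Q_def by (simp add: ac_simps)
        also have "\<dots> = ennreal (A k j powr p) * (\<integral>\<^sup>+x. ennreal (u x) * indicator (Q k j) x \<partial>lebesgue)"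
          by (rule nn_integral_cmult) measurable
        also have "\<dots> = wmeasure u (Q k j) * ennreal (A k j powr p)"
          by (simp add: wmeasure_def mult.commute)
        also have "\<dots> \<le> Ap_const p u v * (\<integral>\<^sup>+x. indicator (Q k j) x * ennreal (g x powr p * v x) \<partial>lebesgue)"
          unfolding Q A_def
          by (rule Ap_average_bound[OF p u v uv s g0 _ T(1)[unfolded Q] T(2)]) measurable
        finally show "(\<integral>\<^sup>+x. indicator (dyadic_cell a l k j) x * (ennreal (A k j powr p) * ennreal (u x)) \<partial>lebesgue)
          \<le> Ap_const p u v * (\<integral>\<^sup>+x. indicator (Q k j) x * ennreal (g x powr p * v x) \<partial>lebesgue)" .
      qed
      also have "\<dots> = Ap_const p u v * N"
        unfolding sum_distrib_left[symmetric] Q_def N_def by (subst dyadic_cubes_sum[OF l]) auto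
      finally show ?thesis .
    qed
    \<comment> \<open>The pointwise bound lives on the half-open cell, where the dyadic position is
      meaningful; passing from the closed cube to it costs a null set.\<close>
    have "(\<integral>\<^sup>+x. indicator (cube a l) x * ennreal (\<bar>f x - poly_proj (m - 1) (cube a l) f x\<bar> powr p * u x) \<partial>lebesgue)
      = (\<integral>\<^sup>+x. indicator ?cell x * ennreal (\<bar>f x - poly_proj (m - 1) (cube a l) f x\<bar> powr p * u x) \<partial>lebesgue)"
      by (simp only: nn_integral_dyadic_cell dyadic_cube_0)
    also have "\<dots> \<le> (\<integral>\<^sup>+x. ennreal ((2 * D * l ^ m) powr p) * (\<Sum>k. ennreal ((1 / 2) ^ Suc k)
          * (\<Sum>j\<in>dyadic_index k. indicator (dyadic_cell a l k j) x * (ennreal (A k j powr p) * ennreal (u x)))) \<partial>lebesgue)"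
      by (rule nn_integral_mono_AE[OF pointwise])
    also have "\<dots> = ennreal ((2 * D * l ^ m) powr p) * (\<Sum>k. ennreal ((1 / 2) ^ Suc k)
          * (\<integral>\<^sup>+x. (\<Sum>j\<in>dyadic_index k. indicator (dyadic_cell a l k j) x * (ennreal (A k j powr p) * ennreal (u x))) \<partial>lebesgue))"
      by (subst nn_integral_cmult, measurable, subst nn_integral_suminf, measurable,
          subst nn_integral_cmult, measurable)
    also have "\<dots> \<le> ennreal ((2 * D * l ^ m) powr p) * (\<Sum>k. ennreal ((1 / 2) ^ Suc k) * (Ap_const p u v * N))"
      by (intro mult_left_mono suminf_le level) auto
    also have "\<dots> = ennreal ((2 * D * l ^ m) powr p) * (Ap_const p u v * N)"
      by (simp only: ennreal_suminf_multc suminf_half_powers mult_1)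
    finally show "(\<integral>\<^sup>+x. indicator (cube a l) x * ennreal (\<bar>f x - poly_proj (m - 1) (cube a l) f x\<bar> powr p * u x) \<partial>lebesgue)
       \<le> ennreal ((2 * D * l ^ m) powr p) * (Ap_const p u v
         * (\<integral>\<^sup>+x. indicator (cube a l) x * ennreal (grad_norm m f x powr p * v x) \<partial>lebesgue))"
      by (simp only: N_def g_def)
  qed
qed

section \<open>Normalisation by the measure of the cube and extraction of the root\<close>

theorem corollary1p25:
  fixes m :: nat
  assumes "1 \<le> m"
  shows "\<exists>C>0. \<forall>(p::real) (u :: real ^ 'n \<Rightarrow> real) (v :: real ^ 'n \<Rightarrow> real).
           1 < p \<longrightarrow> weight u \<longrightarrow> weight v \<longrightarrow> Ap_pair p u v \<longrightarrow> Ainfty_weight u \<longrightarrow>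
           (\<forall>(f :: real ^ 'n \<Rightarrow> real) (a :: real ^ 'n) (l::real).
              sobolev_loc m f \<longrightarrow> 0 < l \<longrightarrow>
              (let Q = cube a l in
                 epowr ((\<integral>\<^sup>+x\<in>Q. ennreal (\<bar>f x - poly_proj (m - 1) Q f x\<bar> powr p * u x) \<partial>lebesgue)
                        / wmeasure u Q) (1 / p)
                 \<le> ennreal C * epowr (Ap_const p u v) (1 / p) * ennreal (l ^ m)
                   * epowr ((\<integral>\<^sup>+x\<in>Q. ennreal (grad_norm m f x powr p * v x) \<partial>lebesgue)
                            / wmeasure u Q) (1 / p)))"
proof -
  obtain D where D: "0 < D"
    and est: "\<And>(p::real) (u :: real ^ 'n \<Rightarrow> real) v f a l.
       1 < p \<Longrightarrow> weight u \<Longrightarrow> weight v \<Longrightarrow> Ap_pair p u v \<Longrightarrow> sobolev_loc m f \<Longrightarrow> 0 < l \<Longrightarrow>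
       (\<integral>\<^sup>+x. indicator (cube a l) x * ennreal (\<bar>f x - poly_proj (m - 1) (cube a l) f x\<bar> powr p * u x) \<partial>lebesgue)
       \<le> ennreal ((D * l ^ m) powr p) * (Ap_const p u v
         * (\<integral>\<^sup>+x. indicator (cube a l) x * ennreal (grad_norm m f x powr p * v x) \<partial>lebesgue))"
    using two_weight_estimate[OF assms, where 'n = 'n] by blast
  show ?thesis
    unfolding Let_def
  proof (intro exI[of _ D] conjI allI impI D)
    fix p :: real and u v f :: "real ^ 'n \<Rightarrow> real" and a :: "real ^ 'n" and l :: real
    assume p: "1 < p" and "weight u" "weight v" "Ap_pair p u v" "sobolev_loc m f" and l: "0 < l"
    define W where "W = wmeasure u (cube a l)"
    define L where "L = (\<integral>\<^sup>+x\<in>cube a l. ennreal (\<bar>f x - poly_proj (m - 1) (cube a l) f x\<bar> powr p * u x) \<partial>lebesgue)"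
    define N where "N = (\<integral>\<^sup>+x\<in>cube a l. ennreal (grad_norm m f x powr p * v x) \<partial>lebesgue)"
    have "L \<le> ennreal ((D * l ^ m) powr p) * (Ap_const p u v * N)"
      using est[of p u v f l a] \<open>weight u\<close> \<open>weight v\<close> \<open>Ap_pair p u v\<close> \<open>sobolev_loc m f\<close> p l
      by (simp add: L_def N_def mult.commute[of _ "indicator _ _"])
    \<comment> \<open>Division is multiplication by the inverse in the extended sense, hence
      monotone also when \<open>W = 0\<close>.\<close>
    then have "L / W \<le> (ennreal ((D * l ^ m) powr p) * (Ap_const p u v * N)) / W"
      unfolding divide_ennreal_def by (rule mult_right_mono) simp
    also have "\<dots> = ennreal ((D * l ^ m) powr p) * (Ap_const p u v * (N / W))"
      unfolding divide_ennreal_def by (simp only: mult.assoc)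
    finally have "epowr (L / W) (1 / p) \<le> epowr (ennreal ((D * l ^ m) powr p) * (Ap_const p u v * (N / W))) (1 / p)"
      using p by (intro epowr_mono) auto
    also have "\<dots> = ennreal (((D * l ^ m) powr p) powr (1 / p)) * (epowr (Ap_const p u v) (1 / p) * epowr (N / W) (1 / p))"
      using p by (simp add: epowr_mult epowr_positive)
    \<comment> \<open>The root undoes the power, so the constant of the theorem is \<open>D\<close>
      itself, free of \<open>p\<close>.\<close>
    also have "((D * l ^ m) powr p) powr (1 / p) = D * l ^ m"
      using p D l by (simp add: powr_powr)
    also have "ennreal (D * l ^ m) = ennreal D * ennreal (l ^ m)"
      using D l by (intro ennreal_mult) auto
    finally have "epowr (L / W) (1 / p)
      \<le> ennreal D * epowr (Ap_const p u v) (1 / p) * ennreal (l ^ m) * epowr (N / W) (1 / p)"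
      by (simp only: ac_simps)
    then show "epowr ((\<integral>\<^sup>+x\<in>cube a l. ennreal (\<bar>f x - poly_proj (m - 1) (cube a l) f x\<bar> powr p * u x) \<partial>lebesgue)
          / wmeasure u (cube a l)) (1 / p)
      \<le> ennreal D * epowr (Ap_const p u v) (1 / p) * ennreal (l ^ m)
        * epowr ((\<integral>\<^sup>+x\<in>cube a l. ennreal (grad_norm m f x powr p * v x) \<partial>lebesgue)
            / wmeasure u (cube a l)) (1 / p)"
      by (simp only: L_def N_def W_def)
  qed
qed

end
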